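(* Let $J:[0,1]\to[0,\infty)$ with $\int_{\mathbb{Z}_p}J(|x|_p)dx=1$ (extended by zero outside $\mathbb{Z}_p$), with radial Fourier transform $\widehat J(|\xi|_p)$, and $\boldsymbol{J}\varphi=J(|x|_p)\ast\varphi-\varphi$. For $r\le 0$, $b\in\mathbb{Q}_p/\mathbb{Z}_p$ with $bp^{-r}\in\mathbb{Z}_p$, and $k\in\{1,\dots,p-1\}$ let $\Psi_{rbk}(x)=p^{-r/2}\chi_p(p^{-1}k(p^rx-b))\Omega(|p^rx-b|_p)$. Then the initial value problem $\Psi(\cdot,t)\in L^2(\mathbb{Z}_p)$ for fixed $t\ge0$; $\Psi(x,\cdot)\in C^1(0,\infty)$ for fixed $x\in\mathbb{Z}_p$; $i\frac{\partial\Psi(x,t)}{\partial t}=-\boldsymbol{J}\Psi(x,t)$; $\|\Psi(\cdot,t)\|_2=1$ for all $t\ge0$; $\Psi(x,0)=\psi_0(x)\in L^2(\mathbb{Z}_p)$ with $\|\psi_0\|_2=1$, has a unique solution of the form $\Psi(x,t)=A_0\Omega(|x|_p)+\sum_{k\in\{1,\dots,p-1\}}\sum_{r\le0}\sum_{b\in\mathbb{Q}_p/\mathbb{Z}_p,\ bp^{-r}\in\mathbb{Z}_p}A_{rbk}\,e^{i(\widehat J(p^{1-r})-1)t}\Psi_{rbk}(x)$, where $A_0,A_{rbk}\in\mathbb{C}$ and $\widehat J(p^{1-r})$ denotes the value of $\widehat J$ at $|\xi|_p=p^{1-r}$.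
   Context: $p$ is a fixed prime; Haar measure with $\int_{\mathbb{Z}_p}dx=1$; $\chi_p(y)=\exp(2\pi i\{y\}_p)$; $\mathbb{Q}_p/\mathbb{Z}_p$ is identified with finite sums $\sum_{j=-m}^{-1}x_jp^j$, $x_j\in\{0,\dots,p-1\}$; $\Omega(|p^rx-b|_p)$ is the characteristic function of $bp^{-r}+p^{-r}\mathbb{Z}_p$ and $\Omega(|x|_p)$ that of $\mathbb{Z}_p$. The set $\{\Omega(|x|_p)\}\cup\{\Psi_{rbk}\}$ (with the index ranges above) is an orthonormal basis of $L^2(\mathbb{Z}_p)$. *)

theory Defs
  imports "HOL-Probability.Probability"
begin

text \<open>Model of the p-adic integers: a p-adic integer x = sum_j x_j p^j is represented by
  its digit sequence x :: nat => nat with all digits in {0..p-1}.  The normalised Haar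
  measure on Z_p is the infinite product of the uniform measures on the digit sets;
  its space is exactly the set of digit sequences.\<close>

definition haar :: "nat \<Rightarrow> (nat \<Rightarrow> nat) measure" where
  "haar p = (\<Pi>\<^sub>M j\<in>(UNIV::nat set). uniform_count_measure {..<p})"

definition ztrunc :: "nat \<Rightarrow> (nat \<Rightarrow> nat) \<Rightarrow> nat \<Rightarrow> nat" where
  "ztrunc p x n = (\<Sum>j<n. x j * p ^ j)"

definition zsub :: "nat \<Rightarrow> (nat \<Rightarrow> nat) \<Rightarrow> (nat \<Rightarrow> nat) \<Rightarrow> (nat \<Rightarrow> nat)" where
  "zsub p x y = (\<lambda>j. nat (((int (ztrunc p x (Suc j)) - int (ztrunc p y (Suc j)))
                              mod (int p ^ Suc j)) div (int p ^ j)))"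

definition padic_abs :: "nat \<Rightarrow> (nat \<Rightarrow> nat) \<Rightarrow> real" where
  "padic_abs p x = (if (\<forall>j. x j = 0) then 0 else real p powr (- real (LEAST j. x j \<noteq> 0)))"

text \<open>chi_p(z / p^n) = exp(2 pi i {z/p^n}_p) for z an integer; {z/p^n}_p = (z mod p^n)/p^n.\<close>
definition chi_frac :: "nat \<Rightarrow> nat \<Rightarrow> int \<Rightarrow> complex" where
  "chi_frac p n z = exp (2 * pi * \<i> * complex_of_real (real_of_int (z mod (int p ^ n)) / real p ^ n))"

text \<open>Radial Fourier transform of J(|x|_p) 1_{Z_p}, evaluated at |xi|_p = p^n
  (taking xi = p^(-n)): integral over Z_p of J(|x|_p) chi_p(p^(-n) x) dx.\<close>
definition Jhat :: "nat \<Rightarrow> (real \<Rightarrow> real) \<Rightarrow> nat \<Rightarrow> complex" where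
  "Jhat p J n = (\<integral>x. complex_of_real (J (padic_abs p x)) * chi_frac p n (int (ztrunc p x n)) \<partial>haar p)"

definition Jop :: "nat \<Rightarrow> (real \<Rightarrow> real) \<Rightarrow> ((nat \<Rightarrow> nat) \<Rightarrow> complex) \<Rightarrow> (nat \<Rightarrow> nat) \<Rightarrow> complex" where
  "Jop p J \<phi> x = (\<integral>y. complex_of_real (J (padic_abs p (zsub p x y))) * \<phi> y \<partial>haar p) - \<phi> x"

text \<open>Wavelets Psi_{rbk} with r = -m (m >= 0) and b = beta / p^m, 0 <= beta < p^m
  (this is exactly the set of b in Q_p/Z_p with b p^(-r) in Z_p).
  Omega(|p^r x - b|_p) is the indicator of x in beta + p^m Z_p, i.e. x mod p^m = beta;
  chi_p(p^(-1) k (p^r x - b)) = chi_p(k (x - beta) / p^(m+1)).\<close>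
definition wavelet :: "nat \<Rightarrow> nat \<Rightarrow> nat \<Rightarrow> nat \<Rightarrow> (nat \<Rightarrow> nat) \<Rightarrow> complex" where
  "wavelet p m \<beta> k x =
     complex_of_real (sqrt (real p ^ m))
     * chi_frac p (Suc m) (int k * (int (ztrunc p x (Suc m)) - int \<beta>))
     * (if ztrunc p x m = \<beta> then 1 else 0)"

definition wav_index :: "nat \<Rightarrow> (nat \<times> nat \<times> nat) set" where
  "wav_index p = {(m, \<beta>, k). \<beta> < p ^ m \<and> 1 \<le> k \<and> k \<le> p - 1}"

definition L2 :: "nat \<Rightarrow> ((nat \<Rightarrow> nat) \<Rightarrow> complex) \<Rightarrow> bool" where
  "L2 p f \<longleftrightarrow> f \<in> borel_measurable (haar p) \<and> integrable (haar p) (\<lambda>x. (cmod (f x))\<^sup>2)"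

definition l2norm :: "nat \<Rightarrow> ((nat \<Rightarrow> nat) \<Rightarrow> complex) \<Rightarrow> real" where
  "l2norm p f = sqrt (\<integral>x. (cmod (f x))\<^sup>2 \<partial>haar p)"

definition IVP_solution :: "nat \<Rightarrow> (real \<Rightarrow> real) \<Rightarrow> ((nat \<Rightarrow> nat) \<Rightarrow> complex)
                             \<Rightarrow> ((nat \<Rightarrow> nat) \<Rightarrow> real \<Rightarrow> complex) \<Rightarrow> bool" where
  "IVP_solution p J \<psi>0 \<Psi> \<longleftrightarrow>
     (\<forall>t\<ge>0. L2 p (\<lambda>x. \<Psi> x t)) \<and>
     (AE x in haar p.
        continuous_on {0..} (\<Psi> x) \<and>
        (\<exists>D. (\<forall>t>0. (\<Psi> x has_vector_derivative D t) (at t)) \<and> continuous_on {0<..} D \<and>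
             (\<forall>t>0. \<i> * D t = - Jop p J (\<lambda>y. \<Psi> y t) x))) \<and>
     (\<forall>t\<ge>0. l2norm p (\<lambda>x. \<Psi> x t) = 1) \<and>
     (AE x in haar p. \<Psi> x 0 = \<psi>0 x)"

end

theory Submission
  imports Defs
begin

text \<open>
  On digit sequences the distance of \<open>x\<close> and \<open>y\<close> depends only on the first index at which they
  differ, so \<open>K x y = J(|x - y|\<^sub>p)\<close> is a symmetric Markov kernel with respect to Haar measure. Let
  \<open>T\<close> be its integral operator, so that the operator of the equation is \<open>T - 1\<close>.

  Existence: the series for \<open>exp (\<i> t (T - 1)) \<psi>\<close> converges at almost every point for all \<open>t\<close>
  simultaneously, being dominated by the series for \<open>exp (|t| T) |\<psi>|\<close>, whose \<open>L\<^sup>1\<close> and \<open>L\<^sup>2\<close> norms are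
  at most \<open>exp |t|\<close> times those of \<open>\<psi>\<close>; as a power series in \<open>t\<close> it may be differentiated pointwise.

  Uniqueness: if \<open>w\<close> is a bounded eigenfunction, \<open>T w = \<mu> w\<close>, then the integrated equation, Fubini's
  theorem and the symmetry of \<open>K\<close> give \<open>\<integral>\<Psi>(t) w = exp (\<i> (\<mu> - 1) t) \<integral>\<Psi>(0) w\<close> for every solution
  \<open>\<Psi>\<close>. The wavelets are such eigenfunctions, with eigenvalue the Fourier transform of the kernel.
  Together with the constants they form an orthonormal basis, since every function of finitely many
  digits is a finite combination of them. As the eigenvalues are real, Parseval's identity also shows
  that the norm is preserved.
\<close>

section \<open>Symmetric Markov kernels and their exponential\<close>

text \<open>\<open>J\<close> is only known to be nonnegative with integral 1, so the kernel may be
  unbounded, and for an integrable \<open>f\<close> the integral in \<open>T f x\<close> is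
  meaningful only at almost every \<open>x\<close>. The problem nevertheless asks for
  differentiability in time along almost every fixed \<open>x\<close>. The wavelet expansion is
  controlled in L2 only and cannot be differentiated at a point; this is why existence rests on a
  power series in \<open>t\<close>, while the expansion enters as a property of every solution. The
  price is one exceptional null set that serves uncountably many times and also permits applying
  \<open>T\<close> under the sum. For uniqueness, a solution is given merely as a family of
  sections, with neither joint measurability nor a bound on its time derivative. Continuity in time
  supplies the former; the unit norm, on a probability space, supplies an L1 bound uniform in time.
  Integrating the equation first then avoids differentiating under the integral.\<close>

locale symmetric_markov_kernel = prob_space M for M :: "'a measure" +
  fixes K :: "'a \<Rightarrow> 'a \<Rightarrow> real"
  assumes K_measurable: "case_prod K \<in> borel_measurable (M \<Otimes>\<^sub>M M)"
    and K_nonneg: "\<And>x y. x \<in> space M \<Longrightarrow> y \<in> space M \<Longrightarrow> K x y \<ge> 0"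
    and K_sym: "\<And>x y. x \<in> space M \<Longrightarrow> y \<in> space M \<Longrightarrow> K x y = K y x"
    and K_mass: "\<And>x. x \<in> space M \<Longrightarrow> (\<integral>\<^sup>+y. ennreal (K x y) \<partial>M) = 1"
begin

declare K_measurable [measurable]

lemma K_measurable' [measurable (raw)]:
  assumes "f \<in> measurable N M" "g \<in> measurable N M"
  shows "(\<lambda>z. K (f z) (g z)) \<in> borel_measurable N"
  using measurable_compose[OF measurable_Pair[OF assms] K_measurable] by simp

sublocale pair: pair_prob_space M M ..

section \<open>The Markov operator and its bounds in L1 and L2\<close>

definition P :: "('a \<Rightarrow> ennreal) \<Rightarrow> 'a \<Rightarrow> ennreal" where
  "P g x = (\<integral>\<^sup>+y. ennreal (K x y) * g y \<partial>M)"

text \<open>The Bochner integral is 0 where the integrand is not integrable, so this is total on all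
  functions; \<open>P\<close> is the companion that iterates without integrability conditions and
  controls it.\<close>

definition T :: "('a \<Rightarrow> complex) \<Rightarrow> 'a \<Rightarrow> complex" where
  "T f x = (\<integral>y. complex_of_real (K x y) * f y \<partial>M)"

lemma P_measurable [measurable]:
  assumes [measurable]: "g \<in> borel_measurable M"
  shows "P g \<in> borel_measurable M"
  unfolding P_def[abs_def] by measurable

lemma T_measurable [measurable]:
  assumes [measurable]: "f \<in> borel_measurable M"
  shows "T f \<in> borel_measurable M"
  unfolding T_def[abs_def] by measurable

lemma P_iter_measurable [measurable]:
  "g \<in> borel_measurable M \<Longrightarrow> (P ^^ n) g \<in> borel_measurable M"
  by (induction n) auto

lemma T_iter_measurable [measurable]:
  "f \<in> borel_measurable M \<Longrightarrow> (T ^^ n) f \<in> borel_measurable M"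
  by (induction n) auto

lemma P_mono: "(\<And>y. y \<in> space M \<Longrightarrow> f y \<le> g y) \<Longrightarrow> P f x \<le> P g x"
  unfolding P_def by (intro nn_integral_mono mult_left_mono) auto

text \<open>Symmetry turns the unit mass of each row of the kernel into unit mass of each column,
  and Tonelli applies because everything is nonnegative.\<close>

lemma nn_integral_P:
  assumes [measurable]: "g \<in> borel_measurable M"
  shows "(\<integral>\<^sup>+x. P g x \<partial>M) = (\<integral>\<^sup>+x. g x \<partial>M)"
proof -
  have "(\<integral>\<^sup>+x. P g x \<partial>M) = (\<integral>\<^sup>+y. (\<integral>\<^sup>+x. ennreal (K x y) * g y \<partial>M) \<partial>M)"
    unfolding P_def by (rule pair.Fubini') measurable
  also have "\<dots> = (\<integral>\<^sup>+y. g y \<partial>M)"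
  proof (rule nn_integral_cong)
    fix y assume y[measurable]: "y \<in> space M"
    have "(\<integral>\<^sup>+x. ennreal (K x y) * g y \<partial>M) = (\<integral>\<^sup>+x. ennreal (K x y) \<partial>M) * g y"
      by (rule nn_integral_multc) measurable
    also have "(\<integral>\<^sup>+x. ennreal (K x y) \<partial>M) = (\<integral>\<^sup>+x. ennreal (K y x) \<partial>M)"
      by (intro nn_integral_cong) (simp add: K_sym y)
    finally show "(\<integral>\<^sup>+x. ennreal (K x y) * g y \<partial>M) = g y" by (simp add: K_mass y)
  qed
  finally show ?thesis .
qed

text \<open>Jensen's inequality for the probability density \<open>K x\<close>, obtained from
  Cauchy-Schwarz by splitting the kernel into two square roots and attaching \<open>g\<close> to one
  of them.\<close>

lemma P_square_le:
  assumes [measurable]: "g \<in> borel_measurable M" and x[measurable]: "x \<in> space M"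
  shows "(P g x)\<^sup>2 \<le> P (\<lambda>y. (g y)\<^sup>2) x"
proof -
  have sq: "ennreal (sqrt (K x y)) * ennreal (sqrt (K x y)) = ennreal (K x y)" if "y \<in> space M" for y
    using K_nonneg[OF x that] by (simp flip: ennreal_mult)
  have "(P g x)\<^sup>2 = (\<integral>\<^sup>+y. ennreal (sqrt (K x y)) * (ennreal (sqrt (K x y)) * g y) \<partial>M)\<^sup>2"
    unfolding P_def
    by (intro arg_cong[where f = "\<lambda>z. z\<^sup>2"] nn_integral_cong) (simp add: sq flip: mult.assoc)
  also have "\<dots> \<le> (\<integral>\<^sup>+y. (ennreal (sqrt (K x y)))\<^sup>2 \<partial>M) * (\<integral>\<^sup>+y. (ennreal (sqrt (K x y)) * g y)\<^sup>2 \<partial>M)"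
    by (rule Cauchy_Schwarz_nn_integral) measurable
  also have "(\<integral>\<^sup>+y. (ennreal (sqrt (K x y)))\<^sup>2 \<partial>M) = (\<integral>\<^sup>+y. ennreal (K x y) \<partial>M)"
    by (intro nn_integral_cong) (simp add: power2_eq_square sq)
  also have "\<dots> = 1" by (rule K_mass[OF x])
  also have "(\<integral>\<^sup>+y. (ennreal (sqrt (K x y)) * g y)\<^sup>2 \<partial>M) = P (\<lambda>y. (g y)\<^sup>2) x"
    unfolding P_def power2_eq_square
    by (intro nn_integral_cong) (metis mult.left_commute mult.assoc sq)
  finally show ?thesis by simp
qed

lemma nn_integral_P_iter:
  "g \<in> borel_measurable M \<Longrightarrow> (\<integral>\<^sup>+x. (P ^^ n) g x \<partial>M) = (\<integral>\<^sup>+x. g x \<partial>M)"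
  by (induction n) (simp_all add: nn_integral_P)

lemma nn_integral_P_iter_square:
  assumes [measurable]: "g \<in> borel_measurable M"
  shows "(\<integral>\<^sup>+x. ((P ^^ n) g x)\<^sup>2 \<partial>M) \<le> (\<integral>\<^sup>+x. (g x)\<^sup>2 \<partial>M)"
proof (induction n)
  case (Suc n)
  have "(\<integral>\<^sup>+x. ((P ^^ Suc n) g x)\<^sup>2 \<partial>M) \<le> (\<integral>\<^sup>+x. P (\<lambda>y. ((P ^^ n) g y)\<^sup>2) x \<partial>M)"
    by (intro nn_integral_mono) (simp add: P_square_le)
  also have "\<dots> = (\<integral>\<^sup>+x. ((P ^^ n) g x)\<^sup>2 \<partial>M)"
    by (rule nn_integral_P) measurable
  finally show ?case using Suc by simp
qed simp

lemma norm_T_le: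
  assumes "x \<in> space M"
  shows "ennreal (norm (T f x)) \<le> P (\<lambda>y. ennreal (norm (f y))) x"
proof (cases "integrable M (\<lambda>y. complex_of_real (K x y) * f y)")
  case True
  have "ennreal (norm (T f x)) \<le> (\<integral>\<^sup>+y. norm (complex_of_real (K x y) * f y) \<partial>M)"
    unfolding T_def by (rule integral_norm_bound_ennreal[OF True])
  also have "\<dots> = P (\<lambda>y. ennreal (norm (f y))) x"
    unfolding P_def by (intro nn_integral_cong)
      (simp add: norm_mult K_nonneg assms ennreal_mult)
  finally show ?thesis .
qed (simp add: T_def not_integrable_integral_eq)

lemma norm_T_iter_le:
  assumes "x \<in> space M"
  shows "ennreal (norm ((T ^^ n) f x)) \<le> (P ^^ n) (\<lambda>y. ennreal (norm (f y))) x"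
  using assms
proof (induction n arbitrary: x)
  case (Suc n)
  have "ennreal (norm ((T ^^ Suc n) f x)) \<le> P (\<lambda>y. ennreal (norm ((T ^^ n) f y))) x"
    using norm_T_le[OF Suc.prems, of "(T ^^ n) f"] by simp
  also have "\<dots> \<le> P ((P ^^ n) (\<lambda>y. ennreal (norm (f y)))) x"
    by (rule P_mono) (rule Suc.IH)
  finally show ?case by simp
qed simp

section \<open>The exponential series of the positive operator\<close>

definition exp_majorant :: "('a \<Rightarrow> ennreal) \<Rightarrow> real \<Rightarrow> 'a \<Rightarrow> ennreal" where
  "exp_majorant g t x = (\<Sum>n. ennreal (t ^ n / fact n) * (P ^^ n) g x)"

lemma exp_majorant_measurable [measurable]:
  "g \<in> borel_measurable M \<Longrightarrow> exp_majorant g t \<in> borel_measurable M"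
  unfolding exp_majorant_def[abs_def] by measurable

lemma suminf_exp_ennreal:
  assumes "t \<ge> 0" shows "(\<Sum>n. ennreal (t ^ n / fact n)) = ennreal (exp t)"
  using exp_converges[of t] assms
  by (intro suminf_ennreal_eq) (auto simp: field_simps)

lemma exp_majorant_mono:
  "0 \<le> s \<Longrightarrow> s \<le> t \<Longrightarrow> exp_majorant g s x \<le> exp_majorant g t x"
  unfolding exp_majorant_def
  by (intro suminf_le mult_right_mono ennreal_leI divide_right_mono power_mono) auto

lemma nn_integral_exp_majorant:
  assumes [measurable]: "g \<in> borel_measurable M" and "t \<ge> 0"
  shows "(\<integral>\<^sup>+x. exp_majorant g t x \<partial>M) = ennreal (exp t) * (\<integral>\<^sup>+x. g x \<partial>M)"
proof -
  have "(\<integral>\<^sup>+x. exp_majorant g t x \<partial>M) = (\<Sum>n. \<integral>\<^sup>+x. ennreal (t ^ n / fact n) * (P ^^ n) g x \<partial>M)"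
    unfolding exp_majorant_def by (rule nn_integral_suminf) measurable
  also have "\<dots> = (\<Sum>n. ennreal (t ^ n / fact n) * (\<integral>\<^sup>+x. g x \<partial>M))"
    by (simp add: nn_integral_cmult nn_integral_P_iter)
  finally show ?thesis
    by (simp only: ennreal_suminf_multc suminf_exp_ennreal[OF \<open>t \<ge> 0\<close>])
qed

text \<open>Cauchy-Schwarz over the index \<open>n\<close> with weights
  \<open>t ^ n / fact n\<close>, whose total mass is \<open>exp t\<close>; the series is treated as
  an integral over counting measure.\<close>

lemma exp_majorant_square_le:
  assumes "t \<ge> 0"
  shows "(exp_majorant g t x)\<^sup>2 \<le> ennreal (exp t) * (\<Sum>n. ennreal (t ^ n / fact n) * ((P ^^ n) g x)\<^sup>2)"
proof -
  define a where "a n = ennreal (sqrt (t ^ n / fact n))" for n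
  have a: "a n * a n = ennreal (t ^ n / fact n)" for n
    using assms by (simp add: a_def flip: ennreal_mult)
  have "(exp_majorant g t x)\<^sup>2 = (\<integral>\<^sup>+n. a n * (a n * (P ^^ n) g x) \<partial>count_space UNIV)\<^sup>2"
    by (simp add: exp_majorant_def nn_integral_count_space_nat a flip: mult.assoc)
  also have "\<dots> \<le> (\<integral>\<^sup>+n. (a n)\<^sup>2 \<partial>count_space UNIV) * (\<integral>\<^sup>+n. (a n * (P ^^ n) g x)\<^sup>2 \<partial>count_space UNIV)"
    by (rule Cauchy_Schwarz_nn_integral) auto
  also have "\<dots> = ennreal (exp t) * (\<Sum>n. ennreal (t ^ n / fact n) * ((P ^^ n) g x)\<^sup>2)"
    by (simp only: nn_integral_count_space_nat power_mult_distrib power2_eq_square[of "a _"] a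
        suminf_exp_ennreal[OF assms])
  finally show ?thesis .
qed

lemma nn_integral_exp_majorant_square:
  assumes [measurable]: "g \<in> borel_measurable M" and "t \<ge> 0"
  shows "(\<integral>\<^sup>+x. (exp_majorant g t x)\<^sup>2 \<partial>M) \<le> ennreal (exp t) * (ennreal (exp t) * (\<integral>\<^sup>+x. (g x)\<^sup>2 \<partial>M))"
proof -
  have "(\<integral>\<^sup>+x. (exp_majorant g t x)\<^sup>2 \<partial>M)
      \<le> (\<integral>\<^sup>+x. ennreal (exp t) * (\<Sum>n. ennreal (t ^ n / fact n) * ((P ^^ n) g x)\<^sup>2) \<partial>M)"
    by (intro nn_integral_mono exp_majorant_square_le assms)
  also have "\<dots> = ennreal (exp t) * (\<Sum>n. ennreal (t ^ n / fact n) * (\<integral>\<^sup>+x. ((P ^^ n) g x)\<^sup>2 \<partial>M))"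
    by (simp add: nn_integral_cmult nn_integral_suminf)
  also have "\<dots> \<le> ennreal (exp t) * (\<Sum>n. ennreal (t ^ n / fact n) * (\<integral>\<^sup>+x. (g x)\<^sup>2 \<partial>M))"
    by (intro mult_left_mono suminf_le nn_integral_P_iter_square) auto
  finally show ?thesis
    by (simp only: ennreal_suminf_multc suminf_exp_ennreal[OF \<open>t \<ge> 0\<close>])
qed

text \<open>One null set has to serve uncountably many times. The majorant increases with time, so
  the countably many null sets belonging to the natural numbers suffice.\<close>

lemma AE_exp_majorant_finite:
  assumes [measurable]: "g \<in> borel_measurable M" and "(\<integral>\<^sup>+x. g x \<partial>M) < \<infinity>"
  shows "AE x in M. \<forall>t. exp_majorant g \<bar>t\<bar> x < \<infinity>"
proof -
  have "AE x in M. \<forall>N::nat. exp_majorant g (real N) x \<noteq> \<infinity>"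
    unfolding AE_all_countable
  proof
    fix N :: nat
    show "AE x in M. exp_majorant g (real N) x \<noteq> \<infinity>"
      using assms by (intro nn_integral_noteq_infinite)
        (simp_all add: nn_integral_exp_majorant ennreal_mult_eq_top_iff less_top)
  qed
  then show ?thesis
  proof eventually_elim
    case (elim x)
    show ?case
    proof
      fix t :: real
      have "exp_majorant g \<bar>t\<bar> x \<le> exp_majorant g (real (nat \<lceil>\<bar>t\<bar>\<rceil>)) x"
        by (intro exp_majorant_mono) (auto simp: of_nat_ceiling)
      also have "\<dots> < \<infinity>" using elim[rule_format] by (simp only: less_top infinity_ennreal_def)
      finally show "exp_majorant g \<bar>t\<bar> x < \<infinity>" .
    qed
  qed
qed

text \<open>The series is the exponential of \<open>\<i> t (T - 1)\<close>, split as \<open>exp (- \<i> t) exp (\<i> t T)\<close>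
  because the powers of the Markov operator \<open>T\<close> are dominated by those of \<open>P\<close>.\<close>

definition evolution :: "('a \<Rightarrow> complex) \<Rightarrow> 'a \<Rightarrow> real \<Rightarrow> complex" where
  "evolution f x t = exp (- (\<i> * t)) * (\<Sum>n. (T ^^ n) f x / fact n * (\<i> * complex_of_real t) ^ n)"

lemma evolution_measurable [measurable]:
  assumes [measurable]: "f \<in> borel_measurable M"
  shows "(\<lambda>x. evolution f x t) \<in> borel_measurable M"
  unfolding evolution_def[abs_def] by measurable

lemma evolution_0: "evolution f x 0 = f x"
  using powser_zero[of "\<lambda>n. (T ^^ n) f x / fact n"] by (simp add: evolution_def)

lemma norm_evolution_term_le:
  assumes "x \<in> space M"
  shows "ennreal (norm ((T ^^ n) f x / fact n * (\<i> * complex_of_real t) ^ n))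
    \<le> ennreal (\<bar>t\<bar> ^ n / fact n) * (P ^^ n) (\<lambda>y. ennreal (norm (f y))) x"
proof -
  have "norm ((T ^^ n) f x / fact n * (\<i> * complex_of_real t) ^ n)
      = \<bar>t\<bar> ^ n / fact n * norm ((T ^^ n) f x)"
    by (simp add: norm_mult norm_divide norm_power)
  then have "ennreal (norm ((T ^^ n) f x / fact n * (\<i> * complex_of_real t) ^ n))
      = ennreal (\<bar>t\<bar> ^ n / fact n) * ennreal (norm ((T ^^ n) f x))"
    by (simp only: ennreal_mult divide_nonneg_nonneg zero_le_power abs_ge_zero norm_ge_zero fact_ge_zero)
  also have "\<dots> \<le> ennreal (\<bar>t\<bar> ^ n / fact n) * (P ^^ n) (\<lambda>y. ennreal (norm (f y))) x"
    by (intro mult_left_mono norm_T_iter_le assms) auto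
  finally show ?thesis .
qed

lemma summable_norm_evolution:
  assumes "x \<in> space M" "exp_majorant (\<lambda>y. ennreal (norm (f y))) \<bar>t\<bar> x < \<infinity>"
  shows "summable (\<lambda>n. norm ((T ^^ n) f x / fact n * (\<i> * complex_of_real t) ^ n))"
proof (rule summable_suminf_not_top)
  have "(\<Sum>n. ennreal (norm ((T ^^ n) f x / fact n * (\<i> * complex_of_real t) ^ n)))
      \<le> exp_majorant (\<lambda>y. ennreal (norm (f y))) \<bar>t\<bar> x"
    unfolding exp_majorant_def by (intro suminf_le norm_evolution_term_le assms) auto
  also note assms(2)
  finally show "(\<Sum>n. ennreal (norm ((T ^^ n) f x / fact n * (\<i> * complex_of_real t) ^ n))) \<noteq> \<top>"
    by simp
qed simp

lemma norm_evolution_le: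
  assumes "x \<in> space M" "exp_majorant (\<lambda>y. ennreal (norm (f y))) \<bar>t\<bar> x < \<infinity>"
  shows "ennreal (norm (evolution f x t)) \<le> exp_majorant (\<lambda>y. ennreal (norm (f y))) \<bar>t\<bar> x"
proof -
  note s = summable_norm_evolution[OF assms]
  have "norm (evolution f x t) \<le> (\<Sum>n. norm ((T ^^ n) f x / fact n * (\<i> * complex_of_real t) ^ n))"
    using summable_norm[OF s] by (simp add: evolution_def norm_mult)
  then have "ennreal (norm (evolution f x t))
      \<le> ennreal (\<Sum>n. norm ((T ^^ n) f x / fact n * (\<i> * complex_of_real t) ^ n))"
    by (rule ennreal_leI)
  also have "\<dots> = (\<Sum>n. ennreal (norm ((T ^^ n) f x / fact n * (\<i> * complex_of_real t) ^ n)))"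
    by (rule suminf_ennreal2[symmetric, OF norm_ge_zero s])
  also have "\<dots> \<le> exp_majorant (\<lambda>y. ennreal (norm (f y))) \<bar>t\<bar> x"
    unfolding exp_majorant_def by (intro suminf_le norm_evolution_term_le assms) auto
  finally show ?thesis .
qed

lemma P_funpow_shift: "(P ^^ n) (P g) x = (P ^^ Suc n) g x"
  by (simp add: funpow_swap1)

text \<open>Integrating the norms of the terms against the kernel at \<open>x\<close> shifts each
  power of \<open>P\<close> by one. The domination that permits exchanging integral and sum is
  therefore the majorant of \<open>P\<close> applied to the norm of \<open>f\<close>.\<close>

lemma T_evolution:
  assumes [measurable]: "f \<in> borel_measurable M" and x[measurable]: "x \<in> space M"
    and fin: "exp_majorant (P (\<lambda>y. ennreal (norm (f y)))) \<bar>t\<bar> x < \<infinity>"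
  shows "T (\<lambda>y. evolution f y t) x
      = exp (- (\<i> * t)) * (\<Sum>n. (T ^^ Suc n) f x / fact n * (\<i> * complex_of_real t) ^ n)"
proof -
  define F where "F n y = complex_of_real (K x y) * ((T ^^ n) f y / fact n * (\<i> * complex_of_real t) ^ n)" for n y
  have F_meas[measurable]: "F n \<in> borel_measurable M" for n
    unfolding F_def[abs_def] by measurable
  have "(\<integral>\<^sup>+y. (\<Sum>n. ennreal (norm (F n y))) \<partial>M)
      \<le> (\<integral>\<^sup>+y. (\<Sum>n. ennreal (\<bar>t\<bar> ^ n / fact n) * (ennreal (K x y) * (P ^^ n) (\<lambda>y. ennreal (norm (f y))) y)) \<partial>M)"
  proof (intro nn_integral_mono suminf_le allI)
    fix y n assume y: "y \<in> space M"
    have "ennreal (norm (F n y))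
        = ennreal (K x y) * ennreal (norm ((T ^^ n) f y / fact n * (\<i> * complex_of_real t) ^ n))"
      unfolding F_def norm_mult[of "complex_of_real (K x y)"] using K_nonneg[OF x y]
      by (simp only: norm_of_real abs_of_nonneg ennreal_mult norm_ge_zero)
    also have "\<dots> \<le> ennreal (K x y) * (ennreal (\<bar>t\<bar> ^ n / fact n) * (P ^^ n) (\<lambda>y. ennreal (norm (f y))) y)"
      by (intro mult_left_mono norm_evolution_term_le y) auto
    finally show "ennreal (norm (F n y))
        \<le> ennreal (\<bar>t\<bar> ^ n / fact n) * (ennreal (K x y) * (P ^^ n) (\<lambda>y. ennreal (norm (f y))) y)"
      by (simp only: mult.left_commute)
  qed auto
  also have "\<dots> = (\<Sum>n. \<integral>\<^sup>+y. ennreal (\<bar>t\<bar> ^ n / fact n) * (ennreal (K x y) * (P ^^ n) (\<lambda>y. ennreal (norm (f y))) y) \<partial>M)"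
    by (rule nn_integral_suminf) measurable
  also have "\<dots> = (\<Sum>n. ennreal (\<bar>t\<bar> ^ n / fact n) * (P ^^ n) (P (\<lambda>y. ennreal (norm (f y)))) x)"
    by (simp add: nn_integral_cmult P_funpow_shift P_def[where x = x])
  also have "\<dots> < \<infinity>" using fin by (simp add: exp_majorant_def)
  finally have fin': "(\<integral>\<^sup>+y. (\<Sum>n. ennreal (norm (F n y))) \<partial>M) < \<infinity>" .
  then have AE: "AE y in M. (\<Sum>n. ennreal (norm (F n y))) \<noteq> \<infinity>"
    by (intro nn_integral_noteq_infinite) auto
  have sum: "(\<Sum>n. \<integral>\<^sup>+y. ennreal (norm (F n y)) \<partial>M) < \<infinity>"
    using fin' by (subst (asm) nn_integral_suminf) auto
  have int: "integrable M (F n)" for n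
  proof (rule integrableI_bounded)
    have "(\<integral>\<^sup>+y. ennreal (norm (F n y)) \<partial>M) \<noteq> \<infinity>"
      using ennreal_suminf_neq_top sum by (metis (no_types, lifting) ennreal_suminf_lessD infinity_ennreal_def less_irrefl)
    then show "(\<integral>\<^sup>+y. ennreal (norm (F n y)) \<partial>M) < \<infinity>" by (simp add: less_top)
  qed measurable
  have "summable (\<lambda>n. \<integral>y. norm (F n y) \<partial>M)"
  proof (rule summable_suminf_not_top)
    show "(\<Sum>n. ennreal (\<integral>y. norm (F n y) \<partial>M)) \<noteq> \<top>"
      using sum by (simp add: nn_integral_eq_integral int integrable_norm)
  qed auto
  moreover have "AE y in M. summable (\<lambda>n. norm (F n y))"
    using AE by eventually_elim (auto intro: summable_suminf_not_top)
  ultimately have *: "(\<integral>y. (\<Sum>n. F n y) \<partial>M) = (\<Sum>n. integral\<^sup>L M (F n))"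
    by (intro integral_suminf int)
  have "T (\<lambda>y. evolution f y t) x = (\<integral>y. exp (- (\<i> * t)) * (\<Sum>n. F n y) \<partial>M)"
    unfolding T_def
  proof (rule integral_cong_AE)
    show "AE y in M. complex_of_real (K x y) * evolution f y t = exp (- (\<i> * t)) * (\<Sum>n. F n y)"
      using AE
    proof eventually_elim
      case (elim y)
      show ?case
      \<comment> \<open>Summability of \<open>F n y\<close> says nothing about the series of
        \<open>evolution\<close> where the kernel vanishes, but there both sides are 0; elsewhere
        dividing by the kernel recovers it.\<close>
      proof (cases "K x y = 0")
        case True
        then show ?thesis by (simp add: F_def)
      next
        case False
        have "summable (\<lambda>n. norm (F n y))"
          using elim by (auto intro: summable_suminf_not_top)
        then have "summable (\<lambda>n. F n y)" by (rule summable_norm_cancel)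
        then have "summable (\<lambda>n. (T ^^ n) f y / fact n * (\<i> * complex_of_real t) ^ n)"
          using False unfolding F_def by (subst (asm) summable_cmult_iff) auto
        then have "(\<Sum>n. F n y) = complex_of_real (K x y) * (\<Sum>n. (T ^^ n) f y / fact n * (\<i> * complex_of_real t) ^ n)"
          unfolding F_def by (rule suminf_mult)
        then show ?thesis by (simp add: evolution_def)
      qed
    qed
  qed measurable
  also have "\<dots> = exp (- (\<i> * t)) * (\<Sum>n. integral\<^sup>L M (F n))"
    by (simp add: *)
  also have "(\<lambda>n. integral\<^sup>L M (F n)) = (\<lambda>n. (T ^^ Suc n) f x / fact n * (\<i> * complex_of_real t) ^ n)"
  proof
    fix n
    have "integral\<^sup>L M (F n) = (\<integral>y. (complex_of_real (K x y) * (T ^^ n) f y) * ((\<i> * complex_of_real t) ^ n / fact n) \<partial>M)"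
      unfolding F_def by (intro Bochner_Integration.integral_cong) auto
    also have "\<dots> = T ((T ^^ n) f) x * ((\<i> * complex_of_real t) ^ n / fact n)"
      unfolding T_def by (rule integral_mult_left_zero)
    finally show "integral\<^sup>L M (F n) = (T ^^ Suc n) f x / fact n * (\<i> * complex_of_real t) ^ n"
      by simp
  qed
  finally show ?thesis .
qed

text \<open>At a fixed \<open>x\<close> the series is an everywhere convergent complex power series,
  restricted to the imaginary axis. Differentiation shifts its coefficients
  \<open>(T ^^ n) f x / fact n\<close>, and the shifted series is exactly what applying
  \<open>T\<close> to the evolution produces.\<close>

lemma has_vector_derivative_evolution:
  fixes f x
  defines "g \<equiv> \<lambda>y. ennreal (norm (f y))"
  assumes f: "f \<in> borel_measurable M" and x: "x \<in> space M"
    and fin: "\<And>t. exp_majorant g \<bar>t\<bar> x < \<infinity>" "\<And>t. exp_majorant (P g) \<bar>t\<bar> x < \<infinity>"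
  shows "(evolution f x has_vector_derivative \<i> * (T (\<lambda>y. evolution f y t) x - evolution f x t)) (at t)"
    and "continuous_on UNIV (\<lambda>t. \<i> * (T (\<lambda>y. evolution f y t) x - evolution f x t))"
proof -
  define c where "c n = (T ^^ n) f x / fact n" for n
  have summ: "summable (\<lambda>n. c n * z ^ n)" for z :: complex
  proof (rule summable_norm_cancel)
    \<comment> \<open>The majorant covers only points of the imaginary axis; at a general
      \<open>z\<close> the terms have the same norms as at \<open>\<i> * norm z\<close>.\<close>
    have "summable (\<lambda>n. norm (c n * (\<i> * complex_of_real (norm z)) ^ n))"
      unfolding c_def by (rule summable_norm_evolution[OF x fin(1)[unfolded g_def]])
    then show "summable (\<lambda>n. norm (c n * z ^ n))"
      by (simp add: norm_mult norm_power)
  qed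
  define h where "h z = (\<Sum>n. c n * z ^ n)" for z :: complex
  define h' where "h' z = (\<Sum>n. diffs c n * z ^ n)" for z :: complex
  have diffs: "diffs c n = (T ^^ Suc n) f x / fact n" for n
    by (simp add: diffs_def c_def field_simps del: of_nat_Suc)
  have summ': "summable (\<lambda>n. diffs c n * z ^ n)" for z :: complex
    by (rule termdiff_converges_all) (rule summ)
  have dh: "(h has_field_derivative h' z) (at z)" for z
    unfolding h_def[abs_def] h'_def by (rule termdiffs_strong_converges_everywhere) (rule summ)
  have dh': "(h' has_field_derivative (\<Sum>n. diffs (diffs c) n * z ^ n)) (at z)" for z
    unfolding h'_def[abs_def] by (rule termdiffs_strong_converges_everywhere) (rule summ')
  have ev: "evolution f x t = exp (- (\<i> * t)) * h (\<i> * t)" for t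
    by (simp add: evolution_def h_def c_def)
  have Tev: "T (\<lambda>y. evolution f y t) x = exp (- (\<i> * t)) * h' (\<i> * t)" for t
    unfolding h'_def diffs by (rule T_evolution[OF f x fin(2)[unfolded g_def]])
  have "((\<lambda>z. exp (- (\<i> * z)) * h (\<i> * z)) has_field_derivative
      \<i> * (exp (- (\<i> * t)) * h' (\<i> * t) - exp (- (\<i> * t)) * h (\<i> * t))) (at (complex_of_real t))"
    by (auto intro!: derivative_eq_intros DERIV_chain2[OF dh] simp: algebra_simps)
  from has_vector_derivative_real_field[OF this]
  show "(evolution f x has_vector_derivative \<i> * (T (\<lambda>y. evolution f y t) x - evolution f x t)) (at t)"
    unfolding Tev ev[abs_def] .
  have "isCont h z" "isCont h' z" for z
    by (rule DERIV_isCont[OF dh], rule DERIV_isCont[OF dh'])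
  then have "continuous_on UNIV h" "continuous_on UNIV h'"
    by (simp_all add: continuous_on_eq_continuous_at)
  then have "continuous_on UNIV (\<lambda>t. h (\<i> * complex_of_real t))" "continuous_on UNIV (\<lambda>t. h' (\<i> * complex_of_real t))"
    by (auto intro: continuous_on_compose2[where t = UNIV] intro!: continuous_intros)
  then show "continuous_on UNIV (\<lambda>t. \<i> * (T (\<lambda>y. evolution f y t) x - evolution f x t))"
    unfolding Tev ev by (intro continuous_intros)
qed

text \<open>The exceptional null sets belong to the norm of \<open>f\<close> and to its image under
  \<open>P\<close>; the latter has the same integral, so both majorants are finite almost
  everywhere.\<close>

theorem evolution_solves:
  assumes [measurable]: "f \<in> borel_measurable M" and f1: "integrable M f"
  shows "AE x in M. (\<forall>t. (evolution f x has_vector_derivative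
           \<i> * (T (\<lambda>y. evolution f y t) x - evolution f x t)) (at t)) \<and>
         continuous_on UNIV (\<lambda>t. \<i> * (T (\<lambda>y. evolution f y t) x - evolution f x t))"
proof -
  let ?g = "\<lambda>y. ennreal (norm (f y))"
  have fin: "(\<integral>\<^sup>+x. ?g x \<partial>M) < \<infinity>"
    using f1 by (simp add: integrable_iff_bounded)
  have "AE x in M. \<forall>t. exp_majorant ?g \<bar>t\<bar> x < \<infinity>"
    by (rule AE_exp_majorant_finite) (use fin in auto)
  moreover have "AE x in M. \<forall>t. exp_majorant (P ?g) \<bar>t\<bar> x < \<infinity>"
    by (rule AE_exp_majorant_finite) (use fin in \<open>auto simp: nn_integral_P\<close>)
  ultimately show ?thesis
    using AE_space
  proof eventually_elim
    case (elim x)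
    note * = has_vector_derivative_evolution[OF assms(1) elim(3) elim(1)[rule_format] elim(2)[rule_format]]
    show ?case using * by (intro conjI allI)
  qed
qed

lemma nn_integral_norm_evolution_le:
  assumes [measurable]: "f \<in> borel_measurable M" and f1: "integrable M f"
  shows "(\<integral>\<^sup>+x. norm (evolution f x t) \<partial>M) \<le> ennreal (exp \<bar>t\<bar>) * (\<integral>\<^sup>+x. norm (f x) \<partial>M)"
    and "(\<integral>\<^sup>+x. (ennreal (norm (evolution f x t)))\<^sup>2 \<partial>M)
      \<le> ennreal (exp \<bar>t\<bar>) * (ennreal (exp \<bar>t\<bar>) * (\<integral>\<^sup>+x. (ennreal (norm (f x)))\<^sup>2 \<partial>M))"
proof -
  let ?g = "\<lambda>y. ennreal (norm (f y))"
  have "AE x in M. \<forall>t. exp_majorant ?g \<bar>t\<bar> x < \<infinity>"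
    by (rule AE_exp_majorant_finite) (use f1 in \<open>auto simp: integrable_iff_bounded\<close>)
  with AE_space have le: "AE x in M. ennreal (norm (evolution f x t)) \<le> exp_majorant ?g \<bar>t\<bar> x"
    by eventually_elim (simp add: norm_evolution_le)
  have "(\<integral>\<^sup>+x. norm (evolution f x t) \<partial>M) \<le> (\<integral>\<^sup>+x. exp_majorant ?g \<bar>t\<bar> x \<partial>M)"
    by (intro nn_integral_mono_AE) (use le in auto)
  then show "(\<integral>\<^sup>+x. norm (evolution f x t) \<partial>M) \<le> ennreal (exp \<bar>t\<bar>) * (\<integral>\<^sup>+x. norm (f x) \<partial>M)"
    by (simp add: nn_integral_exp_majorant)
  have "(\<integral>\<^sup>+x. (ennreal (norm (evolution f x t)))\<^sup>2 \<partial>M) \<le> (\<integral>\<^sup>+x. (exp_majorant ?g \<bar>t\<bar> x)\<^sup>2 \<partial>M)"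
    by (intro nn_integral_mono_AE, rule eventually_mono[OF le]) (simp add: power_mono)
  also note nn_integral_exp_majorant_square[of ?g "\<bar>t\<bar>"]
  finally show "(\<integral>\<^sup>+x. (ennreal (norm (evolution f x t)))\<^sup>2 \<partial>M)
      \<le> ennreal (exp \<bar>t\<bar>) * (ennreal (exp \<bar>t\<bar>) * (\<integral>\<^sup>+x. (ennreal (norm (f x)))\<^sup>2 \<partial>M))"
    by simp
qed

end

section \<open>Evolution of the coefficients at an eigenfunction\<close>

context symmetric_markov_kernel
begin

text \<open>The bound \<open>W\<close> times \<open>P\<close> of the norm of \<open>f\<close>
  dominates the double integral, so Fubini applies and symmetry moves the kernel onto
  \<open>w\<close>. The pairing is bilinear, without conjugation; basis functions will enter through
  their conjugates.\<close>

lemma T_adjoint: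
  assumes f: "integrable M f" and w[measurable]: "w \<in> borel_measurable M"
    and W: "\<And>x. x \<in> space M \<Longrightarrow> norm (w x) \<le> W"
  shows "integrable M (\<lambda>x. w x * T f x)"
    and "(\<integral>x. w x * T f x \<partial>M) = (\<integral>y. T w y * f y \<partial>M)"
proof -
  have [measurable]: "f \<in> borel_measurable M" using f by simp
  have W0: "W \<ge> 0"
    using W not_empty norm_ge_zero by (meson ex_in_conv order_trans)
  have int: "integrable (M \<Otimes>\<^sub>M M) (\<lambda>(x, y). w x * (complex_of_real (K x y) * f y))"
  proof (rule integrableI_bounded)
    have "(\<integral>\<^sup>+z. ennreal (norm (case z of (x, y) \<Rightarrow> w x * (complex_of_real (K x y) * f y))) \<partial>(M \<Otimes>\<^sub>M M))
       = (\<integral>\<^sup>+x. \<integral>\<^sup>+y. ennreal (norm (w x * (complex_of_real (K x y) * f y))) \<partial>M \<partial>M)"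
      by (subst nn_integral_fst[symmetric]) (auto simp: case_prod_beta)
    also have "\<dots> \<le> (\<integral>\<^sup>+x. \<integral>\<^sup>+y. ennreal W * (ennreal (K x y) * ennreal (norm (f y))) \<partial>M \<partial>M)"
    proof (intro nn_integral_mono)
      fix x y assume xy: "x \<in> space M" "y \<in> space M"
      have "norm (w x * (complex_of_real (K x y) * f y)) \<le> W * (K x y * norm (f y))"
        using W[OF xy(1)] K_nonneg[OF xy] by (simp add: norm_mult mult_right_mono)
      then have "ennreal (norm (w x * (complex_of_real (K x y) * f y))) \<le> ennreal (W * (K x y * norm (f y)))"
        by (rule ennreal_leI)
      then show "ennreal (norm (w x * (complex_of_real (K x y) * f y))) \<le> ennreal W * (ennreal (K x y) * ennreal (norm (f y)))"
        using K_nonneg[OF xy] W0 by (simp add: ennreal_mult)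
    qed
    also have "\<dots> = (\<integral>\<^sup>+x. ennreal W * P (\<lambda>y. ennreal (norm (f y))) x \<partial>M)"
      unfolding P_def by (intro nn_integral_cong nn_integral_cmult) measurable
    also have "\<dots> = ennreal W * (\<integral>\<^sup>+y. ennreal (norm (f y)) \<partial>M)"
      by (simp add: nn_integral_cmult nn_integral_P)
    also have "\<dots> < \<infinity>"
      using f by (simp add: integrable_iff_bounded ennreal_mult_less_top)
    finally show "(\<integral>\<^sup>+z. ennreal (norm (case z of (x, y) \<Rightarrow> w x * (complex_of_real (K x y) * f y))) \<partial>(M \<Otimes>\<^sub>M M)) < \<infinity>" .
  qed measurable
  have eq: "w x * T f x = (\<integral>y. w x * (complex_of_real (K x y) * f y) \<partial>M)" for x
    unfolding T_def by simp
  show "integrable M (\<lambda>x. w x * T f x)"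
    unfolding eq by (rule pair.integrable_fst[OF int])
  have "(\<integral>x. w x * T f x \<partial>M) = (\<integral>y. \<integral>x. w x * (complex_of_real (K x y) * f y) \<partial>M \<partial>M)"
    unfolding eq by (rule pair.Fubini_integral[OF int, symmetric])
  also have "\<dots> = (\<integral>y. T w y * f y \<partial>M)"
  proof (rule Bochner_Integration.integral_cong)
    fix y assume y: "y \<in> space M"
    have "(\<integral>x. w x * (complex_of_real (K x y) * f y) \<partial>M) = (\<integral>x. (complex_of_real (K y x) * w x) * f y \<partial>M)"
      by (rule Bochner_Integration.integral_cong) (auto simp: K_sym y)
    also have "\<dots> = T w y * f y" unfolding T_def by (rule integral_mult_left_zero)
    finally show "(\<integral>x. w x * (complex_of_real (K x y) * f y) \<partial>M) = T w y * f y" .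
  qed simp
  finally show "(\<integral>x. w x * T f x \<partial>M) = (\<integral>y. T w y * f y \<partial>M)" .
qed

end

text \<open>Sampling \<open>t\<close> on the grid of mesh \<open>1 / Suc n\<close> leaves countably
  many sections, so each sampled function is jointly measurable; continuity in \<open>t\<close>
  makes the samples converge.\<close>

lemma measurable_continuous_sections:
  fixes \<Phi> :: "'a \<Rightarrow> real \<Rightarrow> 'b::metric_space"
  assumes sec: "\<And>t. (\<lambda>x. \<Phi> x t) \<in> borel_measurable M"
    and cont: "\<And>x. x \<in> space M \<Longrightarrow> continuous_on UNIV (\<Phi> x)"
  shows "(\<lambda>(x, t). \<Phi> x t) \<in> borel_measurable (M \<Otimes>\<^sub>M lborel)"
proof (rule borel_measurable_LIMSEQ_metric)
  fix n :: nat
  let ?f = "\<lambda>z. \<lfloor>real (Suc n) * snd z\<rfloor> :: int"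
  have "(\<lambda>z. (\<lambda>i z. \<Phi> (fst z) (of_int i / real (Suc n))) (?f z) z) \<in> borel_measurable (M \<Otimes>\<^sub>M lborel)"
  proof (rule measurable_compose_countable[where f = "\<lambda>i z. \<Phi> (fst z) (of_int i / real (Suc n))" and g = ?f])
    show "(\<lambda>z. \<Phi> (fst z) (of_int i / real (Suc n))) \<in> borel_measurable (M \<Otimes>\<^sub>M lborel)" for i :: int
      by (rule measurable_compose[OF measurable_fst sec])
    show "?f \<in> (M \<Otimes>\<^sub>M lborel) \<rightarrow>\<^sub>M count_space UNIV" by measurable
  qed
  then show "(\<lambda>z. \<Phi> (fst z) (of_int \<lfloor>real (Suc n) * snd z\<rfloor> / real (Suc n))) \<in> borel_measurable (M \<Otimes>\<^sub>M lborel)"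
    by simp
next
  fix z assume "z \<in> space (M \<Otimes>\<^sub>M (lborel :: real measure))"
  then obtain x t where z: "z = (x, t)" "x \<in> space M" by (auto simp: space_pair_measure)
  have "(\<lambda>n. of_int \<lfloor>real (Suc n) * t\<rfloor> / real (Suc n)) \<longlonglongrightarrow> t"
  proof (rule tendsto_sandwich)
    show "\<forall>\<^sub>F n in sequentially. t - 1 / real (Suc n) \<le> of_int \<lfloor>real (Suc n) * t\<rfloor> / real (Suc n)"
    proof (intro always_eventually allI)
      fix n
      have "t - 1 / real (Suc n) = (real (Suc n) * t - 1) / real (Suc n)" by (simp add: field_simps)
      also have "\<dots> \<le> of_int \<lfloor>real (Suc n) * t\<rfloor> / real (Suc n)"
        by (intro divide_right_mono) linarith+
      finally show "t - 1 / real (Suc n) \<le> of_int \<lfloor>real (Suc n) * t\<rfloor> / real (Suc n)" .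
    qed
    show "\<forall>\<^sub>F n in sequentially. of_int \<lfloor>real (Suc n) * t\<rfloor> / real (Suc n) \<le> t"
    proof (intro always_eventually allI)
      fix n
      have "of_int \<lfloor>real (Suc n) * t\<rfloor> / real (Suc n) \<le> (real (Suc n) * t) / real (Suc n)"
        by (intro divide_right_mono) linarith+
      then show "of_int \<lfloor>real (Suc n) * t\<rfloor> / real (Suc n) \<le> t" by simp
    qed
    show "(\<lambda>n. t - 1 / real (Suc n)) \<longlonglongrightarrow> t"
      using tendsto_diff[OF tendsto_const[of t] lim_inverse_n'[THEN LIMSEQ_Suc]] by simp
  qed simp
  moreover have "isCont (\<Phi> x) t"
    using cont[OF z(2)] by (simp add: continuous_on_eq_continuous_at)
  ultimately show "(\<lambda>n. \<Phi> (fst z) (of_int \<lfloor>real (Suc n) * snd z\<rfloor> / real (Suc n))) \<longlonglongrightarrow> (case z of (x, t) \<Rightarrow> \<Phi> x t)"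
    unfolding z prod.case fst_conv snd_conv by (rule isCont_tendsto_compose[rotated])
qed

text \<open>The equation improves the regularity of \<open>G\<close> by itself: an indefinite
  integral is continuous, so \<open>G\<close> is, and hence \<open>G\<close> is differentiable. The
  integrating factor \<open>exp (- (c * t))\<close> then makes the product constant.\<close>

lemma linear_integral_equation:
  fixes G :: "real \<Rightarrow> complex"
  assumes "R \<ge> 0" and int: "set_integrable lborel {0..R} G"
    and eq: "\<And>t. 0 \<le> t \<Longrightarrow> t \<le> R \<Longrightarrow> G t - G 0 = c * (LINT u:{0..t}|lborel. G u)"
  shows "G R = exp (c * R) * G 0"
proof -
  have G: "G t = G 0 + c * integral {0..t} G" if "t \<in> {0..R}" for t
  proof -
    have "set_integrable lborel {0..t} G"
      by (rule set_integrable_subset[OF int]) (use that in auto)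
    then show ?thesis using eq[of t] that by (simp add: set_borel_integral_eq_integral algebra_simps)
  qed
  have "continuous_on {0..R} (\<lambda>t. G 0 + c * integral {0..t} G)"
    by (intro continuous_intros indefinite_integral_continuous_1 set_borel_integral_eq_integral(1)[OF int])
  then have cont: "continuous_on {0..R} G"
    using continuous_on_cong[OF refl G, of "{0..R}"] by simp
  have deriv: "(G has_vector_derivative c * G t) (at t within {0..R})" if t: "t \<in> {0..R}" for t
  proof (rule has_vector_derivative_transform[OF t])
    show "((\<lambda>t. G 0 + c * integral {0..t} G) has_vector_derivative c * G t) (at t within {0..R})"
      by (auto intro!: derivative_eq_intros integral_has_vector_derivative[OF cont t])
  qed (rule G)
  have "((\<lambda>t. exp (- (c * t)) * G t) has_vector_derivative 0) (at t within {0..R})" if t: "t \<in> {0..R}" for t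
  proof -
    have "((\<lambda>z. exp (- (c * z))) has_field_derivative - c * exp (- (c * complex_of_real t))) (at (complex_of_real t))"
      by (auto intro!: derivative_eq_intros)
    then have "((\<lambda>t. exp (- (c * complex_of_real t))) has_vector_derivative - c * exp (- (c * complex_of_real t))) (at t within {0..R})"
      by (rule has_vector_derivative_real_field)
    from has_vector_derivative_mult[OF this deriv[OF t]] show ?thesis by (simp add: algebra_simps)
  qed
  then obtain k where "\<And>t. t \<in> {0..R} \<Longrightarrow> exp (- (c * complex_of_real t)) * G t = k"
    by (rule has_vector_derivative_zero_constant[rotated]) auto
  from this[of R] this[of 0] \<open>R \<ge> 0\<close> have "exp (- (c * R)) * G R = G 0" by auto
  then have "exp (c * R) * (exp (- (c * R)) * G R) = exp (c * R) * G 0" by simp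
  then show ?thesis by (simp flip: mult.assoc exp_add)
qed

context symmetric_markov_kernel
begin

text \<open>The L1 bound, uniform on \<open>[0, R]\<close>, makes the right-hand side of the
  equation integrable over the product with the time interval. Continuity in time of the coefficient
  is an outcome of the scalar integral equation, not an input.\<close>

theorem coefficient_evolution:
  fixes \<Psi> :: "'a \<Rightarrow> real \<Rightarrow> complex"
  assumes meas: "\<And>t. t \<ge> 0 \<Longrightarrow> (\<lambda>x. \<Psi> x t) \<in> borel_measurable M"
    and ode: "AE x in M. continuous_on {0..} (\<Psi> x) \<and>
      (\<forall>t>0. (\<Psi> x has_vector_derivative \<i> * (T (\<lambda>y. \<Psi> y t) x - \<Psi> x t)) (at t))"
    and bound: "\<And>t. 0 \<le> t \<Longrightarrow> t \<le> R \<Longrightarrow> (\<integral>\<^sup>+x. norm (\<Psi> x t) \<partial>M) \<le> ennreal B"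
    and w[measurable]: "w \<in> borel_measurable M"
    and W: "\<And>x. x \<in> space M \<Longrightarrow> norm (w x) \<le> W"
    and eigen: "\<And>x. x \<in> space M \<Longrightarrow> T w x = \<mu> * w x"
    and "R \<ge> 0"
  shows "(\<integral>x. \<Psi> x R * w x \<partial>M) = exp (\<i> * (\<mu> - 1) * complex_of_real R) * (\<integral>x. \<Psi> x 0 * w x \<partial>M)"
proof -
  obtain N where N: "{x \<in> space M. \<not> (continuous_on {0..} (\<Psi> x) \<and>
      (\<forall>t>0. (\<Psi> x has_vector_derivative \<i> * (T (\<lambda>y. \<Psi> y t) x - \<Psi> x t)) (at t)))} \<subseteq> N"
      and N_null: "emeasure M N = 0" and N_sets[measurable]: "N \<in> sets M"
    using AE_E[OF ode] by blast
  have AE_N: "AE x in M. x \<notin> N"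
    by (rule AE_not_in) (rule null_setsI[OF N_null N_sets])
  \<comment> \<open>Zero on the exceptional set and frozen at time 0 for negative times, so that
    every section is continuous on the whole line and joint measurability follows.\<close>
  define \<Phi> where "\<Phi> x t = (if x \<in> N then 0 else \<Psi> x (max 0 t))" for x t
  have \<Phi>_sec[measurable]: "(\<lambda>x. \<Phi> x t) \<in> borel_measurable M" for t
    using meas[of "max 0 t"] unfolding \<Phi>_def by (intro measurable_If_set) auto
  have \<Phi>_cont: "continuous_on UNIV (\<Phi> x)" if "x \<in> space M" for x
  proof (cases "x \<in> N")
    case False
    then have "continuous_on {0..} (\<Psi> x)" using N that by blast
    then have "continuous_on UNIV (\<lambda>t. \<Psi> x (max 0 t))"
      by (rule continuous_on_compose2) (auto intro!: continuous_intros)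
    then show ?thesis using False by (simp add: \<Phi>_def[abs_def])
  qed (simp add: \<Phi>_def[abs_def])
  have \<Phi>_meas: "(\<lambda>(x, t). \<Phi> x t) \<in> borel_measurable (M \<Otimes>\<^sub>M lborel)"
    by (rule measurable_continuous_sections) (auto intro: \<Phi>_cont)
  have \<Phi>_measurable[measurable (raw)]: "(\<lambda>z. \<Phi> (f z) (g z)) \<in> borel_measurable L"
    if [measurable]: "f \<in> L \<rightarrow>\<^sub>M M" "g \<in> borel_measurable L" for f g and L :: "'c measure"
    using measurable_compose[OF _ \<Phi>_meas, of "\<lambda>z. (f z, g z)" L] by simp
  have AE_\<Phi>: "AE x in M. \<Psi> x t = \<Phi> x t" if "t \<ge> 0" for t
    using AE_N that by (auto simp: \<Phi>_def)
  have \<Phi>_bound: "(\<integral>\<^sup>+x. norm (\<Phi> x t) \<partial>M) \<le> ennreal B" if "0 \<le> t" "t \<le> R" for t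
  proof -
    have "(\<integral>\<^sup>+x. norm (\<Phi> x t) \<partial>M) = (\<integral>\<^sup>+x. norm (\<Psi> x t) \<partial>M)"
      by (rule nn_integral_cong_AE) (use AE_\<Phi>[OF that(1)] in auto)
    then show ?thesis using bound[OF that] by simp
  qed
  have \<Phi>_int: "integrable M (\<lambda>x. \<Phi> x t)" if "0 \<le> t" "t \<le> R" for t
    using \<Phi>_bound[OF that] by (auto intro!: integrableI_bounded elim!: le_less_trans)
  \<comment> \<open>Taken from the right-hand side of the equation rather than as a derivative: in
    this form joint measurability is immediate, and \<open>D_deriv\<close> identifies it with the
    derivative off \<open>N\<close> at positive times.\<close>
  define D where "D x t = \<i> * (T (\<lambda>y. \<Phi> y t) x - \<Phi> x t)" for x t
  have D_meas: "(\<lambda>(x, t). D x t) \<in> borel_measurable (M \<Otimes>\<^sub>M lborel)"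
    unfolding D_def T_def by measurable
  have D_measurable[measurable (raw)]: "(\<lambda>z. D (f z) (g z)) \<in> borel_measurable L"
    if [measurable]: "f \<in> L \<rightarrow>\<^sub>M M" "g \<in> borel_measurable L" for f g and L :: "'c measure"
    using measurable_compose[OF _ D_meas, of "\<lambda>z. (f z, g z)" L] by simp
  have D_deriv: "(\<Phi> x has_vector_derivative D x t) (at t)" if "x \<in> space M" "x \<notin> N" "t > 0" for x t
  proof -
    have "(\<Psi> x has_vector_derivative \<i> * (T (\<lambda>y. \<Psi> y t) x - \<Psi> x t)) (at t)"
      using N that by blast
    moreover have "T (\<lambda>y. \<Psi> y t) x = T (\<lambda>y. \<Phi> y t) x"
      unfolding T_def
    proof (rule integral_cong_AE)
      show "AE y in M. complex_of_real (K x y) * \<Psi> y t = complex_of_real (K x y) * \<Phi> y t"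
        using AE_\<Phi>[of t] that by auto
    next
      have [measurable]: "(\<lambda>y. \<Psi> y t) \<in> borel_measurable M" "x \<in> space M"
        using that by (auto intro: meas)
      show "(\<lambda>y. complex_of_real (K x y) * \<Psi> y t) \<in> borel_measurable M"
        "(\<lambda>y. complex_of_real (K x y) * \<Phi> y t) \<in> borel_measurable M"
        by measurable
    qed
    moreover have "\<Psi> x t = \<Phi> x t" using that by (simp add: \<Phi>_def)
    ultimately have "(\<Psi> x has_vector_derivative D x t) (at t)" by (simp add: D_def)
    then show ?thesis
    proof (rule has_vector_derivative_transform_within_open)
      show "open {0::real<..}" "t \<in> {0<..}" using that by auto
      show "\<And>u. u \<in> {0<..} \<Longrightarrow> \<Psi> x u = \<Phi> x u" using that by (auto simp: \<Phi>_def)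
    qed
  qed
  have D_bound: "(\<integral>\<^sup>+x. norm (D x t) \<partial>M) \<le> ennreal B + ennreal B" if t: "0 \<le> t" "t \<le> R" for t
  proof -
    have "(\<integral>\<^sup>+x. norm (D x t) \<partial>M) \<le> (\<integral>\<^sup>+x. P (\<lambda>y. ennreal (norm (\<Phi> y t))) x + ennreal (norm (\<Phi> x t)) \<partial>M)"
    proof (rule nn_integral_mono)
      fix x assume x: "x \<in> space M"
      have "ennreal (norm (D x t)) \<le> ennreal (norm (T (\<lambda>y. \<Phi> y t) x) + norm (\<Phi> x t))"
        unfolding D_def by (rule ennreal_leI) (simp add: norm_mult norm_triangle_ineq4)
      also have "\<dots> \<le> P (\<lambda>y. ennreal (norm (\<Phi> y t))) x + ennreal (norm (\<Phi> x t))"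
        using norm_T_le[OF x] by (simp add: add_right_mono)
      finally show "ennreal (norm (D x t)) \<le> P (\<lambda>y. ennreal (norm (\<Phi> y t))) x + ennreal (norm (\<Phi> x t))" .
    qed
    also have "\<dots> = (\<integral>\<^sup>+x. norm (\<Phi> x t) \<partial>M) + (\<integral>\<^sup>+x. norm (\<Phi> x t) \<partial>M)"
      by (simp add: nn_integral_add nn_integral_P)
    also have "\<dots> \<le> ennreal B + ennreal B" by (intro add_mono \<Phi>_bound t)
    finally show ?thesis .
  qed
  interpret Q: pair_sigma_finite M "lborel :: real measure" ..
  have W0: "W \<ge> 0"
    using W not_empty norm_ge_zero by (meson ex_in_conv order_trans)
  \<comment> \<open>The weight \<open>v\<close> serves twice: as the constant 1 for integrability
    along almost every time section, and as \<open>w\<close> for exchanging the two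
    integrals.\<close>
  have D_int: "integrable (M \<Otimes>\<^sub>M lborel) (\<lambda>(x, u). v x * (indicator {0..t} u *\<^sub>R D x u))"
    if t: "0 \<le> t" "t \<le> R" and [measurable]: "v \<in> borel_measurable M"
      and V: "\<And>x. x \<in> space M \<Longrightarrow> norm (v x) \<le> V" "V \<ge> 0" for t v V
  proof (rule integrableI_bounded)
    have "(\<integral>\<^sup>+z. ennreal (norm (case z of (x, u) \<Rightarrow> v x * (indicator {0..t} u *\<^sub>R D x u))) \<partial>(M \<Otimes>\<^sub>M lborel))
      = (\<integral>\<^sup>+u. \<integral>\<^sup>+x. ennreal (norm (v x * (indicator {0..t} u *\<^sub>R D x u))) \<partial>M \<partial>lborel)"
      by (subst Q.nn_integral_snd[symmetric]) (auto simp: case_prod_beta)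
    also have "\<dots> \<le> (\<integral>\<^sup>+u. (ennreal V * (ennreal B + ennreal B)) * indicator {0..t} u \<partial>lborel)"
    proof (rule nn_integral_mono)
      fix u :: real
      show "(\<integral>\<^sup>+x. ennreal (norm (v x * (indicator {0..t} u *\<^sub>R D x u))) \<partial>M)
        \<le> (ennreal V * (ennreal B + ennreal B)) * indicator {0..t} u"
      proof (cases "u \<in> {0..t}")
        case True
        have "(\<integral>\<^sup>+x. ennreal (norm (v x * (indicator {0..t} u *\<^sub>R D x u))) \<partial>M)
          \<le> (\<integral>\<^sup>+x. ennreal V * ennreal (norm (D x u)) \<partial>M)"
        proof (rule nn_integral_mono)
          fix x assume x: "x \<in> space M"
          have "norm (v x * (indicator {0..t} u *\<^sub>R D x u)) \<le> V * norm (D x u)"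
            using V(1)[OF x] True by (simp add: norm_mult mult_right_mono)
          then have "ennreal (norm (v x * (indicator {0..t} u *\<^sub>R D x u))) \<le> ennreal (V * norm (D x u))"
            by (rule ennreal_leI)
          then show "ennreal (norm (v x * (indicator {0..t} u *\<^sub>R D x u))) \<le> ennreal V * ennreal (norm (D x u))"
            using V(2) by (simp add: ennreal_mult)
        qed
        also have "\<dots> = ennreal V * (\<integral>\<^sup>+x. norm (D x u) \<partial>M)"
          by (rule nn_integral_cmult) measurable
        also have "\<dots> \<le> ennreal V * (ennreal B + ennreal B)"
          by (intro mult_left_mono D_bound) (use True t in auto)
        finally show ?thesis using True by simp
      qed simp
    qed
    also have "\<dots> = (ennreal V * (ennreal B + ennreal B)) * ennreal t"
      using t by (simp add: nn_integral_cmult_indicator)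
    also have "\<dots> < \<infinity>" by (simp add: ennreal_mult_less_top)
    finally show "(\<integral>\<^sup>+z. ennreal (norm (case z of (x, u) \<Rightarrow> v x * (indicator {0..t} u *\<^sub>R D x u))) \<partial>(M \<Otimes>\<^sub>M lborel)) < \<infinity>" .
  qed measurable
  define G where "G t = (\<integral>x. \<Phi> x t * w x \<partial>M)" for t
  have iG: "integrable M (\<lambda>x. \<Phi> x s * w x)" if "0 \<le> s" "s \<le> R" for s
  proof (rule Bochner_Integration.integrable_bound)
    show "integrable M (\<lambda>x. W * norm (\<Phi> x s))"
      using \<Phi>_int[OF that] by simp
    show "AE x in M. norm (\<Phi> x s * w x) \<le> norm (W * norm (\<Phi> x s))"
      using W W0 by (intro AE_I2) (simp add: norm_mult mult.commute mult_right_mono)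
  qed measurable
  have inner: "(\<integral>x. w x * D x u \<partial>M) = \<i> * (\<mu> - 1) * G u" if u: "0 \<le> u" "u \<le> R" for u
  proof -
    have "(\<integral>x. w x * D x u \<partial>M) = (\<integral>x. \<i> * (w x * T (\<lambda>y. \<Phi> y u) x - \<Phi> x u * w x) \<partial>M)"
      by (rule Bochner_Integration.integral_cong) (auto simp: D_def algebra_simps)
    also have "\<dots> = \<i> * ((\<integral>x. w x * T (\<lambda>y. \<Phi> y u) x \<partial>M) - G u)"
      using T_adjoint(1)[OF \<Phi>_int[OF u] w W] iG[OF u] by (simp add: G_def)
    also have "(\<integral>x. w x * T (\<lambda>y. \<Phi> y u) x \<partial>M) = (\<integral>x. T w x * \<Phi> x u \<partial>M)"
      by (rule T_adjoint(2)[OF \<Phi>_int[OF u] w W])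
    also have "\<dots> = (\<integral>x. \<mu> * (\<Phi> x u * w x) \<partial>M)"
      by (rule Bochner_Integration.integral_cong) (auto simp: eigen)
    also have "\<dots> = \<mu> * G u" by (simp add: G_def)
    finally show ?thesis by (simp add: algebra_simps)
  qed
  have key: "G t - G 0 = \<i> * (\<mu> - 1) * (LINT u:{0..t}|lborel. G u)
      \<and> integrable lborel (\<lambda>u. indicator {0..t} u *\<^sub>R (\<i> * (\<mu> - 1) * G u))" if t: "0 \<le> t" "t \<le> R" for t
  proof -
    note I1 = D_int[OF t, of "\<lambda>_. 1" 1, simplified]
    note Iw = D_int[OF t w W W0]
    have AE1: "AE x in M. \<Phi> x t - \<Phi> x 0 = (\<integral>u. indicator {0..t} u *\<^sub>R D x u \<partial>lborel)"
      using Q.AE_integrable_fst[OF I1] AE_N AE_space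
    proof eventually_elim
      case (elim x)
      \<comment> \<open>At time 0 only continuity is known, hence the fundamental theorem with
        derivatives in the open interval.\<close>
      have "(D x has_integral \<Phi> x t - \<Phi> x 0) {0..t}"
        by (rule fundamental_theorem_of_calculus_interior)
          (use elim t in \<open>auto intro!: D_deriv continuous_on_subset[OF \<Phi>_cont]\<close>)
      moreover have "set_integrable lborel {0..t} (D x)"
        using elim by (simp add: set_integrable_def)
      ultimately show ?case
        using set_borel_integral_eq_integral(2)[of "{0..t}" "D x"]
        by (simp add: set_lebesgue_integral_def integral_unique)
    qed
    have "G t - G 0 = (\<integral>x. \<Phi> x t * w x - \<Phi> x 0 * w x \<partial>M)"
      using iG t \<open>R \<ge> 0\<close> by (simp add: G_def)
    also have "\<dots> = (\<integral>x. \<integral>u. w x * (indicator {0..t} u *\<^sub>R D x u) \<partial>lborel \<partial>M)"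
    proof (rule integral_cong_AE)
      show "AE x in M. \<Phi> x t * w x - \<Phi> x 0 * w x = (\<integral>u. w x * (indicator {0..t} u *\<^sub>R D x u) \<partial>lborel)"
        using AE1
      proof eventually_elim
        case (elim x)
        have "(\<integral>u. w x * (indicator {0..t} u *\<^sub>R D x u) \<partial>lborel) = w x * (\<integral>u. indicator {0..t} u *\<^sub>R D x u \<partial>lborel)"
          by (rule integral_mult_right_zero)
        then show ?case unfolding elim[symmetric] by (simp add: algebra_simps)
      qed
    qed measurable
    also have "\<dots> = (\<integral>u. \<integral>x. w x * (indicator {0..t} u *\<^sub>R D x u) \<partial>M \<partial>lborel)"
      by (rule Q.Fubini_integral[OF Iw, symmetric])
    also have eqG: "(\<lambda>u. \<integral>x. w x * (indicator {0..t} u *\<^sub>R D x u) \<partial>M)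
        = (\<lambda>u. indicator {0..t} u *\<^sub>R (\<i> * (\<mu> - 1) * G u))"
    proof
      fix u :: real
      show "(\<integral>x. w x * (indicator {0..t} u *\<^sub>R D x u) \<partial>M) = indicator {0..t} u *\<^sub>R (\<i> * (\<mu> - 1) * G u)"
        using inner[of u] t by (auto simp: indicator_def)
    qed
    also have "(\<integral>u. indicator {0..t} u *\<^sub>R (\<i> * (\<mu> - 1) * G u) \<partial>lborel) = \<i> * (\<mu> - 1) * (LINT u:{0..t}|lborel. G u)"
      unfolding set_lebesgue_integral_def by (simp flip: integral_mult_right_zero)
    finally show ?thesis
      using Q.integrable_snd[OF Iw] unfolding eqG by simp
  qed
  have "G R = exp (\<i> * (\<mu> - 1) * complex_of_real R) * G 0"
  \<comment> \<open>Fubini yields integrability of \<open>G\<close> only up to the factor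
    \<open>\<mu> - 1\<close>; when that factor is 0, the identity in \<open>key\<close> already
    gives constancy.\<close>
  proof (cases "\<mu> = 1")
    case True
    then show ?thesis using key[of R] \<open>R \<ge> 0\<close> by simp
  next
    case False
    have "set_integrable lborel {0..R} (\<lambda>u. \<i> * (\<mu> - 1) * G u)"
      using key[of R] \<open>R \<ge> 0\<close> by (simp add: set_integrable_def)
    then have "set_integrable lborel {0..R} G"
      using False by simp
    then show ?thesis
      using linear_integral_equation[OF \<open>R \<ge> 0\<close>] key by blast
  qed
  moreover have "G s = (\<integral>x. \<Psi> x s * w x \<partial>M)" if "s \<ge> 0" for s
    unfolding G_def
  proof (rule integral_cong_AE)
    show "AE x in M. \<Phi> x s * w x = \<Psi> x s * w x"
      using AE_\<Phi>[OF that] by auto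
  next
    have [measurable]: "(\<lambda>x. \<Psi> x s) \<in> borel_measurable M" by (rule meas[OF that])
    show "(\<lambda>x. \<Psi> x s * w x) \<in> borel_measurable M" by measurable
  qed measurable
  ultimately show ?thesis using \<open>R \<ge> 0\<close> by simp
qed

end

section \<open>Orthonormal systems and density in the square integrable functions\<close>

definition square_integrable :: "'a measure \<Rightarrow> ('a \<Rightarrow> complex) \<Rightarrow> bool" where
  "square_integrable M f \<longleftrightarrow> f \<in> borel_measurable M \<and> integrable M (\<lambda>x. (cmod (f x))\<^sup>2)"

lemma square_integrableD:
  assumes "square_integrable M f"
  shows "f \<in> borel_measurable M" "integrable M (\<lambda>x. (cmod (f x))\<^sup>2)"
  using assms by (auto simp: square_integrable_def)

lemma square_integrable_add:
  assumes f: "square_integrable M f" and g: "square_integrable M g"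
  shows "square_integrable M (\<lambda>x. f x + g x)"
proof -
  note [measurable] = square_integrableD(1)[OF f] square_integrableD(1)[OF g]
  have "integrable M (\<lambda>x. (cmod (f x + g x))\<^sup>2)"
  proof (rule Bochner_Integration.integrable_bound)
    show "integrable M (\<lambda>x. 2 * (cmod (f x))\<^sup>2 + 2 * (cmod (g x))\<^sup>2)"
      using square_integrableD(2)[OF f] square_integrableD(2)[OF g] by simp
    have "(cmod (f x + g x))\<^sup>2 \<le> 2 * (cmod (f x))\<^sup>2 + 2 * (cmod (g x))\<^sup>2" for x
    proof -
      have "(cmod (f x + g x))\<^sup>2 \<le> (cmod (f x) + cmod (g x))\<^sup>2"
        by (intro power_mono norm_triangle_ineq) simp
      also have "\<dots> \<le> 2 * (cmod (f x))\<^sup>2 + 2 * (cmod (g x))\<^sup>2"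
        using sum_squares_bound[of "cmod (f x)" "cmod (g x)"] by (simp add: power2_sum)
      finally show ?thesis .
    qed
    then show "AE x in M. norm ((cmod (f x + g x))\<^sup>2) \<le> norm (2 * (cmod (f x))\<^sup>2 + 2 * (cmod (g x))\<^sup>2)"
      by simp
  qed measurable
  then show ?thesis by (simp add: square_integrable_def)
qed

lemma square_integrable_scale:
  assumes "square_integrable M f" shows "square_integrable M (\<lambda>x. a * f x)"
  using assms by (auto simp: square_integrable_def norm_mult power_mult_distrib)

lemma square_integrable_diff:
  assumes "square_integrable M f" "square_integrable M g"
  shows "square_integrable M (\<lambda>x. f x - g x)"
  using square_integrable_add[OF assms(1) square_integrable_scale[OF assms(2), of "-1"]] by simp

lemma square_integrable_sum:
  assumes "\<And>i. i \<in> F \<Longrightarrow> square_integrable M (f i)"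
  shows "square_integrable M (\<lambda>x. \<Sum>i\<in>F. f i x)"
  using assms
  by (induction F rule: infinite_finite_induct)
    (auto simp: square_integrable_add, auto simp: square_integrable_def)

lemma integrable_mult_cnj:
  assumes f: "square_integrable M f" and g: "square_integrable M g"
  shows "integrable M (\<lambda>x. f x * cnj (g x))"
proof (rule Bochner_Integration.integrable_bound)
  note [measurable] = square_integrableD(1)[OF f] square_integrableD(1)[OF g]
  show "integrable M (\<lambda>x. (cmod (f x))\<^sup>2 + (cmod (g x))\<^sup>2)"
    using square_integrableD(2)[OF f] square_integrableD(2)[OF g] by simp
  have "cmod (f x) * cmod (g x) \<le> (cmod (f x))\<^sup>2 + (cmod (g x))\<^sup>2" for x
    using sum_squares_bound[of "cmod (f x)" "cmod (g x)"] mult_nonneg_nonneg[of "cmod (f x)" "cmod (g x)"]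
    by (simp del: mult_nonneg_nonneg)
  then show "AE x in M. norm (f x * cnj (g x)) \<le> norm ((cmod (f x))\<^sup>2 + (cmod (g x))\<^sup>2)"
    by (simp add: norm_mult)
  have "(\<lambda>x. cnj (g x)) \<in> borel_measurable M"
    by (rule borel_measurable_continuous_on[OF _ square_integrableD(1)[OF g]]) (intro continuous_intros)
  then show "(\<lambda>x. f x * cnj (g x)) \<in> borel_measurable M" by measurable
qed

section \<open>Density in L2 from an intersection-stable generator\<close>

definition l2_approximable :: "'a measure \<Rightarrow> (('a \<Rightarrow> complex) \<Rightarrow> bool) \<Rightarrow> ('a \<Rightarrow> complex) \<Rightarrow> bool" where
  "l2_approximable M S f \<longleftrightarrow> square_integrable M f \<and>
     (\<forall>\<epsilon>>0. \<exists>g. S g \<and> (\<integral>x. (cmod (f x - g x))\<^sup>2 \<partial>M) < \<epsilon>)"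

text \<open>An abstraction of the span of a basis; the constants are required for passing to
  complements of sets.\<close>

locale function_space = prob_space M for M :: "'a measure" +
  fixes S :: "('a \<Rightarrow> complex) \<Rightarrow> bool"
  assumes S_square: "S f \<Longrightarrow> square_integrable M f"
    and S_add: "S f \<Longrightarrow> S g \<Longrightarrow> S (\<lambda>x. f x + g x)"
    and S_scale: "S f \<Longrightarrow> S (\<lambda>x. a * f x)"
    and S_one: "S (\<lambda>x. 1)"
begin

abbreviation "approximable \<equiv> l2_approximable M S"

lemma S_approximable: "S f \<Longrightarrow> approximable f"
  unfolding l2_approximable_def by (auto intro!: S_square exI[of _ f])

lemma integral_square_triangle:
  assumes "square_integrable M f" "square_integrable M g"
  shows "(\<integral>x. (cmod (f x + g x))\<^sup>2 \<partial>M) \<le> 2 * (\<integral>x. (cmod (f x))\<^sup>2 \<partial>M) + 2 * (\<integral>x. (cmod (g x))\<^sup>2 \<partial>M)"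
proof -
  have "(\<integral>x. (cmod (f x + g x))\<^sup>2 \<partial>M) \<le> (\<integral>x. 2 * (cmod (f x))\<^sup>2 + 2 * (cmod (g x))\<^sup>2 \<partial>M)"
  proof (rule integral_mono)
    fix x
    have "(cmod (f x + g x))\<^sup>2 \<le> (cmod (f x) + cmod (g x))\<^sup>2"
      by (intro power_mono norm_triangle_ineq) simp
    also have "\<dots> \<le> 2 * (cmod (f x))\<^sup>2 + 2 * (cmod (g x))\<^sup>2"
      using sum_squares_bound[of "cmod (f x)" "cmod (g x)"] by (simp add: power2_sum)
    finally show "(cmod (f x + g x))\<^sup>2 \<le> 2 * (cmod (f x))\<^sup>2 + 2 * (cmod (g x))\<^sup>2" .
  qed (use square_integrableD(2)[OF square_integrable_add[OF assms]] square_integrableD(2)[OF assms(1)]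
      square_integrableD(2)[OF assms(2)] in simp_all)
  also have "\<dots> = 2 * (\<integral>x. (cmod (f x))\<^sup>2 \<partial>M) + 2 * (\<integral>x. (cmod (g x))\<^sup>2 \<partial>M)"
    using assms by (simp add: square_integrableD(2))
  finally show ?thesis .
qed

lemma approximable_add:
  assumes f: "approximable f" and g: "approximable g" shows "approximable (\<lambda>x. f x + g x)"
  unfolding l2_approximable_def
proof (intro conjI allI impI)
  have sf: "square_integrable M f" and sg: "square_integrable M g"
    using f g by (auto simp: l2_approximable_def)
  show "square_integrable M (\<lambda>x. f x + g x)" by (rule square_integrable_add[OF sf sg])
  fix \<epsilon> :: real assume "\<epsilon> > 0"
  \<comment> \<open>A quarter each: the square of a sum is at most twice the sum of the squares, so
    the two errors together stay below \<open>\<epsilon>\<close>.\<close>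
  then obtain f' g' where f': "S f'" "(\<integral>x. (cmod (f x - f' x))\<^sup>2 \<partial>M) < \<epsilon> / 4"
    and g': "S g'" "(\<integral>x. (cmod (g x - g' x))\<^sup>2 \<partial>M) < \<epsilon> / 4"
    using f g unfolding l2_approximable_def by (meson divide_pos_pos zero_less_numeral)
  have "(\<integral>x. (cmod (f x + g x - (f' x + g' x)))\<^sup>2 \<partial>M) = (\<integral>x. (cmod ((f x - f' x) + (g x - g' x)))\<^sup>2 \<partial>M)"
    by (simp add: algebra_simps)
  also have "\<dots> \<le> 2 * (\<integral>x. (cmod (f x - f' x))\<^sup>2 \<partial>M) + 2 * (\<integral>x. (cmod (g x - g' x))\<^sup>2 \<partial>M)"
    by (intro integral_square_triangle square_integrable_diff sf sg S_square f' g')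
  also have "\<dots> < \<epsilon>" using f'(2) g'(2) by simp
  finally show "\<exists>h. S h \<and> (\<integral>x. (cmod (f x + g x - h x))\<^sup>2 \<partial>M) < \<epsilon>"
    using S_add[OF f'(1) g'(1)] by blast
qed

lemma approximable_scale:
  assumes f: "approximable f" shows "approximable (\<lambda>x. a * f x)"
  unfolding l2_approximable_def
proof (intro conjI allI impI)
  have sf: "square_integrable M f"
    using f by (auto simp: l2_approximable_def)
  show "square_integrable M (\<lambda>x. a * f x)" by (rule square_integrable_scale[OF sf])
  fix \<epsilon> :: real assume "\<epsilon> > 0"
  \<comment> \<open>The added 1 keeps the denominator positive when \<open>a = 0\<close>.\<close>
  then have "\<epsilon> / ((cmod a)\<^sup>2 + 1) > 0" by (intro divide_pos_pos) (auto simp: add_nonneg_pos)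
  then obtain f' where f': "S f'" "(\<integral>x. (cmod (f x - f' x))\<^sup>2 \<partial>M) < \<epsilon> / ((cmod a)\<^sup>2 + 1)"
    using f unfolding l2_approximable_def by blast
  have "(\<integral>x. (cmod (a * f x - a * f' x))\<^sup>2 \<partial>M) = (\<integral>x. (cmod a)\<^sup>2 * (cmod (f x - f' x))\<^sup>2 \<partial>M)"
    by (simp flip: right_diff_distrib add: norm_mult power_mult_distrib)
  also have "\<dots> = (cmod a)\<^sup>2 * (\<integral>x. (cmod (f x - f' x))\<^sup>2 \<partial>M)" by simp
  also have "\<dots> \<le> ((cmod a)\<^sup>2 + 1) * (\<integral>x. (cmod (f x - f' x))\<^sup>2 \<partial>M)"
    by (intro mult_right_mono) auto
  also have "\<dots> < \<epsilon>"
    using f'(2) by (simp add: pos_less_divide_eq add_nonneg_pos mult.commute)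
  finally show "\<exists>h. S h \<and> (\<integral>x. (cmod (a * f x - h x))\<^sup>2 \<partial>M) < \<epsilon>"
    using S_scale[OF f'(1), of a] by blast
qed

lemma approximable_0: "approximable (\<lambda>x. 0)"
  using S_approximable[OF S_scale[OF S_one, of 0]] by simp

lemma approximable_sum: "(\<And>i. i \<in> F \<Longrightarrow> approximable (f i)) \<Longrightarrow> approximable (\<lambda>x. \<Sum>i\<in>F. f i x)"
  by (induction F rule: infinite_finite_induct) (auto simp: approximable_0 approximable_add)

lemma approximable_limit:
  assumes f: "\<And>n. approximable (f n)" and g[measurable]: "square_integrable M g"
    and lim: "\<And>x. x \<in> space M \<Longrightarrow> (\<lambda>n. f n x) \<longlonglongrightarrow> g x"
    and dom: "integrable M h" "\<And>n x. x \<in> space M \<Longrightarrow> (cmod (g x - f n x))\<^sup>2 \<le> h x"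
  shows "approximable g"
  unfolding l2_approximable_def
proof (intro conjI allI impI)
  show "square_integrable M g" by fact
  have sf: "square_integrable M (f n)" for n
    using f by (auto simp: l2_approximable_def)
  note [measurable] = square_integrableD(1)[OF sf] square_integrableD(1)[OF g]
  fix \<epsilon> :: real assume \<epsilon>: "\<epsilon> > 0"
  have "(\<lambda>n. \<integral>x. (cmod (g x - f n x))\<^sup>2 \<partial>M) \<longlonglongrightarrow> (\<integral>x. 0 \<partial>M)"
  proof (rule integral_dominated_convergence[OF _ _ dom(1)])
    show "AE x in M. (\<lambda>n. (cmod (g x - f n x))\<^sup>2) \<longlonglongrightarrow> 0"
    proof (rule AE_I2)
      fix x assume "x \<in> space M"
      from tendsto_power[OF tendsto_norm[OF tendsto_diff[OF tendsto_const[of "g x"] lim[OF this]]], of 2]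
      show "(\<lambda>n. (cmod (g x - f n x))\<^sup>2) \<longlonglongrightarrow> 0" by simp
    qed
    show "AE x in M. norm ((cmod (g x - f n x))\<^sup>2) \<le> h x" for n
      using dom(2) by (intro AE_I2) simp
  qed measurable
  then have "\<forall>\<^sub>F n in sequentially. (\<integral>x. (cmod (g x - f n x))\<^sup>2 \<partial>M) < \<epsilon> / 4"
    using \<epsilon> by (intro order_tendstoD) auto
  then obtain n where n: "(\<integral>x. (cmod (g x - f n x))\<^sup>2 \<partial>M) < \<epsilon> / 4"
    by (auto simp: eventually_sequentially)
  obtain f' where f': "S f'" "(\<integral>x. (cmod (f n x - f' x))\<^sup>2 \<partial>M) < \<epsilon> / 4"
    using f[of n] \<epsilon> unfolding l2_approximable_def by (meson divide_pos_pos zero_less_numeral)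
  have "(\<integral>x. (cmod (g x - f' x))\<^sup>2 \<partial>M) = (\<integral>x. (cmod ((g x - f n x) + (f n x - f' x)))\<^sup>2 \<partial>M)"
    by simp
  also have "\<dots> \<le> 2 * (\<integral>x. (cmod (g x - f n x))\<^sup>2 \<partial>M) + 2 * (\<integral>x. (cmod (f n x - f' x))\<^sup>2 \<partial>M)"
    by (intro integral_square_triangle square_integrable_diff sf g S_square f')
  also have "\<dots> < \<epsilon>" using f'(2) n by simp
  finally show "\<exists>h. S h \<and> (\<integral>x. (cmod (g x - h x))\<^sup>2 \<partial>M) < \<epsilon>"
    using f'(1) by blast
qed

text \<open>A Dynkin argument: the sets with approximable indicator contain the intersection-stable
  generator and are closed under complements and countable disjoint unions.\<close>

lemma approximable_indicator:
  assumes G: "sets M = sigma_sets (space M) G" "Int_stable G" "G \<subseteq> Pow (space M)"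
    and ind: "\<And>A. A \<in> G \<Longrightarrow> S (indicator A)"
    and A: "A \<in> sets M"
  shows "approximable (indicator A)"
proof -
  have si: "square_integrable M (indicator A :: _ \<Rightarrow> complex)" if "A \<in> sets M" for A
  proof -
    have "(\<lambda>x. (cmod (indicator A x))\<^sup>2) = (indicator A :: _ \<Rightarrow> real)"
      by (auto simp: indicator_def)
    then show ?thesis using that by (simp add: square_integrable_def less_top[symmetric])
  qed
  have "A \<in> sigma_sets (space M) G" using A G by simp
  from G(2) G(3) this show ?thesis
  proof (induction A rule: sigma_sets_induct_disjoint)
    case (basic A)
    then show ?case by (intro S_approximable ind)
  next
    case empty
    then show ?case using approximable_0 by (simp add: indicator_def[abs_def])
  next
    case (compl A)
    have [measurable]: "A \<in> sets M" using compl G by simp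
    show ?case
    proof (rule approximable_limit[where f = "\<lambda>n x. 1 + (-1) * indicator A x"])
      show "approximable (\<lambda>x. 1 + (-1) * indicator A x)"
        by (intro approximable_add approximable_scale compl.IH S_approximable S_one)
      show "square_integrable M (indicator (space M - A))" by (intro si) auto
      show "integrable M (\<lambda>x. 0 :: real)" by simp
      fix x assume "x \<in> space M"
      then have eq: "1 + (-1) * indicator A x = (indicator (space M - A) x :: complex)"
        by (simp add: indicator_def)
      show "(\<lambda>n::nat. 1 + (-1) * indicator A x) \<longlonglongrightarrow> (indicator (space M - A) x :: complex)"
        unfolding eq by simp
      show "(cmod (indicator (space M - A) x - (1 + (-1) * indicator A x)))\<^sup>2 \<le> 0"
        unfolding eq by simp
    qed
  next
    case (union A)
    have [measurable]: "A i \<in> sets M" for i using union(2) G(1) by auto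
    show ?case
    proof (rule approximable_limit[where f = "\<lambda>n x. \<Sum>i<n. indicator (A i) x"])
      show "approximable (\<lambda>x. \<Sum>i<n. indicator (A i) x)" for n by (intro approximable_sum union)
      show "square_integrable M (indicator (\<Union>i. A i))" by (intro si) auto
      show "integrable M (\<lambda>x. 1 :: real)" by simp
      fix x
      have eq: "(\<Sum>i<n. indicator (A i) x) = (indicator (\<Union>i<n. A i) x :: complex)" for n
        using union(1) by (intro indicator_UN_disjoint[symmetric]) (auto simp: disjoint_family_on_def)
      show "(\<lambda>n. \<Sum>i<n. indicator (A i) x) \<longlonglongrightarrow> (indicator (\<Union>i. A i) x :: complex)"
        unfolding eq by (rule LIMSEQ_indicator_UN)
      show "(cmod (indicator (\<Union>i. A i) x - (\<Sum>i<n. indicator (A i) x)))\<^sup>2 \<le> 1" for n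
        unfolding eq by (auto simp: indicator_def)
    qed
  qed
qed

text \<open>Simple functions reduce the claim to indicators. They can be chosen with norm at most
  twice that of \<open>f\<close>, so their distance to \<open>f\<close> is at most three times its
  norm; hence the constant 9 in the domination.\<close>

theorem square_integrable_approximable:
  assumes G: "sets M = sigma_sets (space M) G" "Int_stable G" "G \<subseteq> Pow (space M)"
    and ind: "\<And>A. A \<in> G \<Longrightarrow> S (indicator A)"
    and f: "square_integrable M f"
  shows "approximable f"
proof -
  note [measurable] = square_integrableD(1)[OF f]
  obtain F where F: "\<And>i. simple_function M (F i)" "\<And>x. x \<in> space M \<Longrightarrow> (\<lambda>i. F i x) \<longlonglongrightarrow> f x"
    "\<And>i x. x \<in> space M \<Longrightarrow> dist (F i x) 0 \<le> 2 * dist (f x) 0"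
    using borel_measurable_implies_sequence_metric[OF square_integrableD(1)[OF f], of 0] by blast
  have repr: "approximable (\<lambda>x. \<Sum>y\<in>F i ` space M. y * indicator (F i -` {y} \<inter> space M) x)" for i
    by (intro approximable_sum approximable_scale approximable_indicator[OF G ind] simple_functionD(2)[OF F(1)])
  have eq: "F i x = (\<Sum>y\<in>F i ` space M. y * indicator (F i -` {y} \<inter> space M) x)" if "x \<in> space M" for i x
  proof -
    have "F i x = (\<Sum>y\<in>F i ` space M. indicator (F i -` {y} \<inter> space M) x *\<^sub>R y)"
      by (rule simple_function_indicator_representation_banach[OF F(1) that])
    also have "\<dots> = (\<Sum>y\<in>F i ` space M. y * indicator (F i -` {y} \<inter> space M) x)"
      by (rule sum.cong) (auto simp: indicator_def)
    finally show ?thesis .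
  qed
  show ?thesis
  proof (rule approximable_limit[OF repr f])
    show "(\<lambda>n. \<Sum>y\<in>F n ` space M. y * indicator (F n -` {y} \<inter> space M) x) \<longlonglongrightarrow> f x" if "x \<in> space M" for x
      using F(2)[OF that] by (simp add: eq[OF that, symmetric])
    show "integrable M (\<lambda>x. 9 * (cmod (f x))\<^sup>2)"
      using square_integrableD(2)[OF f] by simp
    fix n x assume x: "x \<in> space M"
    have "cmod (f x - F n x) \<le> 3 * cmod (f x)"
      using norm_triangle_ineq4[of "f x" "F n x"] F(3)[OF x, of n] by simp
    then have "(cmod (f x - F n x))\<^sup>2 \<le> (3 * cmod (f x))\<^sup>2" by (intro power_mono) auto
    then show "(cmod (f x - (\<Sum>y\<in>F n ` space M. y * indicator (F n -` {y} \<inter> space M) x)))\<^sup>2 \<le> 9 * (cmod (f x))\<^sup>2"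
      by (simp add: eq[OF x, symmetric] power_mult_distrib)
  qed
qed

end

section \<open>Orthonormal systems, best approximation and Parseval\<close>

locale orthonormal_system =
  fixes M :: "'a measure" and I :: "'i set" and e :: "'i \<Rightarrow> 'a \<Rightarrow> complex"
  assumes e_square: "i \<in> I \<Longrightarrow> square_integrable M (e i)"
    and e_orthonormal: "i \<in> I \<Longrightarrow> j \<in> I \<Longrightarrow> (\<integral>x. e i x * cnj (e j x) \<partial>M) = (if i = j then 1 else 0)"
begin

definition coeff :: "('a \<Rightarrow> complex) \<Rightarrow> 'i \<Rightarrow> complex" where
  "coeff f i = (\<integral>x. f x * cnj (e i x) \<partial>M)"

lemma coeff_diff_sum:
  assumes f: "square_integrable M f" and F: "finite F" "F \<subseteq> I" and j: "j \<in> I" "j \<notin> F"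
  shows "coeff (\<lambda>x. f x - (\<Sum>i\<in>F. a i * e i x)) j = coeff f j"
proof -
  have int: "integrable M (\<lambda>x. a i * (e i x * cnj (e j x)))" if "i \<in> F" for i
    using that F j by (intro integrable_mult_right integrable_mult_cnj e_square) auto
  have "coeff (\<lambda>x. f x - (\<Sum>i\<in>F. a i * e i x)) j
      = (\<integral>x. f x * cnj (e j x) - (\<Sum>i\<in>F. a i * (e i x * cnj (e j x))) \<partial>M)"
    unfolding coeff_def by (intro Bochner_Integration.integral_cong) (auto simp: left_diff_distrib sum_distrib_right mult.assoc)
  also have "\<dots> = coeff f j - (\<integral>x. (\<Sum>i\<in>F. a i * (e i x * cnj (e j x))) \<partial>M)"
    unfolding coeff_def using int
    by (intro Bochner_Integration.integral_diff Bochner_Integration.integrable_sum integrable_mult_cnj f e_square j)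
  also have "(\<integral>x. (\<Sum>i\<in>F. a i * (e i x * cnj (e j x))) \<partial>M) = (\<Sum>i\<in>F. \<integral>x. a i * (e i x * cnj (e j x)) \<partial>M)"
    by (rule Bochner_Integration.integral_sum) (rule int)
  also have "\<dots> = (\<Sum>i\<in>F. a i * (\<integral>x. e i x * cnj (e j x) \<partial>M))" by simp
  also have "(\<Sum>i\<in>F. a i * (\<integral>x. e i x * cnj (e j x) \<partial>M)) = 0"
    using F j by (intro sum.neutral) (auto simp: e_orthonormal subset_iff)
  finally show ?thesis by simp
qed

text \<open>Completing the square in \<open>a\<close>. The coefficient is left arbitrary so that
  Fourier sums can be compared with any other combination.\<close>

lemma integral_square_diff:
  assumes g: "square_integrable M g" and j: "j \<in> I"
  shows "(\<integral>x. (cmod (g x - a * e j x))\<^sup>2 \<partial>M)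
    = (\<integral>x. (cmod (g x))\<^sup>2 \<partial>M) - (cmod (coeff g j))\<^sup>2 + (cmod (a - coeff g j))\<^sup>2"
proof -
  have ej: "(\<integral>x. (cmod (e j x))\<^sup>2 \<partial>M) = 1"
  proof -
    have "complex_of_real (\<integral>x. (cmod (e j x))\<^sup>2 \<partial>M) = (\<integral>x. e j x * cnj (e j x) \<partial>M)"
      by (simp only: complex_norm_square flip: integral_complex_of_real)
    then show ?thesis using e_orthonormal[OF j j] by simp
  qed
  have pt: "(cmod (g x - a * e j x))\<^sup>2 = (cmod (g x))\<^sup>2 - 2 * Re (cnj a * (g x * cnj (e j x))) + (cmod a)\<^sup>2 * (cmod (e j x))\<^sup>2" for x
    unfolding cmod_power2 by (simp add: power2_eq_square algebra_simps)
  have int: "integrable M (\<lambda>x. g x * cnj (e j x))" by (rule integrable_mult_cnj[OF g e_square[OF j]])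
  have int': "integrable M (\<lambda>x. cnj a * (g x * cnj (e j x)))" by (rule integrable_mult_right) (rule int)
  have re: "(\<integral>x. Re (cnj a * (g x * cnj (e j x))) \<partial>M) = Re (cnj a * coeff g j)"
    unfolding integral_Re[OF int'] coeff_def integral_mult_right_zero ..
  have 1: "(\<integral>x. (cmod (g x - a * e j x))\<^sup>2 \<partial>M)
      = (\<integral>x. (cmod (g x))\<^sup>2 - 2 * Re (cnj a * (g x * cnj (e j x))) \<partial>M) + (\<integral>x. (cmod a)\<^sup>2 * (cmod (e j x))\<^sup>2 \<partial>M)"
    unfolding pt
    by (intro Bochner_Integration.integral_add Bochner_Integration.integrable_diff integrable_mult_right
        square_integrableD(2)[OF g] square_integrableD(2)[OF e_square[OF j]] integrable_Re int')
  have 2: "(\<integral>x. (cmod (g x))\<^sup>2 - 2 * Re (cnj a * (g x * cnj (e j x))) \<partial>M)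
      = (\<integral>x. (cmod (g x))\<^sup>2 \<partial>M) - (\<integral>x. 2 * Re (cnj a * (g x * cnj (e j x))) \<partial>M)"
    by (intro Bochner_Integration.integral_diff integrable_mult_right
        square_integrableD(2)[OF g] integrable_Re int')
  have "(cmod (a - c))\<^sup>2 = (cmod a)\<^sup>2 - 2 * Re (cnj a * c) + (cmod c)\<^sup>2" for c
    unfolding cmod_power2 by (simp add: power2_eq_square algebra_simps)
  then show ?thesis
    unfolding 1 2 by (simp only: integral_mult_right_zero re ej)
qed

text \<open>Subtracting terms with other indices leaves the coefficient at \<open>j\<close>
  unchanged, so the one-term identity can be iterated. The last sum vanishes for the Fourier
  coefficients, which therefore minimise the distance, and enlarging \<open>F\<close> then cannot
  increase it.\<close>

lemma integral_square_diff_sum: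
  assumes f: "square_integrable M f" and "finite F" "F \<subseteq> I"
  shows "(\<integral>x. (cmod (f x - (\<Sum>i\<in>F. a i * e i x)))\<^sup>2 \<partial>M)
    = (\<integral>x. (cmod (f x))\<^sup>2 \<partial>M) - (\<Sum>i\<in>F. (cmod (coeff f i))\<^sup>2) + (\<Sum>i\<in>F. (cmod (a i - coeff f i))\<^sup>2)"
  using assms(2,3)
proof (induction F rule: finite_induct)
  case (insert j F)
  let ?g = "\<lambda>x. f x - (\<Sum>i\<in>F. a i * e i x)"
  have j: "j \<in> I" "F \<subseteq> I" using insert by auto
  have g: "square_integrable M ?g"
    using j by (intro square_integrable_diff[OF f] square_integrable_sum square_integrable_scale e_square) auto
  have "(\<integral>x. (cmod (f x - (\<Sum>i\<in>insert j F. a i * e i x)))\<^sup>2 \<partial>M) = (\<integral>x. (cmod (?g x - a j * e j x))\<^sup>2 \<partial>M)"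
    using insert by (simp add: algebra_simps)
  also have "\<dots> = (\<integral>x. (cmod (?g x))\<^sup>2 \<partial>M) - (cmod (coeff ?g j))\<^sup>2 + (cmod (a j - coeff ?g j))\<^sup>2"
    by (rule integral_square_diff[OF g j(1)])
  finally show ?case
    using insert coeff_diff_sum[OF f insert(1) j(2) j(1) insert(2), of a] by simp
qed simp

text \<open>Equality is asked on \<open>space M\<close> only, since functions of digit sequences are
  arbitrary where an entry is not a digit.\<close>

definition span :: "('a \<Rightarrow> complex) \<Rightarrow> bool" where
  "span g \<longleftrightarrow> (\<exists>F a. finite F \<and> F \<subseteq> I \<and> (\<forall>x\<in>space M. g x = (\<Sum>i\<in>F. a i * e i x)))"

lemma span_square: "span g \<Longrightarrow> square_integrable M g"
proof -
  assume "span g"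
  then obtain F a where F: "finite F" "F \<subseteq> I" and g: "\<And>x. x \<in> space M \<Longrightarrow> g x = (\<Sum>i\<in>F. a i * e i x)"
    unfolding span_def by blast
  have "square_integrable M (\<lambda>x. \<Sum>i\<in>F. a i * e i x)"
    using F by (intro square_integrable_sum square_integrable_scale e_square) auto
  moreover have "g \<in> borel_measurable M \<longleftrightarrow> (\<lambda>x. \<Sum>i\<in>F. a i * e i x) \<in> borel_measurable M"
    by (rule measurable_cong) (rule g)
  moreover have "integrable M (\<lambda>x. (cmod (g x))\<^sup>2) \<longleftrightarrow> integrable M (\<lambda>x. (cmod (\<Sum>i\<in>F. a i * e i x))\<^sup>2)"
    by (rule Bochner_Integration.integrable_cong) (auto simp: g)
  ultimately show ?thesis unfolding square_integrable_def by simp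
qed

lemma span_base: "i \<in> I \<Longrightarrow> span (e i)"
  unfolding span_def by (intro exI[of _ "{i}"] exI[of _ "\<lambda>_. 1"]) auto

lemma span_cong: "(\<And>x. x \<in> space M \<Longrightarrow> f x = g x) \<Longrightarrow> span f \<longleftrightarrow> span g"
  unfolding span_def by auto

lemma span_scale: "span f \<Longrightarrow> span (\<lambda>x. c * f x)"
  unfolding span_def
proof (elim exE conjE)
  fix F a assume "finite F" "F \<subseteq> I" "\<forall>x\<in>space M. f x = (\<Sum>i\<in>F. a i * e i x)"
  then show "\<exists>F a. finite F \<and> F \<subseteq> I \<and> (\<forall>x\<in>space M. c * f x = (\<Sum>i\<in>F. a i * e i x))"
    by (intro exI[of _ F] exI[of _ "\<lambda>i. c * a i"]) (auto simp: sum_distrib_left mult.assoc)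
qed

lemma span_add: "span f \<Longrightarrow> span g \<Longrightarrow> span (\<lambda>x. f x + g x)"
  unfolding span_def
proof (elim exE conjE)
  fix F a F' a' assume F: "finite F" "F \<subseteq> I" "\<forall>x\<in>space M. f x = (\<Sum>i\<in>F. a i * e i x)"
    and F': "finite F'" "F' \<subseteq> I" "\<forall>x\<in>space M. g x = (\<Sum>i\<in>F'. a' i * e i x)"
  define b where "b i = (if i \<in> F then a i else 0) + (if i \<in> F' then a' i else 0)" for i
  have "f x + g x = (\<Sum>i\<in>F \<union> F'. b i * e i x)" if "x \<in> space M" for x
  proof -
    have "(\<Sum>i\<in>F \<union> F'. b i * e i x) = (\<Sum>i\<in>F \<union> F'. (if i \<in> F then a i * e i x else 0)) + (\<Sum>i\<in>F \<union> F'. (if i \<in> F' then a' i * e i x else 0))"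
      unfolding b_def sum.distrib[symmetric] by (intro sum.cong) (auto simp: algebra_simps)
    also have "\<dots> = (\<Sum>i\<in>F. a i * e i x) + (\<Sum>i\<in>F'. a' i * e i x)"
      using F(1) F'(1) by (simp add: sum.inter_restrict[symmetric] Int_absorb1 Int_absorb2 Un_Int_distrib2 Int_Un_distrib2)
    finally show ?thesis using F F' that by simp
  qed
  then show "\<exists>F a. finite F \<and> F \<subseteq> I \<and> (\<forall>x\<in>space M. f x + g x = (\<Sum>i\<in>F. a i * e i x))"
    using F F' by (intro exI[of _ "F \<union> F'"] exI[of _ b]) auto
qed

lemma span_0: "span (\<lambda>x. 0)"
  unfolding span_def by (intro exI[of _ "{}"]) auto

lemma span_sum: "(\<And>k. k \<in> A \<Longrightarrow> span (f k)) \<Longrightarrow> span (\<lambda>x. \<Sum>k\<in>A. f k x)"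
  by (induction A rule: infinite_finite_induct) (auto simp: span_0 span_add)

text \<open>Best approximation: once a finite set contains the indices of some close element of the
  span, the Fourier sum over it is at least as close. Hence convergence along all finite
  subsets.\<close>

theorem fourier_partial_sums_converge:
  assumes "l2_approximable M span f"
  shows "((\<lambda>F. \<integral>x. (cmod (f x - (\<Sum>i\<in>F. coeff f i * e i x)))\<^sup>2 \<partial>M) \<longlongrightarrow> 0) (finite_subsets_at_top I)"
proof (rule order_tendstoI)
  have f: "square_integrable M f" using assms by (simp add: l2_approximable_def)
  fix \<epsilon> :: real assume "0 < \<epsilon>"
  then obtain g where "span g" and "(\<integral>x. (cmod (f x - g x))\<^sup>2 \<partial>M) < \<epsilon>"
    using assms unfolding l2_approximable_def by metis
  moreover from \<open>span g\<close> obtain F a where F: "finite F" "F \<subseteq> I"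
    and "\<forall>x\<in>space M. g x = (\<Sum>i\<in>F. a i * e i x)"
    unfolding span_def by (elim exE conjE)
  moreover from this have "(\<integral>x. (cmod (f x - g x))\<^sup>2 \<partial>M) = (\<integral>x. (cmod (f x - (\<Sum>i\<in>F. a i * e i x)))\<^sup>2 \<partial>M)"
    by (intro Bochner_Integration.integral_cong) auto
  ultimately have lt: "(\<integral>x. (cmod (f x - (\<Sum>i\<in>F. a i * e i x)))\<^sup>2 \<partial>M) < \<epsilon>"
    by (simp only:)
  show "\<forall>\<^sub>F F' in finite_subsets_at_top I. (\<integral>x. (cmod (f x - (\<Sum>i\<in>F'. coeff f i * e i x)))\<^sup>2 \<partial>M) < \<epsilon>"
    unfolding eventually_finite_subsets_at_top
  proof (intro exI conjI allI impI)
    fix F' assume F': "finite F' \<and> F \<subseteq> F' \<and> F' \<subseteq> I"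
    have "(\<Sum>i\<in>F. (cmod (coeff f i))\<^sup>2) \<le> (\<Sum>i\<in>F'. (cmod (coeff f i))\<^sup>2)"
      using F' by (intro sum_mono2) auto
    moreover have "0 \<le> (\<Sum>i\<in>F. (cmod (a i - coeff f i))\<^sup>2)" by (intro sum_nonneg) auto
    ultimately show "(\<integral>x. (cmod (f x - (\<Sum>i\<in>F'. coeff f i * e i x)))\<^sup>2 \<partial>M) < \<epsilon>"
      using lt F F' by (simp add: integral_square_diff_sum[OF f])
  qed (use F in auto)
qed (auto intro!: always_eventually less_le_trans[OF _ integral_nonneg_AE])

text \<open>For both functions the squared norm minus the finite sums of squared coefficients tends
  to 0, and these finite sums coincide. Only moduli enter, so unimodular factors on the coefficients
  preserve the norm.\<close>

theorem parseval_eq: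
  assumes "l2_approximable M span f" "l2_approximable M span g"
    and eq: "\<And>i. i \<in> I \<Longrightarrow> cmod (coeff f i) = cmod (coeff g i)"
  shows "(\<integral>x. (cmod (f x))\<^sup>2 \<partial>M) = (\<integral>x. (cmod (g x))\<^sup>2 \<partial>M)"
proof -
  have lim: "((\<lambda>F. (\<integral>x. (cmod (h x))\<^sup>2 \<partial>M) - (\<Sum>i\<in>F. (cmod (coeff h i))\<^sup>2)) \<longlongrightarrow> 0) (finite_subsets_at_top I)"
    if "l2_approximable M span h" for h
  proof (rule Lim_transform_eventually[OF fourier_partial_sums_converge[OF that]])
    have "square_integrable M h" using that by (simp add: l2_approximable_def)
    then show "\<forall>\<^sub>F F in finite_subsets_at_top I. (\<integral>x. (cmod (h x - (\<Sum>i\<in>F. coeff h i * e i x)))\<^sup>2 \<partial>M)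
        = (\<integral>x. (cmod (h x))\<^sup>2 \<partial>M) - (\<Sum>i\<in>F. (cmod (coeff h i))\<^sup>2)"
      by (intro eventually_finite_subsets_at_top_weakI) (simp add: integral_square_diff_sum)
  qed
  have "((\<lambda>F. (\<integral>x. (cmod (f x))\<^sup>2 \<partial>M) - (\<integral>x. (cmod (g x))\<^sup>2 \<partial>M)) \<longlongrightarrow> 0 - 0) (finite_subsets_at_top I)"
  proof (rule Lim_transform_eventually[OF tendsto_diff[OF lim[OF assms(1)] lim[OF assms(2)]]])
    show "\<forall>\<^sub>F F in finite_subsets_at_top I.
        (\<integral>x. (cmod (f x))\<^sup>2 \<partial>M) - (\<Sum>i\<in>F. (cmod (coeff f i))\<^sup>2) - ((\<integral>x. (cmod (g x))\<^sup>2 \<partial>M) - (\<Sum>i\<in>F. (cmod (coeff g i))\<^sup>2))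
        = (\<integral>x. (cmod (f x))\<^sup>2 \<partial>M) - (\<integral>x. (cmod (g x))\<^sup>2 \<partial>M)"
    proof (intro eventually_finite_subsets_at_top_weakI)
      fix F assume "finite F" "F \<subseteq> I"
      then have "(\<Sum>i\<in>F. (cmod (coeff f i))\<^sup>2) = (\<Sum>i\<in>F. (cmod (coeff g i))\<^sup>2)"
        by (intro sum.cong) (auto simp: eq)
      then show "(\<integral>x. (cmod (f x))\<^sup>2 \<partial>M) - (\<Sum>i\<in>F. (cmod (coeff f i))\<^sup>2) - ((\<integral>x. (cmod (g x))\<^sup>2 \<partial>M) - (\<Sum>i\<in>F. (cmod (coeff g i))\<^sup>2))
        = (\<integral>x. (cmod (f x))\<^sup>2 \<partial>M) - (\<integral>x. (cmod (g x))\<^sup>2 \<partial>M)" by simp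
    qed
  qed
  then show ?thesis by (simp add: tendsto_const_iff)
qed

end

section \<open>Haar measure and wavelets on the p-adic integers\<close>

text \<open>The natural number \<open>g\<close> regarded as a p-adic integer through its base
  \<open>p\<close> digits. For \<open>g < p ^ n\<close> it is the chosen centre of the ball on which
  the first \<open>n\<close> digits encode \<open>g\<close>.\<close>

definition rep :: "nat \<Rightarrow> nat \<Rightarrow> nat \<Rightarrow> nat" where
  "rep p g j = g div p ^ j mod p"

locale padic =
  fixes p :: nat
  assumes p_ge_2: "p \<ge> 2"
begin

lemma p_pos: "p > 0" using p_ge_2 by simp

section \<open>Digits, truncations and residues modulo powers of p\<close>

lemma space_haar: "space (haar p) = {x. \<forall>j. x j < p}"
  by (auto simp: haar_def space_PiM PiE_def extensional_def space_uniform_count_measure)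

lemma rep_in_space [simp]: "rep p g \<in> space (haar p)"
  using p_pos by (simp add: space_haar rep_def)

lemma ztrunc_0 [simp]: "ztrunc p x 0 = 0"
  by (simp add: ztrunc_def)

lemma ztrunc_Suc: "ztrunc p x (Suc n) = ztrunc p x n + x n * p ^ n"
  by (simp add: ztrunc_def)

lemma ztrunc_rep: "ztrunc p (rep p g) n = g mod p ^ n"
proof (induction n)
  case (Suc n)
  then show ?case
    using mod_mult2_eq[of g "p ^ n" p] by (simp add: ztrunc_Suc rep_def mult.commute add.commute)
qed simp

lemma ztrunc_less: "x \<in> space (haar p) \<Longrightarrow> ztrunc p x n < p ^ n"
proof (induction n)
  case (Suc n)
  have "x n < p" using Suc.prems by (simp add: space_haar)
  then have "x n \<le> p - 1" by simp
  then have "x n * p ^ n \<le> (p - 1) * p ^ n" by (rule mult_right_mono) simp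
  with Suc.IH[OF Suc.prems] have "ztrunc p x (Suc n) < p ^ n + (p - 1) * p ^ n"
    unfolding ztrunc_Suc by (rule add_less_le_mono)
  also have "\<dots> = (1 + (p - 1)) * p ^ n" by (simp only: distrib_right mult_1)
  also have "\<dots> = p ^ Suc n" using p_pos by simp
  finally show ?case .
qed simp

lemma digit_ztrunc:
  assumes "x \<in> space (haar p)" "j < n"
  shows "ztrunc p x n div p ^ j mod p = x j"
  using assms(2)
proof (induction n)
  case (Suc n)
  show ?case
  proof (cases "j = n")
    case True
    then show ?thesis using ztrunc_less[OF assms(1), of n] assms(1)
      by (simp add: ztrunc_Suc space_haar p_pos)
  next
    case False
    with Suc.prems have j: "j < n" by simp
    have "p ^ n = p ^ j * (p * p ^ (n - Suc j))"
      using j by (simp flip: power_Suc power_add)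
    then have "ztrunc p x (Suc n) = ztrunc p x n + (p * (x n * p ^ (n - Suc j))) * p ^ j"
      by (simp add: ztrunc_Suc mult_ac)
    then have "ztrunc p x (Suc n) div p ^ j = ztrunc p x n div p ^ j + p * (x n * p ^ (n - Suc j))"
      using div_mult_self1[of "p ^ j" "ztrunc p x n" "p * (x n * p ^ (n - Suc j))"] p_pos
      by (simp only: power_not_zero neq0_conv not_False_eq_True add.commute)
    then show ?thesis using Suc.IH[OF j] by simp
  qed
qed simp

lemma rep_ztrunc: "x \<in> space (haar p) \<Longrightarrow> j < n \<Longrightarrow> rep p (ztrunc p x n) j = x j"
  by (simp add: rep_def digit_ztrunc)

lemma ztrunc_cong: "(\<And>j. j < n \<Longrightarrow> x j = y j) \<Longrightarrow> ztrunc p x n = ztrunc p y n"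
  by (simp add: ztrunc_def)

lemma ztrunc_eq_iff:
  assumes "x \<in> space (haar p)" "y \<in> space (haar p)"
  shows "ztrunc p x n = ztrunc p y n \<longleftrightarrow> (\<forall>j<n. x j = y j)"
  using assms by (metis rep_ztrunc ztrunc_cong)

lemma ztrunc_eq_iff_rep:
  assumes "x \<in> space (haar p)" "g < p ^ n"
  shows "ztrunc p x n = g \<longleftrightarrow> (\<forall>j<n. x j = rep p g j)"
  using ztrunc_eq_iff[OF assms(1) rep_in_space, of n g] assms(2) by (simp add: ztrunc_rep)

lemma ztrunc_mod: "x \<in> space (haar p) \<Longrightarrow> m \<le> n \<Longrightarrow> ztrunc p x n mod p ^ m = ztrunc p x m"
  using ztrunc_rep[of "ztrunc p x n" m] by (metis rep_ztrunc order_less_le_trans ztrunc_cong)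

section \<open>Haar measure of balls\<close>

sublocale digit_space: product_prob_space "\<lambda>_. uniform_count_measure {..<p}" "UNIV :: nat set"
proof -
  interpret prob_space "uniform_count_measure {..<p}"
    by (rule prob_space_uniform_count_measure) (use p_pos in auto)
  show "product_prob_space (\<lambda>_. uniform_count_measure {..<p})" ..
qed

sublocale haar: prob_space "haar p"
  unfolding haar_def by (rule digit_space.prob_space_axioms)

lemma cylinder_emb:
  assumes "g < p ^ n"
  shows "{x \<in> space (haar p). ztrunc p x n = g}
    = prod_emb UNIV (\<lambda>_. uniform_count_measure {..<p}) {..<n} (\<Pi>\<^sub>E j\<in>{..<n}. {rep p g j})"
proof -
  have "{x \<in> space (haar p). ztrunc p x n = g} = {x \<in> space (haar p). \<forall>j<n. x j = rep p g j}"
    using ztrunc_eq_iff_rep[OF _ assms] by blast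
  also have "\<dots> = prod_emb UNIV (\<lambda>_. uniform_count_measure {..<p}) {..<n} (\<Pi>\<^sub>E j\<in>{..<n}. {rep p g j})"
    by (auto simp: prod_emb_def space_haar PiE_iff space_uniform_count_measure)
  finally show ?thesis .
qed

lemma emeasure_cylinder:
  assumes "g < p ^ n"
  shows "{x \<in> space (haar p). ztrunc p x n = g} \<in> sets (haar p)"
    and "emeasure (haar p) {x \<in> space (haar p). ztrunc p x n = g} = ennreal (1 / real p ^ n)"
proof -
  have rep: "rep p g j < p" for j using p_pos by (simp add: rep_def)
  then have sets: "{rep p g j} \<in> sets (uniform_count_measure {..<p})" for j
    by (simp add: sets_uniform_count_measure)
  show "{x \<in> space (haar p). ztrunc p x n = g} \<in> sets (haar p)"
    unfolding cylinder_emb[OF assms] unfolding haar_def by (intro sets_PiM_I) (use sets in auto)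
  have "emeasure (uniform_count_measure {..<p}) {rep p g j} = ennreal (1 / real p)" for j
    using rep p_pos by (subst emeasure_uniform_count_measure) (auto simp: divide_ennreal ennreal_of_nat_eq_real_of_nat)
  then have "emeasure (haar p) {x \<in> space (haar p). ztrunc p x n = g} = (\<Prod>j<n. ennreal (1 / real p))"
    unfolding cylinder_emb[OF assms] unfolding haar_def
    by (subst digit_space.emeasure_PiM_emb) (use sets in auto)
  also have "\<dots> = ennreal (1 / real p ^ n)"
    by (simp add: ennreal_power power_one_over)
  finally show "emeasure (haar p) {x \<in> space (haar p). ztrunc p x n = g} = ennreal (1 / real p ^ n)" .
qed

lemma measurable_ztrunc [measurable]: "(\<lambda>x. ztrunc p x n) \<in> haar p \<rightarrow>\<^sub>M count_space UNIV"
proof (subst measurable_count_space_eq2_countable, intro conjI ballI)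
  fix g :: nat
  show "(\<lambda>x. ztrunc p x n) -` {g} \<inter> space (haar p) \<in> sets (haar p)"
  proof (cases "g < p ^ n")
    case True
    then show ?thesis using emeasure_cylinder(1)[OF True] by (simp add: vimage_def Int_def conj_commute)
  next
    case False
    then have "(\<lambda>x. ztrunc p x n) -` {g} \<inter> space (haar p) = {}" using ztrunc_less by auto
    then show ?thesis by simp
  qed
qed auto

lemma measurable_digit [measurable]: "(\<lambda>x. x j) \<in> haar p \<rightarrow>\<^sub>M count_space UNIV"
proof -
  have "(\<lambda>x. ztrunc p x (Suc j) div p ^ j mod p) \<in> haar p \<rightarrow>\<^sub>M count_space UNIV"
    by measurable
  then show ?thesis
    by (subst measurable_cong[where g = "\<lambda>x. ztrunc p x (Suc j) div p ^ j mod p"])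
      (simp_all add: digit_ztrunc)
qed

text \<open>The functions constant on balls of radius \<open>p ^ (-n)\<close>. Phrasing this through
  the centre \<open>rep\<close> makes their integrals finite averages over
  \<open>g < p ^ n\<close>.\<close>

definition level :: "nat \<Rightarrow> ((nat \<Rightarrow> nat) \<Rightarrow> 'b) \<Rightarrow> bool" where
  "level n f \<longleftrightarrow> (\<forall>x\<in>space (haar p). f x = f (rep p (ztrunc p x n)))"

lemma levelD: "level n f \<Longrightarrow> x \<in> space (haar p) \<Longrightarrow> f x = f (rep p (ztrunc p x n))"
  unfolding level_def by blast

lemma level_comp: "level n f \<Longrightarrow> level n (\<lambda>x. h (f x))"
  unfolding level_def by metis

lemma level_comp2: "level n f \<Longrightarrow> level n g \<Longrightarrow> level n (\<lambda>x. h (f x) (g x))"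
  unfolding level_def by metis

lemma level_ztrunc: "m \<le> n \<Longrightarrow> level n (\<lambda>x. h (ztrunc p x m))"
  unfolding level_def by (auto simp: ztrunc_rep ztrunc_mod)

lemma levelI_ztrunc:
  "(\<And>x. x \<in> space (haar p) \<Longrightarrow> f x = h (ztrunc p x m)) \<Longrightarrow> m \<le> n \<Longrightarrow> level n f"
  unfolding level_def by (auto simp: ztrunc_rep ztrunc_mod)

lemma measurable_level:
  fixes f :: "_ \<Rightarrow> 'b::topological_space"
  assumes "level n f" shows "f \<in> borel_measurable (haar p)"
proof -
  have "(\<lambda>x. f (rep p (ztrunc p x n))) \<in> borel_measurable (haar p)"
    by (rule measurable_compose[OF measurable_ztrunc]) simp
  then show ?thesis
    using measurable_cong[of "haar p" f, OF levelD[OF assms]] by blast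
qed

lemma level_bounded:
  fixes f :: "_ \<Rightarrow> 'b::real_normed_vector"
  assumes "level n f" obtains B where "\<And>x. x \<in> space (haar p) \<Longrightarrow> norm (f x) \<le> B"
proof
  fix x assume x: "x \<in> space (haar p)"
  have "norm (f x) = norm (f (rep p (ztrunc p x n)))" by (rule arg_cong[OF levelD[OF assms x]])
  also have "\<dots> \<le> (\<Sum>g<p ^ n. norm (f (rep p g)))"
    using ztrunc_less[OF x] by (intro member_le_sum) auto
  finally show "norm (f x) \<le> (\<Sum>g<p ^ n. norm (f (rep p g)))" .
qed

lemma level_expand:
  fixes f :: "_ \<Rightarrow> 'b::real_vector"
  assumes "level n f" "x \<in> space (haar p)"
  shows "f x = (\<Sum>g<p ^ n. indicator {x \<in> space (haar p). ztrunc p x n = g} x *\<^sub>R f (rep p g))"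
proof -
  have "(\<Sum>g<p ^ n. indicator {x \<in> space (haar p). ztrunc p x n = g} x *\<^sub>R f (rep p g))
     = (\<Sum>g<p ^ n. if ztrunc p x n = g then f (rep p g) else 0)"
    using assms(2) by (intro sum.cong) (auto simp: indicator_def)
  also have "\<dots> = f (rep p (ztrunc p x n))" using ztrunc_less[OF assms(2)] by simp
  also have "\<dots> = f x" by (rule levelD[OF assms, symmetric])
  finally show ?thesis by (rule sym)
qed

lemma integral_level:
  fixes f :: "_ \<Rightarrow> 'b::{banach, second_countable_topology}"
  assumes "level n f"
  shows "integrable (haar p) f" "(\<integral>x. f x \<partial>haar p) = (1 / real p ^ n) *\<^sub>R (\<Sum>g<p ^ n. f (rep p g))"
proof -
  let ?C = "\<lambda>g. {x \<in> space (haar p). ztrunc p x n = g}"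
  have 1: "has_bochner_integral (haar p) (\<lambda>x. \<Sum>g<p ^ n. indicator (?C g) x *\<^sub>R f (rep p g))
      (\<Sum>g<p ^ n. measure (haar p) (?C g) *\<^sub>R f (rep p g))"
    using emeasure_cylinder
    by (intro has_bochner_integral_sum has_bochner_integral_scaleR_left has_bochner_integral_real_indicator)
      (auto simp: emeasure_cylinder)
  have 2: "measure (haar p) (?C g) = 1 / real p ^ n" if "g < p ^ n" for g
    using emeasure_cylinder(2)[OF that] by (simp add: measure_def)
  have "has_bochner_integral (haar p) f (\<Sum>g<p ^ n. measure (haar p) (?C g) *\<^sub>R f (rep p g))"
    using 1 has_bochner_integral_cong[of "haar p" "haar p" f, OF refl level_expand[OF assms] refl] by blast
  moreover have "(\<Sum>g<p ^ n. measure (haar p) (?C g) *\<^sub>R f (rep p g)) = (1 / real p ^ n) *\<^sub>R (\<Sum>g<p ^ n. f (rep p g))"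
    unfolding scaleR_sum_right by (intro sum.cong) (auto simp: 2)
  ultimately have *: "has_bochner_integral (haar p) f ((1 / real p ^ n) *\<^sub>R (\<Sum>g<p ^ n. f (rep p g)))"
    by simp
  from * show "integrable (haar p) f" by (rule integrable.intros)
  from * show "(\<integral>x. f x \<partial>haar p) = (1 / real p ^ n) *\<^sub>R (\<Sum>g<p ^ n. f (rep p g))"
    by (rule has_bochner_integral_integral_eq)
qed

lemma sum_Suc_level: "(\<Sum>g<p ^ Suc n. h g) = (\<Sum>d<p. \<Sum>\<beta><p ^ n. h (\<beta> + d * p ^ n))"
proof -
  have "(\<Sum>g<p ^ Suc n. h g) = (\<Sum>d<p. sum h {d * p ^ n..<d * p ^ n + p ^ n})"
    by (simp add: sum.nat_group)
  also have "\<dots> = (\<Sum>d<p. \<Sum>\<beta><p ^ n. h (\<beta> + d * p ^ n))"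
  proof (rule sum.cong)
    fix d
    show "sum h {d * p ^ n..<d * p ^ n + p ^ n} = (\<Sum>\<beta><p ^ n. h (\<beta> + d * p ^ n))"
      using sum.shift_bounds_nat_ivl[of h 0 "d * p ^ n" "p ^ n"]
      by (simp only: lessThan_atLeast0 add.commute[of "d * p ^ n"] add_0)
  qed simp
  finally show ?thesis .
qed

text \<open>Independence of the digit with index \<open>n\<close> from the digits before it. The
  vanishing mean of wavelets and their orthogonality across frequencies and scales reduce to this
  factorisation.\<close>

lemma integral_level_digit:
  fixes f :: "_ \<Rightarrow> complex"
  assumes f: "level n f"
  shows "level (Suc n) (\<lambda>x. f x * \<phi> (x n))"
    and "(\<integral>x. f x * \<phi> (x n) \<partial>haar p) = (\<integral>x. f x \<partial>haar p) * ((\<Sum>d<p. \<phi> d) / of_nat p)"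
proof -
  have fr: "f (rep p (g + d * p ^ n)) = f (rep p g)" for g d
    using f unfolding level_def by (metis mod_mult_self3 mod_mult_self1 rep_in_space ztrunc_rep)
  show lev: "level (Suc n) (\<lambda>x. f x * \<phi> (x n))"
    unfolding level_def
  proof
    fix x assume x: "x \<in> space (haar p)"
    have "f x = f (rep p (ztrunc p x n))" by (rule levelD[OF f x])
    also have "\<dots> = f (rep p (ztrunc p x (Suc n)))" by (simp add: ztrunc_Suc fr)
    finally show "f x * \<phi> (x n) = f (rep p (ztrunc p x (Suc n))) * \<phi> (rep p (ztrunc p x (Suc n)) n)"
      using rep_ztrunc[OF x, of n "Suc n"] by simp
  qed
  have dig: "rep p (\<beta> + d * p ^ n) n = d" if "\<beta> < p ^ n" "d < p" for \<beta> d
    using that by (simp add: rep_def)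
  have "(\<Sum>g<p ^ Suc n. f (rep p g) * \<phi> (rep p g n)) = (\<Sum>d<p. \<Sum>\<beta><p ^ n. f (rep p \<beta>) * \<phi> d)"
    unfolding sum_Suc_level by (intro sum.cong) (auto simp: fr dig)
  also have "\<dots> = (\<Sum>\<beta><p ^ n. f (rep p \<beta>)) * (\<Sum>d<p. \<phi> d)"
    by (simp add: sum_distrib_left sum_distrib_right)
  finally show "(\<integral>x. f x * \<phi> (x n) \<partial>haar p) = (\<integral>x. f x \<partial>haar p) * ((\<Sum>d<p. \<phi> d) / of_nat p)"
    unfolding integral_level(2)[OF f] integral_level(2)[OF lev]
    by (simp add: scaleR_conv_of_real field_simps)
qed

section \<open>Additive characters modulo p and orthonormality of the wavelets\<close>

definition root_char :: "int \<Rightarrow> nat \<Rightarrow> complex" where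
  "root_char k d = exp (2 * pi * \<i> * (of_int k * of_nat d / of_nat p))"

lemma root_char_0 [simp]: "root_char 0 d = 1" "root_char k 0 = 1"
  by (simp_all add: root_char_def)

lemma root_char_mult: "root_char k d * root_char l d = root_char (k + l) d"
  unfolding root_char_def exp_add[symmetric] by (simp add: field_simps add_divide_distrib)

lemma cnj_root_char: "cnj (root_char k d) = root_char (- k) d"
  unfolding root_char_def exp_cnj by simp

text \<open>A geometric sum of powers of a \<open>p\<close>-th root of unity. The bound leaves 0 as
  the only multiple of \<open>p\<close>, and differences of two frequencies below \<open>p\<close>
  satisfy it.\<close>

lemma sum_root_char:
  assumes "\<bar>k\<bar> < int p" shows "(\<Sum>d<p. root_char k d) = (if k = 0 then of_nat p else 0)"
proof (cases "k = 0")
  case False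
  define z where "z = exp (2 * pi * \<i> * (of_int k / of_nat p))"
  have pow: "root_char k d = z ^ d" for d
    unfolding root_char_def z_def exp_of_nat_mult[symmetric] by (simp add: mult_ac)
  have "z ^ p = exp (2 * of_int k * pi * \<i>)"
    unfolding z_def exp_of_nat_mult[symmetric] using p_pos by (simp add: mult_ac)
  also have "\<dots> = 1" using exp_integer_2pi[of "of_int k"] by (simp add: mult_ac)
  finally have zp: "z ^ p = 1" .
  have "z \<noteq> 1"
  proof
    assume "z = 1"
    then obtain n :: int where "2 * pi * (of_int k / of_nat p) = of_int (2 * n) * pi"
      unfolding z_def exp_eq_1 by auto
    then have "real_of_int k = of_int n * real p"
      using p_pos by (simp add: field_simps)
    then have "k = n * int p" by (metis of_int_eq_iff of_int_mult of_int_of_nat_eq)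
    with assms False show False by (auto simp: abs_mult)
  qed
  then show ?thesis using False unfolding pow by (simp add: sum_gp_strict zp)
qed simp

lemma chi_frac_eq: "chi_frac p n z = exp (2 * pi * \<i> * (of_int z / of_nat p ^ n))"
proof -
  define q where "q = int p ^ n"
  have q: "q \<noteq> 0" using p_pos by (simp add: q_def)
  have "z = z mod q + q * (z div q)" by simp
  then have "(of_int z :: complex) = of_int (z mod q) + of_int q * of_int (z div q)"
    by (metis of_int_add of_int_mult)
  then have "(of_int z / of_int q :: complex) = of_int (z mod q) / of_int q + of_int (z div q)"
    using q by (simp add: add_divide_distrib)
  then have "exp (2 * pi * \<i> * (of_int z / of_int q)) = exp (2 * pi * \<i> * (of_int (z mod q) / of_int q)) * exp (2 * pi * \<i> * of_int (z div q))"
    by (simp add: distrib_left exp_add)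
  also have "exp (2 * pi * \<i> * of_int (z div q)) = 1"
    using exp_integer_2pi[of "of_int (z div q)"] by (simp add: mult_ac)
  finally show ?thesis unfolding chi_frac_def q_def[symmetric] by (simp add: q_def)
qed

lemma chi_frac_add: "chi_frac p n (a + b) = chi_frac p n a * chi_frac p n b"
  unfolding chi_frac_eq by (simp add: add_divide_distrib distrib_left exp_add)

lemma chi_frac_digit: "chi_frac p (Suc m) (k * (int d * int p ^ m)) = root_char k d"
  unfolding chi_frac_eq root_char_def using p_pos by simp

text \<open>On the ball where \<open>ztrunc p x m = \<beta>\<close>, the difference
  \<open>x - \<beta>\<close> modulo \<open>p ^ Suc m\<close> is the digit \<open>x m\<close> times
  \<open>p ^ m\<close>. A wavelet thus separates into a function of the first \<open>m\<close>
  digits and a character of the next one.\<close>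

lemma wavelet_eq:
  "wavelet p m \<beta> k x = (if ztrunc p x m = \<beta> then complex_of_real (sqrt (real p ^ m)) else 0) * root_char (int k) (x m)"
  using chi_frac_digit[of m "int k" "x m"] by (auto simp: wavelet_def ztrunc_Suc)

lemma wavelet_0: "wavelet p 0 0 0 x = 1"
  by (simp add: wavelet_eq)

lemma level_wavelet: "level (Suc m) (wavelet p m \<beta> k)"
  unfolding wavelet_eq[abs_def] by (rule integral_level_digit(1)) (rule level_ztrunc[OF order_refl])

lemma level_mono: "level m f \<Longrightarrow> m \<le> n \<Longrightarrow> level n f"
  by (rule levelI_ztrunc[where h = "\<lambda>g. f (rep p g)" and m = m]) (rule levelD)

text \<open>The digit \<open>x m\<close> is independent of \<open>f\<close>, and a nontrivial
  character has mean 0. A coarser wavelet for \<open>f\<close> gives orthogonality between scales, a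
  constant gives vanishing mean.\<close>

lemma integral_level_wavelet:
  assumes "level m f" "1 \<le> k" "k \<le> p - 1"
  shows "(\<integral>x. f x * wavelet p m \<beta> k x \<partial>haar p) = 0"
    and "(\<integral>x. f x * cnj (wavelet p m \<beta> k x) \<partial>haar p) = 0"
proof -
  have lev: "level m (\<lambda>x. f x * (if ztrunc p x m = \<beta> then complex_of_real (sqrt (real p ^ m)) else 0))"
    by (intro level_comp2[where h = "(*)"] assms(1) level_ztrunc[OF order_refl])
  show "(\<integral>x. f x * wavelet p m \<beta> k x \<partial>haar p) = 0"
    using integral_level_digit(2)[OF lev, of "root_char (int k)"] assms p_ge_2
    by (simp add: wavelet_eq sum_root_char mult.assoc)
  have "cnj (wavelet p m \<beta> k x) = (if ztrunc p x m = \<beta> then complex_of_real (sqrt (real p ^ m)) else 0) * root_char (- int k) (x m)" for x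
    by (simp add: wavelet_eq cnj_root_char)
  then show "(\<integral>x. f x * cnj (wavelet p m \<beta> k x) \<partial>haar p) = 0"
    using integral_level_digit(2)[OF lev, of "root_char (- int k)"] assms p_ge_2
    by (simp add: sum_root_char mult.assoc)
qed

lemma wavelet_orthonormal_same:
  assumes "\<beta> < p ^ m" "k < p" "k' < p"
  shows "(\<integral>x. wavelet p m \<beta> k x * cnj (wavelet p m \<beta>' k' x) \<partial>haar p) = (if \<beta> = \<beta>' \<and> k = k' then 1 else 0)"
proof (cases "\<beta> = \<beta>'")
  case True
  let ?f = "\<lambda>x. (if ztrunc p x m = \<beta> then of_nat p ^ m else 0) :: complex"
  have lev: "level m ?f" by (rule level_ztrunc[OF order_refl])
  have eq: "wavelet p m \<beta> k x * cnj (wavelet p m \<beta>' k' x) = ?f x * root_char (int k - int k') (x m)" for x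
  proof -
    have "complex_of_real (sqrt (real p ^ m)) * complex_of_real (sqrt (real p ^ m)) = of_nat p ^ m"
      by (simp flip: of_real_mult)
    then show ?thesis
      by (auto simp: wavelet_eq cnj_root_char True root_char_mult[of "int k" _ "- int k'", simplified, symmetric] mult_ac)
  qed
  have "(\<integral>x. ?f x \<partial>haar p) = 1"
    unfolding integral_level(2)[OF lev] using assms(1) p_pos
    by (simp add: ztrunc_rep scaleR_conv_of_real)
  then show ?thesis
    unfolding eq integral_level_digit(2)[OF lev] using assms True p_pos by (simp add: sum_root_char)
next
  case False
  have z: "wavelet p m \<beta> k x * cnj (wavelet p m \<beta>' k' x) = 0" for x
    using False by (simp add: wavelet_eq)
  show ?thesis unfolding z using False by simp
qed

text \<open>The constant function is the (degenerate) wavelet with \<open>m = \<beta> = k = 0\<close>.\<close>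

definition basis_index :: "(nat \<times> nat \<times> nat) set" where
  "basis_index = insert (0, 0, 0) (wav_index p)"

definition basis :: "nat \<times> nat \<times> nat \<Rightarrow> (nat \<Rightarrow> nat) \<Rightarrow> complex" where
  "basis = (\<lambda>(m, \<beta>, k). wavelet p m \<beta> k)"

lemma square_integrable_level:
  assumes "level n f" shows "square_integrable (haar p) f"
proof -
  have "level n (\<lambda>x. (cmod (f x))\<^sup>2)" by (rule level_comp[OF assms])
  then show ?thesis
    unfolding square_integrable_def using measurable_level[OF assms] integral_level(1) by blast
qed

sublocale basis: orthonormal_system "haar p" basis_index basis
proof
  fix i assume "i \<in> basis_index"
  show "square_integrable (haar p) (basis i)"
    by (cases i) (auto simp: basis_def intro: square_integrable_level level_wavelet)
next
  fix i j assume ij: "i \<in> basis_index" "j \<in> basis_index"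
  obtain m \<beta> k where i: "i = (m, \<beta>, k)" by (cases i)
  obtain m' \<beta>' k' where j: "j = (m', \<beta>', k')" by (cases j)
  have b: "\<beta> < p ^ m" "k < p" "\<beta>' < p ^ m'" "k' < p"
    "k \<ge> 1 \<or> (m = 0 \<and> k = 0)" "k' \<ge> 1 \<or> (m' = 0 \<and> k' = 0)"
    using ij p_ge_2 by (auto simp: i j basis_index_def wav_index_def)
  \<comment> \<open>At different scales the coarser function is locally constant at the level of the
    finer one; the finer scale is positive, so its frequency is nonzero.\<close>
  consider "m = m'" | "m < m'" | "m' < m" by linarith
  then show "(\<integral>x. basis i x * cnj (basis j x) \<partial>haar p) = (if i = j then 1 else 0)"
  proof cases
    case 1
    then show ?thesis using wavelet_orthonormal_same[of \<beta> m k k' \<beta>'] b by (auto simp: i j basis_def)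
  next
    case 2
    then have "(\<integral>x. wavelet p m \<beta> k x * cnj (wavelet p m' \<beta>' k' x) \<partial>haar p) = 0"
      using b by (intro integral_level_wavelet(2) level_mono[OF level_wavelet]) auto
    then show ?thesis using 2 by (simp add: i j basis_def)
  next
    case 3
    have "level (Suc m') (\<lambda>x. cnj (wavelet p m' \<beta>' k' x))"
      by (rule level_comp[OF level_wavelet])
    then have "(\<integral>x. cnj (wavelet p m' \<beta>' k' x) * wavelet p m \<beta> k x \<partial>haar p) = 0"
      using b 3 by (intro integral_level_wavelet(1)[OF level_mono[of "Suc m'"]]) auto
    then show ?thesis using 3 by (simp add: i j basis_def mult.commute)
  qed
qed

text \<open>Refining a ball by one digit is Fourier inversion on that digit. The trivial frequency
  gives the parent ball, covered by the induction hypothesis; the other frequencies give wavelets on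
  it.\<close>

lemma span_cylinder: "basis.span (\<lambda>x. if ztrunc p x n = g then 1 else 0)"
proof (induction n arbitrary: g)
  case 0
  show ?case
  proof (cases "g = 0")
    case True
    then show ?thesis using basis.span_base[of "(0, 0, 0)"]
      by (simp add: basis_index_def basis_def wavelet_0[abs_def])
  next
    case False
    then show ?thesis by (simp add: basis.span_0)
  qed
next
  case (Suc n)
  show ?case
  proof (cases "g < p ^ Suc n")
    case False
    then have "basis.span (\<lambda>x. if ztrunc p x (Suc n) = g then 1 else 0) \<longleftrightarrow> basis.span (\<lambda>x. 0)"
      by (intro basis.span_cong) (use ztrunc_less[of _ "Suc n"] in auto)
    then show ?thesis by (simp add: basis.span_0)
  next
    case True
    define \<beta> where "\<beta> = g mod p ^ n"
    define d where "d = g div p ^ n"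
    have d: "d < p" using True p_pos by (simp add: d_def less_mult_imp_div_less)
    have \<beta>: "\<beta> < p ^ n" using p_pos by (simp add: \<beta>_def)
    have g: "g = \<beta> + d * p ^ n" unfolding \<beta>_def d_def by (rule mod_div_mult_eq[symmetric])
    \<comment> \<open>Fourier coefficients of the indicator of \<open>x n = d\<close> as a function
      of the digit; the square root undoes the L2 normalisation of the wavelet.\<close>
    define c where "c k = (if k = 0 then 1 / of_nat p else root_char (- int k) d / of_nat p / complex_of_real (sqrt (real p ^ n)))" for k
    have span: "basis.span (\<lambda>x. (1 / of_nat p) * (if ztrunc p x n = \<beta> then 1 else 0) + (\<Sum>k\<in>{1..p - 1}. c k * basis (n, \<beta>, k) x))"
      by (intro basis.span_add basis.span_scale basis.span_sum basis.span_base Suc.IH)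
        (auto simp: basis_index_def wav_index_def \<beta>)
    have eq: "(if ztrunc p x (Suc n) = g then 1 else 0)
      = (1 / of_nat p) * (if ztrunc p x n = \<beta> then 1 else 0) + (\<Sum>k\<in>{1..p - 1}. c k * basis (n, \<beta>, k) x)"
      if x: "x \<in> space (haar p)" for x
    proof (cases "ztrunc p x n = \<beta>")
      case False
      then have "ztrunc p x (Suc n) \<noteq> g"
        using ztrunc_mod[OF x, of n "Suc n"] by (auto simp: \<beta>_def)
      then show ?thesis using False by (simp add: basis_def wavelet_eq)
    next
      case True
      have xn: "x n < p" using x by (simp add: space_haar)
      have iff: "ztrunc p x (Suc n) = g \<longleftrightarrow> x n = d"
        using p_pos by (simp add: ztrunc_Suc True g)
      \<comment> \<open>Frequency and digit exchange roles, so that the sum over \<open>k\<close>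
        becomes a full character sum.\<close>
      have rc: "root_char (int k) (x n) * root_char (- int k) d = root_char (int (x n) - int d) k" for k
        unfolding root_char_def exp_add[symmetric]
        by (rule arg_cong[where f = exp]) (simp add: field_simps diff_divide_distrib)
      have "(\<Sum>k\<in>{1..p - 1}. c k * basis (n, \<beta>, k) x)
          = (\<Sum>k\<in>{1..p - 1}. root_char (int (x n) - int d) k / of_nat p)"
        using p_pos by (intro sum.cong) (auto simp: c_def basis_def wavelet_eq True rc[symmetric])
      also have "1 / of_nat p + \<dots> = (\<Sum>k\<in>{..<p}. root_char (int (x n) - int d) k / of_nat p)"
      proof -
        have "{..<p} = insert 0 {1..p - 1}" using p_ge_2 by auto
        then show ?thesis by simp
      qed
      also have "\<dots> = (if x n = d then 1 else 0)"
        unfolding sum_divide_distrib[symmetric] using xn d p_pos by (subst sum_root_char) auto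
      finally show ?thesis using True iff by simp
    qed
    show ?thesis by (subst basis.span_cong[OF eq]) (simp_all only: span)
  qed
qed

lemma span_level:
  assumes "level n f" shows "basis.span f"
proof -
  have "basis.span (\<lambda>x. \<Sum>g<p ^ n. f (rep p g) * (if ztrunc p x n = g then 1 else 0))"
    by (intro basis.span_sum basis.span_scale span_cylinder)
  moreover have "f x = (\<Sum>g<p ^ n. f (rep p g) * (if ztrunc p x n = g then 1 else 0))" if "x \<in> space (haar p)" for x
    unfolding level_expand[OF assms that] using that
    by (intro sum.cong) (auto simp: indicator_def)
  ultimately show ?thesis by (subst basis.span_cong)
qed

sublocale basis: function_space "haar p" basis.span
proof
  show "basis.span (\<lambda>x. 1)"
    by (rule span_level[of 0]) (simp add: level_def)
qed (auto intro: basis.span_square basis.span_add basis.span_scale)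

text \<open>Members of the product algebra constrain finitely many digits, so their indicators have
  some level \<open>n\<close> and lie in the span.\<close>

theorem square_integrable_approximable:
  assumes "square_integrable (haar p) f"
  shows "l2_approximable (haar p) basis.span f"
proof (rule basis.square_integrable_approximable[OF _ _ _ _ assms])
  let ?M = "\<lambda>_::nat. uniform_count_measure {..<p}"
  show "sets (haar p) = sigma_sets (space (haar p)) (prod_algebra UNIV ?M)"
    unfolding haar_def by (simp add: sets_PiM space_PiM)
  show "Int_stable (prod_algebra UNIV ?M)" by (rule Int_stable_prod_algebra)
  show "prod_algebra UNIV ?M \<subseteq> Pow (space (haar p))"
    using prod_algebra_sets_into_space[of UNIV ?M] by (simp add: haar_def space_PiM)
  fix A assume "A \<in> prod_algebra UNIV ?M"
  then obtain J' E where A: "A = prod_emb UNIV ?M J' (Pi\<^sub>E J' E)" and J': "finite J'"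
    by (rule prod_algebraE)
  obtain n where n: "J' \<subseteq> {..<n}" using finite_nat_bounded[OF J'] by blast
  have mem: "x \<in> A \<longleftrightarrow> (\<forall>j\<in>J'. x j \<in> E j)" if "x \<in> space (haar p)" for x
    using that by (auto simp: A prod_emb_def haar_def space_PiM PiE_iff)
  have "level n (indicator A :: _ \<Rightarrow> complex)"
    unfolding level_def
  proof
    fix x assume x: "x \<in> space (haar p)"
    have "x \<in> A \<longleftrightarrow> rep p (ztrunc p x n) \<in> A"
      unfolding mem[OF x] mem[OF rep_in_space] using n rep_ztrunc[OF x] by (auto simp: subset_iff)
    then show "indicator A x = (indicator A (rep p (ztrunc p x n)) :: complex)"
      by (simp add: indicator_def)
  qed
  then show "basis.span (indicator A)" by (rule span_level)
qed

end

section \<open>The jump kernel and its eigenvalues\<close>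

text \<open>The value is one more than the first index at which \<open>x\<close> and \<open>y\<close> differ, and \<open>0\<close> if \<open>x = y\<close>;
  with this convention \<open>radius\<close> turns it into the distance \<open>|x - y|\<^sub>p\<close>.\<close>

definition first_diff :: "(nat \<Rightarrow> nat) \<Rightarrow> (nat \<Rightarrow> nat) \<Rightarrow> nat" where
  "first_diff x y = (if x = y then 0 else Suc (LEAST j. x j \<noteq> y j))"

definition radius :: "nat \<Rightarrow> nat \<Rightarrow> real" where
  "radius p n = (case n of 0 \<Rightarrow> 0 | Suc m \<Rightarrow> real p powr - real m)"

lemma first_diff_eq_Suc:
  "first_diff x y = Suc n \<longleftrightarrow> (\<forall>j<n. x j = y j) \<and> x n \<noteq> y n"
proof
  assume "first_diff x y = Suc n"
  then have "x \<noteq> y" and n: "n = (LEAST j. x j \<noteq> y j)" by (auto simp: first_diff_def split: if_splits)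
  then obtain j where "x j \<noteq> y j" by auto
  then show "(\<forall>j<n. x j = y j) \<and> x n \<noteq> y n"
    unfolding n using not_less_Least by (metis (mono_tags, lifting) LeastI)
next
  assume *: "(\<forall>j<n. x j = y j) \<and> x n \<noteq> y n"
  then have "(LEAST j. x j \<noteq> y j) = n" by (intro Least_equality) (auto simp: not_less[symmetric])
  with * show "first_diff x y = Suc n" by (auto simp: first_diff_def)
qed

lemma first_diff_eq_0: "first_diff x y = 0 \<longleftrightarrow> x = y"
  by (simp add: first_diff_def)

lemma first_diff_same [simp]: "first_diff x x = 0"
  by (simp add: first_diff_def)

lemma first_diff_commute: "first_diff x y = first_diff y x"
  by (auto simp: first_diff_def neq_commute)

context padic
begin

lemma padic_abs_eq: "padic_abs p x = radius p (first_diff (\<lambda>_. 0) x)"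
proof (cases "\<forall>j. x j = 0")
  case True
  then have "(\<lambda>_. 0) = x" by auto
  then show ?thesis using True by (simp add: padic_abs_def first_diff_def radius_def)
next
  case False
  then have "(\<lambda>_. 0) \<noteq> x" by auto
  then show ?thesis using False by (auto simp: padic_abs_def first_diff_def radius_def)
qed

lemma zsub_eq_0:
  assumes "\<forall>i\<le>j. x i = y i" shows "zsub p x y j = 0"
  using ztrunc_cong[of "Suc j" x y] assms by (simp add: zsub_def)

text \<open>The truncations before \<open>j\<close> agree, so no borrow occurs and the digit of the
  difference is \<open>x j - y j\<close> modulo \<open>p\<close>, nonzero for distinct
  digits.\<close>

lemma zsub_neq_0:
  assumes x: "x \<in> space (haar p)" and y: "y \<in> space (haar p)"
    and eq: "\<forall>i<j. x i = y i" and neq: "x j \<noteq> y j"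
  shows "zsub p x y j \<noteq> 0"
proof -
  have "ztrunc p x j = ztrunc p y j" using eq by (intro ztrunc_cong) auto
  then have "int (ztrunc p x (Suc j)) - int (ztrunc p y (Suc j)) = int p ^ j * (int (x j) - int (y j))"
    by (simp add: ztrunc_Suc algebra_simps)
  then have "(int (ztrunc p x (Suc j)) - int (ztrunc p y (Suc j))) mod (int p ^ Suc j)
      = int p ^ j * ((int (x j) - int (y j)) mod int p)"
    by (simp only: power_Suc2 mult_mod_right)
  then have "zsub p x y j = nat ((int (x j) - int (y j)) mod int p)"
    using p_pos by (simp add: zsub_def)
  moreover have "(int (x j) - int (y j)) mod int p \<noteq> 0"
  proof
    assume "(int (x j) - int (y j)) mod int p = 0"
    then have "int (x j) mod int p = int (y j) mod int p" by (simp add: mod_eq_dvd_iff mod_eq_0_iff_dvd)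
    then show False using neq x y by (simp add: space_haar)
  qed
  moreover have "(int (x j) - int (y j)) mod int p \<ge> 0" using p_pos by simp
  ultimately show ?thesis by simp
qed

lemma padic_abs_zsub:
  assumes x: "x \<in> space (haar p)" and y: "y \<in> space (haar p)"
  shows "padic_abs p (zsub p x y) = radius p (first_diff x y)"
proof -
  have "first_diff (\<lambda>_. 0) (zsub p x y) = first_diff x y"
  proof (cases "first_diff x y")
    case 0
    then have "zsub p x y = (\<lambda>_. 0)" by (auto simp: first_diff_eq_0 zsub_eq_0)
    then show ?thesis using 0 by simp
  next
    case (Suc n)
    then have "(\<forall>j<n. x j = y j) \<and> x n \<noteq> y n" by (rule first_diff_eq_Suc[THEN iffD1])
    then have "(\<forall>j<n. 0 = zsub p x y j) \<and> 0 \<noteq> zsub p x y n"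
      using zsub_neq_0[OF x y, of n] zsub_eq_0[of _ x y] by (metis order_le_less_trans)
    then have "first_diff (\<lambda>_. 0) (zsub p x y) = Suc n" by (rule first_diff_eq_Suc[THEN iffD2])
    then show ?thesis using Suc by simp
  qed
  then show ?thesis by (simp add: padic_abs_eq)
qed

lemma zero_in_space [simp]: "(\<lambda>_. 0) \<in> space (haar p)"
  using p_pos by (simp add: space_haar)

lemma measurable_first_diff [measurable]:
  "(\<lambda>z. first_diff (fst z) (snd z)) \<in> haar p \<Otimes>\<^sub>M haar p \<rightarrow>\<^sub>M count_space UNIV"
proof (subst measurable_count_space_eq2_countable, intro conjI ballI)
  fix n :: nat
  let ?L = "haar p \<Otimes>\<^sub>M haar p"
  have [measurable]: "(\<lambda>z. real (fst z j)) \<in> borel_measurable ?L" "(\<lambda>z. real (snd z j)) \<in> borel_measurable ?L" for j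
    by (auto intro!: measurable_compose[OF measurable_fst] measurable_compose[OF measurable_snd]
        measurable_compose[OF measurable_digit])
  have [measurable]: "Measurable.pred ?L (\<lambda>z. fst z j = snd z j)" for j
  proof -
    have "Measurable.pred ?L (\<lambda>z. real (fst z j) = real (snd z j))" by measurable
    then show ?thesis by simp
  qed
  show "(\<lambda>z. first_diff (fst z) (snd z)) -` {n} \<inter> space ?L \<in> sets ?L"
  proof (cases n)
    case 0
    have "{z \<in> space ?L. \<forall>j. fst z j = snd z j} \<in> sets ?L" by measurable
    moreover have "(\<lambda>z. first_diff (fst z) (snd z)) -` {n} \<inter> space ?L = {z \<in> space ?L. \<forall>j. fst z j = snd z j}"
      by (auto simp: 0 first_diff_eq_0 fun_eq_iff simp del: split_paired_All)
    ultimately show ?thesis by simp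
  next
    case (Suc m)
    have "{z \<in> space ?L. (\<forall>j<m. fst z j = snd z j) \<and> fst z m \<noteq> snd z m} \<in> sets ?L" by measurable
    moreover have "(\<lambda>z. first_diff (fst z) (snd z)) -` {n} \<inter> space ?L
        = {z \<in> space ?L. (\<forall>j<m. fst z j = snd z j) \<and> fst z m \<noteq> snd z m}"
      by (auto simp: Suc first_diff_eq_Suc)
    ultimately show ?thesis by simp
  qed
qed auto

lemma measurable_first_diff' [measurable]:
  "x \<in> space (haar p) \<Longrightarrow> first_diff x \<in> haar p \<rightarrow>\<^sub>M count_space UNIV"
  using measurable_compose[OF measurable_Pair1' measurable_first_diff] by simp

text \<open>A sphere is the difference of two nested balls, and a point lies in balls of mass
  \<open>1 / p ^ n\<close> for every \<open>n\<close>. Neither mass depends on the centre.\<close>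

lemma emeasure_first_diff:
  assumes x: "x \<in> space (haar p)"
  shows "emeasure (haar p) {y \<in> space (haar p). first_diff x y = Suc n}
      = ennreal (1 / real p ^ n - 1 / real p ^ Suc n)"
    and "emeasure (haar p) {y \<in> space (haar p). first_diff x y = 0} = 0"
proof -
  let ?C = "\<lambda>n. {y \<in> space (haar p). ztrunc p y n = ztrunc p x n}"
  have C: "?C n \<in> sets (haar p)" "emeasure (haar p) (?C n) = ennreal (1 / real p ^ n)" for n
    using emeasure_cylinder[OF ztrunc_less[OF x]] by auto
  have le: "?C (Suc n) \<subseteq> ?C n" for n
    using ztrunc_eq_iff[OF _ x] by auto
  have "{y \<in> space (haar p). first_diff x y = Suc n} = ?C n - ?C (Suc n)"
    using ztrunc_eq_iff[OF _ x] by (auto simp: first_diff_eq_Suc less_Suc_eq)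
  then have "emeasure (haar p) {y \<in> space (haar p). first_diff x y = Suc n}
      = emeasure (haar p) (?C n) - emeasure (haar p) (?C (Suc n))"
    using emeasure_Diff[OF _ C(1) C(1) le, of n] by (simp only: C infinity_ennreal_def ennreal_neq_top not_False_eq_True simp_thms)
  also have "\<dots> = ennreal (1 / real p ^ n - 1 / real p ^ Suc n)"
    unfolding C by (rule ennreal_minus) simp
  finally show "emeasure (haar p) {y \<in> space (haar p). first_diff x y = Suc n}
      = ennreal (1 / real p ^ n - 1 / real p ^ Suc n)" .
  have "emeasure (haar p) {y \<in> space (haar p). first_diff x y = 0} \<le> ennreal (1 / real p ^ n)" for n
    unfolding C(2)[of n, symmetric] by (intro emeasure_mono C) (auto simp: first_diff_eq_0)
  moreover have "(\<lambda>n. ennreal (1 / real p ^ n)) \<longlonglongrightarrow> ennreal 0"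
    using p_ge_2 LIMSEQ_realpow_zero[of "1 / real p"]
    by (intro tendsto_ennrealI) (simp add: power_one_over)
  ultimately have "emeasure (haar p) {y \<in> space (haar p). first_diff x y = 0} \<le> ennreal 0"
    by (intro LIMSEQ_le_const[of "\<lambda>n. ennreal (1 / real p ^ n)"]) auto
  then show "emeasure (haar p) {y \<in> space (haar p). first_diff x y = 0} = 0" by simp
qed

text \<open>This takes the place of translation invariance of Haar measure: integrals of functions
  of the distance to \<open>x\<close> can be moved to the centre 0.\<close>

lemma distr_first_diff:
  assumes x: "x \<in> space (haar p)" and x': "x' \<in> space (haar p)"
  shows "distr (haar p) (count_space UNIV) (first_diff x) = distr (haar p) (count_space UNIV) (first_diff x')"
proof (rule measure_eqI_countable[where A = UNIV])
  fix n :: nat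
  have "emeasure (distr (haar p) (count_space UNIV) (first_diff z)) {n} = emeasure (haar p) {y \<in> space (haar p). first_diff z y = n}"
    if "z \<in> space (haar p)" for z
    using measurable_first_diff'[OF that]
    by (subst emeasure_distr) (auto simp: vimage_def Int_def conj_commute)
  then show "emeasure (distr (haar p) (count_space UNIV) (first_diff x)) {n}
      = emeasure (distr (haar p) (count_space UNIV) (first_diff x')) {n}"
    using x x' by (cases n) (simp_all add: emeasure_first_diff)
qed auto

lemma integral_first_diff:
  fixes F :: "nat \<Rightarrow> 'b::{banach, second_countable_topology}"
  assumes "x \<in> space (haar p)" "x' \<in> space (haar p)"
  shows "(\<integral>y. F (first_diff x y) \<partial>haar p) = (\<integral>y. F (first_diff x' y) \<partial>haar p)"
  using arg_cong[OF distr_first_diff[OF assms], of "\<lambda>N. integral\<^sup>L N F"] assms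
  by (simp add: integral_distr)

lemma integrable_first_diff:
  fixes F :: "nat \<Rightarrow> 'b::{banach, second_countable_topology}"
  assumes "x \<in> space (haar p)" "x' \<in> space (haar p)"
  shows "integrable (haar p) (\<lambda>y. F (first_diff x y)) \<longleftrightarrow> integrable (haar p) (\<lambda>y. F (first_diff x' y))"
  using arg_cong[OF distr_first_diff[OF assms], of "\<lambda>N. integrable N F"] assms
  by (simp add: integrable_distr_eq)

end

section \<open>The jump kernel and its action on wavelets\<close>

locale jump_kernel = padic +
  fixes J :: "real \<Rightarrow> real"
  assumes J_nonneg: "\<forall>s\<in>{0..1}. J s \<ge> 0"
    and J_integrable: "integrable (haar p) (\<lambda>x. J (padic_abs p x))"
    and J_mass: "(\<integral>x. J (padic_abs p x) \<partial>haar p) = 1"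
begin

definition jump :: "nat \<Rightarrow> real" where
  "jump n = J (radius p n)"

lemma jump_nonneg: "jump n \<ge> 0"
proof -
  have "radius p n \<in> {0..1}"
    using p_ge_2 powr_mono[of "- real (n - 1)" 0 "real p"]
    by (auto simp: radius_def split: nat.split)
  then show ?thesis using J_nonneg by (simp add: jump_def)
qed

lemma integrable_jump:
  assumes "x \<in> space (haar p)" shows "integrable (haar p) (\<lambda>y. jump (first_diff x y))"
  using J_integrable unfolding padic_abs_eq jump_def[symmetric]
  by (subst integrable_first_diff[OF assms zero_in_space])

sublocale symmetric_markov_kernel "haar p" "\<lambda>x y. jump (first_diff x y)"
proof
  show "(\<lambda>(x, y). jump (first_diff x y)) \<in> borel_measurable (haar p \<Otimes>\<^sub>M haar p)"
    unfolding case_prod_beta by (rule measurable_compose[OF measurable_first_diff]) simp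
  fix x assume x: "x \<in> space (haar p)"
  have "(\<integral>\<^sup>+y. ennreal (jump (first_diff x y)) \<partial>haar p) = ennreal (\<integral>y. jump (first_diff x y) \<partial>haar p)"
    by (rule nn_integral_eq_integral[OF integrable_jump[OF x]]) (simp add: jump_nonneg)
  also have "(\<integral>y. jump (first_diff x y) \<partial>haar p) = 1"
    using J_mass unfolding padic_abs_eq jump_def[symmetric]
    by (subst integral_first_diff[OF x zero_in_space])
  finally show "(\<integral>\<^sup>+y. ennreal (jump (first_diff x y)) \<partial>haar p) = 1" by simp
qed (auto simp: jump_nonneg first_diff_commute)

lemma Jop_eq:
  assumes "x \<in> space (haar p)" shows "Jop p J \<phi> x = T \<phi> x - \<phi> x"
  unfolding Jop_def T_def
  by (intro arg_cong2[where f = "(-)"] Bochner_Integration.integral_cong refl)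
    (simp add: padic_abs_zsub[OF assms] jump_def)

text \<open>The first term is the integral of the kernel over the ball \<open>x + p\<^sup>m\<^sup>+\<^sup>1\<int>\<^sub>p\<close>, which does not depend
  on the centre \<open>x\<close>.\<close>

definition eigenvalue :: "nat \<Rightarrow> complex" where
  "eigenvalue m = (\<integral>y. (if first_diff (\<lambda>_. 0) y \<in> {1..Suc m} then 0 else complex_of_real (jump (first_diff (\<lambda>_. 0) y))) \<partial>haar p)
     - complex_of_real (jump (Suc m)) / of_nat p ^ Suc m"

text \<open>The lower end 1 matters: the value 0 stands for equality, that is, agreement in all
  digits, and belongs with the values above \<open>n\<close>.\<close>

lemma first_diff_prefix:
  assumes "x \<in> space (haar p)" "y \<in> space (haar p)"
  shows "first_diff x y \<in> {1..n} \<longleftrightarrow> ztrunc p y n \<noteq> ztrunc p x n"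
proof (cases "first_diff x y")
  case 0
  then have "x = y" by (simp add: first_diff_eq_0)
  then show ?thesis by simp
next
  case (Suc k)
  then have k: "(\<forall>j<k. x j = y j) \<and> x k \<noteq> y k" by (rule first_diff_eq_Suc[THEN iffD1])
  then have "(\<forall>j<n. y j = x j) \<longleftrightarrow> n \<le> k" by (metis leI order_less_le_trans)
  then show ?thesis using Suc ztrunc_eq_iff[OF assms(2,1), of n] by auto
qed

text \<open>For \<open>x\<close> in the support, the kernel is \<open>jump (Suc m)\<close> on the
  part of the ball where digit \<open>m\<close> differs. Since the wavelet has mean 0, its integral
  there is minus its value at \<open>x\<close> times the mass \<open>1 / p ^ Suc m\<close> of the
  smaller ball, which is the origin of the second term of \<open>eigenvalue\<close>.\<close>

lemma T_wavelet:
  assumes x: "x \<in> space (haar p)" and k: "1 \<le> k" "k \<le> p - 1" and \<beta>: "\<beta> < p ^ m"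
  shows "T (wavelet p m \<beta> k) x = eigenvalue m * wavelet p m \<beta> k x"
proof (cases "ztrunc p x m = \<beta>")
  case False
  have "first_diff x (rep p \<beta>) \<in> {1..m}"
    using first_diff_prefix[OF x rep_in_space, of \<beta> m] False \<beta> by (auto simp: ztrunc_rep)
  \<comment> \<open>Off its supporting ball the wavelet sees a constant kernel, and its mean is \<open>0\<close>.\<close>
  then obtain n where n: "first_diff x (rep p \<beta>) = Suc n" "n < m"
    by (metis Suc_le_lessD atLeastAtMost_iff not0_implies_Suc not_one_le_zero)
  have "jump (first_diff x y) * wavelet p m \<beta> k y = jump (Suc n) * wavelet p m \<beta> k y"
    if y: "y \<in> space (haar p)" for y
  proof (cases "ztrunc p y m = \<beta>")
    case True
    then have "\<forall>j<m. y j = rep p \<beta> j" using ztrunc_eq_iff_rep[OF y \<beta>] by simp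
    then have "first_diff x y = Suc n"
      using n unfolding first_diff_eq_Suc by (metis order.strict_trans)
    then show ?thesis by simp
  qed (simp add: wavelet_eq)
  then have "T (wavelet p m \<beta> k) x = (\<integral>y. jump (Suc n) * wavelet p m \<beta> k y \<partial>haar p)"
    unfolding T_def by (intro Bochner_Integration.integral_cong) auto
  also have "\<dots> = 0"
    using integral_level_wavelet(1)[of m "\<lambda>_. complex_of_real (jump (Suc n))", OF _ k] by (simp add: level_def)
  finally show ?thesis using False by (simp add: wavelet_eq)
next
  case True
  let ?w = "wavelet p m \<beta> k"
  let ?F = "\<lambda>n. if n \<in> {1..Suc m} then 0 else complex_of_real (jump n)"
  let ?I = "\<lambda>y. (if ztrunc p y (Suc m) = ztrunc p x (Suc m) then 1 else 0) :: complex"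
  \<comment> \<open>On the ball \<open>\<beta> + p\<^sup>m\<int>\<^sub>p\<close> the kernel is constant outside the smaller ball around \<open>x\<close>,
    and on the latter the wavelet is constant.\<close>
  have pt: "complex_of_real (jump (first_diff x y)) * ?w y
      = ?F (first_diff x y) * ?w x + (complex_of_real (jump (Suc m)) * ?w y - complex_of_real (jump (Suc m)) * ?w x * ?I y)"
    if y: "y \<in> space (haar p)" for y
  proof (cases "ztrunc p y (Suc m) = ztrunc p x (Suc m)")
    case eq: True
    then have "ztrunc p y m = ztrunc p x m" "y m = x m"
      using ztrunc_eq_iff[OF y x] by auto
    then have "?w y = ?w x" by (simp add: wavelet_eq)
    then show ?thesis using first_diff_prefix[OF x y, of "Suc m"] eq by (simp del: atLeastAtMost_iff)
  next
    case neq: False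
    show ?thesis
    proof (cases "ztrunc p y m = \<beta>")
      case c: True
      then have "ztrunc p x m = ztrunc p y m" using True by simp
      then have "\<forall>j<m. x j = y j" by (rule ztrunc_eq_iff[OF x y, THEN iffD1])
      moreover from this have "x m \<noteq> y m"
        using neq ztrunc_eq_iff[OF y x, of "Suc m"] by (auto simp: less_Suc_eq)
      ultimately have "first_diff x y = Suc m" by (simp add: first_diff_eq_Suc)
      then show ?thesis using neq by simp
    next
      case c: False
      then show ?thesis using first_diff_prefix[OF x y, of "Suc m"] neq True
        by (simp add: wavelet_eq del: atLeastAtMost_iff)
    qed
  qed
  have lev: "level (Suc m) ?I" by (rule level_ztrunc[OF order_refl])
  have intI: "(\<integral>y. ?I y \<partial>haar p) = 1 / of_nat p ^ Suc m"
    unfolding integral_level(2)[OF lev] using ztrunc_less[OF x, of "Suc m"]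
    by (simp add: ztrunc_rep scaleR_conv_of_real)
  have intw: "(\<integral>y. ?w y \<partial>haar p) = 0"
    using integral_level_wavelet(1)[of m "\<lambda>_. 1", OF _ k] by (simp add: level_def)
  have iF: "integrable (haar p) (\<lambda>y. ?F (first_diff x y))"
  proof (rule Bochner_Integration.integrable_bound[OF integrable_jump[OF x]])
    show "(\<lambda>y. ?F (first_diff x y)) \<in> borel_measurable (haar p)"
      by (rule measurable_compose[OF measurable_first_diff'[OF x]]) simp
  qed auto
  have int_w: "integrable (haar p) (\<lambda>y. complex_of_real (jump (Suc m)) * ?w y)"
    by (intro integrable_mult_right integral_level(1)[OF level_wavelet])
  have int_I: "integrable (haar p) (\<lambda>y. complex_of_real (jump (Suc m)) * ?w x * ?I y)"
    by (intro integrable_mult_right integral_level(1)[OF lev])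
  have "T ?w x = (\<integral>y. ?F (first_diff x y) * ?w x + (complex_of_real (jump (Suc m)) * ?w y - complex_of_real (jump (Suc m)) * ?w x * ?I y) \<partial>haar p)"
    unfolding T_def by (rule Bochner_Integration.integral_cong) (use pt in auto)
  also have "\<dots> = (\<integral>y. ?F (first_diff x y) * ?w x \<partial>haar p) + ((\<integral>y. complex_of_real (jump (Suc m)) * ?w y \<partial>haar p) - (\<integral>y. complex_of_real (jump (Suc m)) * ?w x * ?I y \<partial>haar p))"
    unfolding Bochner_Integration.integral_diff[OF int_w int_I, symmetric]
    by (intro Bochner_Integration.integral_add Bochner_Integration.integrable_diff integrable_mult_left iF int_w int_I)
  also have "\<dots> = (\<integral>y. ?F (first_diff x y) \<partial>haar p) * ?w x - complex_of_real (jump (Suc m)) * ?w x / of_nat p ^ Suc m"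
    by (simp only: integral_mult_left_zero integral_mult_right_zero intw intI) simp
  also have "(\<integral>y. ?F (first_diff x y) \<partial>haar p) = (\<integral>y. ?F (first_diff (\<lambda>_. 0) y) \<partial>haar p)"
    by (rule integral_first_diff[OF x zero_in_space])
  finally show ?thesis by (simp add: eigenvalue_def algebra_simps)
qed

lemma T_one: "x \<in> space (haar p) \<Longrightarrow> T (\<lambda>_. 1) x = 1"
proof -
  assume x: "x \<in> space (haar p)"
  have "(\<integral>y. jump (first_diff x y) \<partial>haar p) = 1"
    using J_mass unfolding padic_abs_eq jump_def[symmetric]
    by (subst integral_first_diff[OF x zero_in_space])
  then show ?thesis by (simp add: T_def)
qed

text \<open>The Fourier integral is \<open>T\<close> applied to a character and evaluated at the
  point 0, so the eigenfunction property replaces a direct computation. The shift by one is that of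
  \<open>p ^ (1 - r)\<close> at \<open>r = - m\<close>.\<close>

lemma Jhat_eq: "Jhat p J (Suc m) = eigenvalue m"
proof -
  let ?c = "\<lambda>\<beta>. chi_frac p (Suc m) (int \<beta>) / complex_of_real (sqrt (real p ^ m))"
  \<comment> \<open>The character is a combination of wavelets, of which only the one with \<open>\<beta> = 0\<close> is nonzero at \<open>0\<close>.\<close>
  have u: "chi_frac p (Suc m) (int (ztrunc p y (Suc m))) = (\<Sum>\<beta><p ^ m. ?c \<beta> * wavelet p m \<beta> 1 y)"
    if y: "y \<in> space (haar p)" for y
  proof -
    have "(\<Sum>\<beta><p ^ m. ?c \<beta> * wavelet p m \<beta> 1 y)
        = (\<Sum>\<beta><p ^ m. if \<beta> = ztrunc p y m then chi_frac p (Suc m) (int (ztrunc p y m)) * root_char 1 (y m) else 0)"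
      using p_pos by (intro sum.cong) (auto simp: wavelet_eq)
    also have "\<dots> = chi_frac p (Suc m) (int (ztrunc p y m)) * root_char 1 (y m)"
      using ztrunc_less[OF y, of m] by simp
    also have "\<dots> = chi_frac p (Suc m) (int (ztrunc p y (Suc m)))"
      using chi_frac_digit[of m 1 "y m"] by (simp add: ztrunc_Suc chi_frac_add)
    finally show ?thesis by simp
  qed
  have "Jhat p J (Suc m) = (\<integral>y. (\<Sum>\<beta><p ^ m. ?c \<beta> * (complex_of_real (jump (first_diff (\<lambda>_. 0) y)) * wavelet p m \<beta> 1 y)) \<partial>haar p)"
    unfolding Jhat_def padic_abs_eq jump_def[symmetric]
    by (rule Bochner_Integration.integral_cong[OF refl])
      (simp only: u sum_distrib_left mult.left_commute)
  also have "\<dots> = (\<Sum>\<beta><p ^ m. ?c \<beta> * T (wavelet p m \<beta> 1) (\<lambda>_. 0))"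
  proof (subst Bochner_Integration.integral_sum)
    fix \<beta>
    obtain B where B: "\<And>x. x \<in> space (haar p) \<Longrightarrow> norm (wavelet p m \<beta> 1 x) \<le> B"
      using level_bounded[OF level_wavelet] by blast
    have [measurable]: "wavelet p m \<beta> 1 \<in> borel_measurable (haar p)"
      by (rule measurable_level[OF level_wavelet])
    have [measurable]: "(\<lambda>y. jump (first_diff (\<lambda>_. 0) y)) \<in> borel_measurable (haar p)"
      using integrable_jump[OF zero_in_space] by simp
    have "integrable (haar p) (\<lambda>y. complex_of_real (jump (first_diff (\<lambda>_. 0) y)) * wavelet p m \<beta> 1 y)"
    proof (rule Bochner_Integration.integrable_bound)
      show "integrable (haar p) (\<lambda>y. jump (first_diff (\<lambda>_. 0) y) * B)"
        by (intro integrable_mult_left integrable_jump zero_in_space)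
      show "AE y in haar p. norm (complex_of_real (jump (first_diff (\<lambda>_. 0) y)) * wavelet p m \<beta> 1 y) \<le> norm (jump (first_diff (\<lambda>_. 0) y) * B)"
      proof (rule AE_I2)
        fix y assume "y \<in> space (haar p)"
        from B[OF this] have "norm (wavelet p m \<beta> 1 y) \<le> \<bar>B\<bar>" by simp
        then show "norm (complex_of_real (jump (first_diff (\<lambda>_. 0) y)) * wavelet p m \<beta> 1 y) \<le> norm (jump (first_diff (\<lambda>_. 0) y) * B)"
          by (simp add: norm_mult abs_mult mult_left_mono)
      qed
    qed measurable
    then show "integrable (haar p) (\<lambda>y. ?c \<beta> * (complex_of_real (jump (first_diff (\<lambda>_. 0) y)) * wavelet p m \<beta> 1 y))"
      by (rule integrable_mult_right)
  next
    show "(\<Sum>\<beta><p ^ m. \<integral>y. ?c \<beta> * (complex_of_real (jump (first_diff (\<lambda>_. 0) y)) * wavelet p m \<beta> 1 y) \<partial>haar p)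
        = (\<Sum>\<beta><p ^ m. ?c \<beta> * T (wavelet p m \<beta> 1) (\<lambda>_. 0))"
      unfolding T_def by (simp only: integral_mult_right_zero)
  qed
  also have "\<dots> = (\<Sum>\<beta><p ^ m. if \<beta> = 0 then eigenvalue m else 0)"
  proof (rule sum.cong)
    fix \<beta> assume "\<beta> \<in> {..<p ^ m}"
    then have "T (wavelet p m \<beta> 1) (\<lambda>_. 0) = eigenvalue m * wavelet p m \<beta> 1 (\<lambda>_. 0)"
      using p_ge_2 by (intro T_wavelet) auto
    moreover have "ztrunc p (\<lambda>_. 0) m = 0" by (simp add: ztrunc_def)
    moreover have "chi_frac p (Suc m) 0 = 1" by (simp add: chi_frac_def)
    ultimately show "?c \<beta> * T (wavelet p m \<beta> 1) (\<lambda>_. 0) = (if \<beta> = 0 then eigenvalue m else 0)"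
      using p_pos by (simp add: wavelet_eq)
  qed simp
  also have "\<dots> = eigenvalue m" using p_pos by simp
  finally show ?thesis .
qed

end

section \<open>The initial value problem\<close>

lemma L2_iff: "L2 p f \<longleftrightarrow> square_integrable (haar p) f"
  by (simp add: L2_def square_integrable_def)

context padic
begin

text \<open>Cauchy-Schwarz against the constant 1 on a probability space; it turns the normalisation
  of a solution into the L1 bound required for its coefficients.\<close>

lemma nn_integral_norm_le_l2norm:
  assumes "L2 p f" shows "(\<integral>\<^sup>+x. norm (f x) \<partial>haar p) \<le> ennreal (l2norm p f)"
proof -
  have [measurable]: "f \<in> borel_measurable (haar p)" and int: "integrable (haar p) (\<lambda>x. (cmod (f x))\<^sup>2)"
    using assms by (auto simp: L2_def)
  have "(\<integral>\<^sup>+x. norm (f x) \<partial>haar p)\<^sup>2 \<le> (\<integral>\<^sup>+x. (ennreal (norm (f x)))\<^sup>2 \<partial>haar p) * (\<integral>\<^sup>+x. 1\<^sup>2 \<partial>haar p)"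
    using Cauchy_Schwarz_nn_integral[of "\<lambda>x. ennreal (norm (f x))" "haar p" "\<lambda>_. 1"] by simp
  also have "\<dots> = (\<integral>\<^sup>+x. ennreal ((cmod (f x))\<^sup>2) \<partial>haar p)"
    by (simp add: haar.emeasure_space_1 ennreal_power)
  also have "\<dots> = ennreal (\<integral>x. (cmod (f x))\<^sup>2 \<partial>haar p)"
    by (rule nn_integral_eq_integral[OF int]) simp
  also have "\<dots> = (ennreal (l2norm p f))\<^sup>2"
    by (simp add: l2norm_def ennreal_power)
  finally have le: "(\<integral>\<^sup>+x. norm (f x) \<partial>haar p)\<^sup>2 \<le> (ennreal (l2norm p f))\<^sup>2" .
  have l2: "l2norm p f \<ge> 0" by (simp add: l2norm_def)
  show ?thesis
  proof (cases "\<integral>\<^sup>+x. norm (f x) \<partial>haar p")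
    case (real r)
    then have "r\<^sup>2 \<le> (l2norm p f)\<^sup>2" using le l2 by (simp add: ennreal_power)
    then have "r \<le> l2norm p f" using l2 by (rule power2_le_imp_le)
    then show ?thesis unfolding real by (rule ennreal_leI)
  next
    case top
    then show ?thesis using le l2 by (simp add: ennreal_power top_unique)
  qed
qed

end

context jump_kernel
begin

text \<open>The eigenvalue of \<open>T\<close> at a basis function. The index of the constant must
  be tested in full, since wavelets with \<open>m = 0\<close> share its first two
  components.\<close>

definition rate :: "nat \<times> nat \<times> nat \<Rightarrow> complex" where
  "rate i = (if i = (0, 0, 0) then 1 else eigenvalue (fst i))"

lemma eigenvalue_real: "cnj (eigenvalue m) = eigenvalue m"
proof -
  let ?F = "\<lambda>y. if first_diff (\<lambda>_. 0) y \<in> {1..Suc m} then 0 else complex_of_real (jump (first_diff (\<lambda>_. 0) y))"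
  have "cnj (\<integral>y. ?F y \<partial>haar p) = (\<integral>y. cnj (?F y) \<partial>haar p)" by (rule Bochner_Integration.integral_cnj[symmetric])
  also have "\<dots> = (\<integral>y. ?F y \<partial>haar p)" by (rule Bochner_Integration.integral_cong) auto
  finally show ?thesis by (simp add: eigenvalue_def)
qed

text \<open>Coefficients pair with conjugates. As the kernel and the eigenvalues are real,
  conjugation preserves eigenfunctions and their eigenvalues.\<close>

lemma T_cnj_basis:
  assumes i: "i \<in> basis_index" and x: "x \<in> space (haar p)"
  shows "T (\<lambda>y. cnj (basis i y)) x = rate i * cnj (basis i x)"
proof -
  have "T (\<lambda>y. cnj (basis i y)) x = cnj (T (basis i) x)"
    unfolding T_def by (subst Bochner_Integration.integral_cnj[symmetric]) simp
  also have "T (basis i) x = rate i * basis i x"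
    using i x T_one T_wavelet
    by (auto simp: basis_index_def wav_index_def basis_def rate_def wavelet_0[abs_def])
  finally show ?thesis by (simp add: rate_def eigenvalue_real)
qed

lemma wav_index_0: "(0, 0, 0) \<notin> wav_index p"
  by (simp add: wav_index_def)

text \<open>Stated under an L1 bound instead of \<open>IVP_solution\<close>, because it is also
  applied to the evolution before its norm is known to be 1.\<close>

lemma coeff_IVP:
  assumes meas: "\<And>t. t \<ge> 0 \<Longrightarrow> (\<lambda>x. \<Psi> x t) \<in> borel_measurable (haar p)"
    and ode: "AE x in haar p. continuous_on {0..} (\<Psi> x) \<and>
      (\<forall>t>0. (\<Psi> x has_vector_derivative \<i> * (T (\<lambda>y. \<Psi> y t) x - \<Psi> x t)) (at t))"
    and bound: "\<And>t. 0 \<le> t \<Longrightarrow> t \<le> R \<Longrightarrow> (\<integral>\<^sup>+x. norm (\<Psi> x t) \<partial>haar p) \<le> ennreal B"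
    and "R \<ge> 0" and i: "i \<in> basis_index"
  shows "basis.coeff (\<lambda>x. \<Psi> x R) i = exp (\<i> * (rate i - 1) * complex_of_real R) * basis.coeff (\<lambda>x. \<Psi> x 0) i"
proof -
  obtain m \<beta> k where ieq: "i = (m, \<beta>, k)" by (cases i)
  have lev: "level (Suc m) (\<lambda>x. cnj (basis i x))"
    unfolding ieq basis_def prod.case by (rule level_comp[OF level_wavelet])
  obtain W where W: "\<And>x. x \<in> space (haar p) \<Longrightarrow> norm (cnj (basis i x)) \<le> W"
    using level_bounded[OF lev] by blast
  show ?thesis
    unfolding basis.coeff_def
    by (rule coefficient_evolution[OF meas ode bound measurable_level[OF lev] W T_cnj_basis[OF i] \<open>R \<ge> 0\<close>])
qed

lemma norm_exp_rate: "norm (exp (\<i> * (rate i - 1) * complex_of_real R)) = 1"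
proof -
  have "Im (rate i) = 0"
    using arg_cong[OF eigenvalue_real[of "fst i"], of Im] by (simp add: rate_def)
  then show ?thesis by simp
qed

theorem IVP_expansion:
  assumes \<psi>0: "L2 p \<psi>0" and sol: "IVP_solution p J \<psi>0 \<Psi>" and t: "t \<ge> 0"
  shows "((\<lambda>F. l2norm p (\<lambda>x. \<Psi> x t - (basis.coeff \<psi>0 (0, 0, 0) + (\<Sum>(m, \<beta>, k)\<in>F. basis.coeff \<psi>0 (m, \<beta>, k)
      * exp (\<i> * (Jhat p J (Suc m) - 1) * complex_of_real t) * wavelet p m \<beta> k x))))
    \<longlongrightarrow> 0) (finite_subsets_at_top (wav_index p))"
proof -
  have L2: "L2 p (\<lambda>x. \<Psi> x s)" and norm1: "l2norm p (\<lambda>x. \<Psi> x s) = 1" if "s \<ge> 0" for s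
    using sol that by (auto simp: IVP_solution_def)
  have meas: "(\<lambda>x. \<Psi> x s) \<in> borel_measurable (haar p)" if "s \<ge> 0" for s
    using L2[OF that] by (simp add: L2_def)
  have "AE x in haar p. continuous_on {0..} (\<Psi> x) \<and>
        (\<exists>D. (\<forall>t>0. (\<Psi> x has_vector_derivative D t) (at t)) \<and> continuous_on {0<..} D \<and>
             (\<forall>t>0. \<i> * D t = - Jop p J (\<lambda>y. \<Psi> y t) x))"
    using sol by (auto simp: IVP_solution_def)
  then have ode: "AE x in haar p. continuous_on {0..} (\<Psi> x) \<and>
      (\<forall>t>0. (\<Psi> x has_vector_derivative \<i> * (T (\<lambda>y. \<Psi> y t) x - \<Psi> x t)) (at t))"
    using AE_space
  proof eventually_elim
    case (elim x)
    then obtain D where D: "\<forall>t>0. (\<Psi> x has_vector_derivative D t) (at t)"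
      "\<forall>t>0. \<i> * D t = - Jop p J (\<lambda>y. \<Psi> y t) x" by blast
    have "D t = \<i> * (T (\<lambda>y. \<Psi> y t) x - \<Psi> x t)" if "t > 0" for t
    proof -
      have "\<i> * (\<i> * D t) = \<i> * (- (T (\<lambda>y. \<Psi> y t) x - \<Psi> x t))"
        using D(2) that Jop_eq[OF elim(2)] by simp
      then have "- D t = - (\<i> * (T (\<lambda>y. \<Psi> y t) x - \<Psi> x t))"
        by (simp only: mult.assoc[symmetric] i_squared minus_mult_right[symmetric] mult_minus_left mult_1_left)
      then show ?thesis by (simp only: neg_equal_iff_equal)
    qed
    then show ?case using D(1) elim(1) by metis
  qed
  have coeff: "basis.coeff (\<lambda>x. \<Psi> x t) i = exp (\<i> * (rate i - 1) * complex_of_real t) * basis.coeff \<psi>0 i"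
    if i: "i \<in> basis_index" for i
  proof -
    \<comment> \<open>The bound \<open>B = 1\<close> is the unit norm of the solution at every
      time.\<close>
    have "basis.coeff (\<lambda>x. \<Psi> x t) i = exp (\<i> * (rate i - 1) * complex_of_real t) * basis.coeff (\<lambda>x. \<Psi> x 0) i"
      using nn_integral_norm_le_l2norm[OF L2] norm1
      by (intro coeff_IVP[where B = 1] meas ode t i) auto
    also have "basis.coeff (\<lambda>x. \<Psi> x 0) i = basis.coeff \<psi>0 i"
      unfolding basis.coeff_def
    proof (rule integral_cong_AE)
      have "AE x in haar p. \<Psi> x 0 = \<psi>0 x" using sol by (simp add: IVP_solution_def)
      then show "AE x in haar p. \<Psi> x 0 * cnj (basis i x) = \<psi>0 x * cnj (basis i x)"
        by eventually_elim simp
      have b: "square_integrable (haar p) (basis i)" by (rule basis.e_square[OF i])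
      show "(\<lambda>x. \<Psi> x 0 * cnj (basis i x)) \<in> borel_measurable (haar p)"
        using integrable_mult_cnj[OF L2[of 0, unfolded L2_iff] b] by simp
      show "(\<lambda>x. \<psi>0 x * cnj (basis i x)) \<in> borel_measurable (haar p)"
        using integrable_mult_cnj[OF \<psi>0[unfolded L2_iff] b] by simp
    qed
    finally show ?thesis .
  qed
  let ?f = "\<lambda>x. \<Psi> x t"
  have "((\<lambda>F. \<integral>x. (cmod (?f x - (\<Sum>i\<in>F. basis.coeff ?f i * basis i x)))\<^sup>2 \<partial>haar p) \<longlongrightarrow> 0) (finite_subsets_at_top basis_index)"
    using L2[OF t] by (intro basis.fourier_partial_sums_converge square_integrable_approximable) (simp add: L2_iff)
  \<comment> \<open>The partial sums of the stated expansion always contain the constant term, so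
    the limit over finite subsets of the full basis is pulled back along insertion of its
    index.\<close>
  moreover have "filterlim (insert (0, 0, 0)) (finite_subsets_at_top basis_index) (finite_subsets_at_top (wav_index p))"
    unfolding filterlim_iff
  proof (intro allI impI)
    fix Q assume "\<forall>\<^sub>F F in finite_subsets_at_top basis_index. Q F"
    then obtain X where X: "finite X" "X \<subseteq> basis_index" and Q: "\<forall>Y. finite Y \<and> X \<subseteq> Y \<and> Y \<subseteq> basis_index \<longrightarrow> Q Y"
      unfolding eventually_finite_subsets_at_top by (elim exE conjE)
    show "\<forall>\<^sub>F F in finite_subsets_at_top (wav_index p). Q (insert (0, 0, 0) F)"
      unfolding eventually_finite_subsets_at_top
    proof (intro exI conjI allI impI)
      show "finite (X - {(0, 0, 0)})" "X - {(0, 0, 0)} \<subseteq> wav_index p"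
        using X by (auto simp: basis_index_def)
      fix Y assume "finite Y \<and> X - {(0, 0, 0)} \<subseteq> Y \<and> Y \<subseteq> wav_index p"
      then show "Q (insert (0, 0, 0) Y)"
        by (intro Q[rule_format]) (auto simp: basis_index_def)
    qed
  qed
  ultimately have "((\<lambda>F. \<integral>x. (cmod (?f x - (\<Sum>i\<in>insert (0, 0, 0) F. basis.coeff ?f i * basis i x)))\<^sup>2 \<partial>haar p) \<longlongrightarrow> 0)
      (finite_subsets_at_top (wav_index p))"
    by (rule filterlim_compose)
  from tendsto_real_sqrt[OF this]
  have lim: "((\<lambda>F. l2norm p (\<lambda>x. ?f x - (\<Sum>i\<in>insert (0, 0, 0) F. basis.coeff ?f i * basis i x))) \<longlongrightarrow> 0)
      (finite_subsets_at_top (wav_index p))"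
    by (simp add: l2norm_def)
  show ?thesis
  proof (rule Lim_transform_eventually[OF lim], rule eventually_finite_subsets_at_top_weakI)
    fix F assume F: "finite F" "F \<subseteq> wav_index p"
    have "(\<Sum>i\<in>insert (0, 0, 0) F. basis.coeff ?f i * basis i x)
        = basis.coeff \<psi>0 (0, 0, 0) + (\<Sum>(m, \<beta>, k)\<in>F. basis.coeff \<psi>0 (m, \<beta>, k)
      * exp (\<i> * (Jhat p J (Suc m) - 1) * complex_of_real t) * wavelet p m \<beta> k x)" for x
    proof -
      have "basis.coeff ?f (0, 0, 0) * basis (0, 0, 0) x = basis.coeff \<psi>0 (0, 0, 0)"
      proof -
        have "basis (0, 0, 0) x = 1" by (simp add: basis_def wavelet_0)
        then show ?thesis using coeff[of "(0, 0, 0)"] by (simp add: basis_index_def rate_def)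
      qed
      moreover have "(\<Sum>i\<in>F. basis.coeff ?f i * basis i x) = (\<Sum>(m, \<beta>, k)\<in>F. basis.coeff \<psi>0 (m, \<beta>, k)
          * exp (\<i> * (Jhat p J (Suc m) - 1) * complex_of_real t) * wavelet p m \<beta> k x)"
      proof (rule sum.cong)
        fix i assume "i \<in> F"
        then have i: "i \<in> basis_index" "i \<noteq> (0, 0, 0)"
          using F wav_index_0 by (auto simp: basis_index_def)
        show "basis.coeff ?f i * basis i x = (case i of (m, \<beta>, k) \<Rightarrow> basis.coeff \<psi>0 (m, \<beta>, k)
          * exp (\<i> * (Jhat p J (Suc m) - 1) * complex_of_real t) * wavelet p m \<beta> k x)"
        proof -
          have "rate i = Jhat p J (Suc (fst i))" using i(2) by (simp add: rate_def Jhat_eq)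
          then show ?thesis
            unfolding coeff[OF i(1)] by (cases i) (simp add: basis_def mult_ac)
        qed
      qed simp
      ultimately show ?thesis using F wav_index_0 by (subst sum.insert) auto
    qed
    then show "l2norm p (\<lambda>x. ?f x - (\<Sum>i\<in>insert (0, 0, 0) F. basis.coeff ?f i * basis i x))
      = l2norm p (\<lambda>x. \<Psi> x t - (basis.coeff \<psi>0 (0, 0, 0) + (\<Sum>(m, \<beta>, k)\<in>F. basis.coeff \<psi>0 (m, \<beta>, k)
      * exp (\<i> * (Jhat p J (Suc m) - 1) * complex_of_real t) * wavelet p m \<beta> k x)))"
      by (simp only:)
  qed
qed

theorem IVP_solution_evolution:
  assumes \<psi>0: "L2 p \<psi>0" and norm: "l2norm p \<psi>0 = 1"
  shows "IVP_solution p J \<psi>0 (evolution \<psi>0)"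
proof -
  have sq: "square_integrable (haar p) \<psi>0" using \<psi>0 by (simp add: L2_iff)
  have meas[measurable]: "\<psi>0 \<in> borel_measurable (haar p)" using \<psi>0 by (simp add: L2_def)
  have le1: "(\<integral>\<^sup>+x. norm (\<psi>0 x) \<partial>haar p) \<le> 1"
    using nn_integral_norm_le_l2norm[OF \<psi>0] norm by simp
  have int: "integrable (haar p) \<psi>0"
    by (rule integrableI_bounded) (use le1 in \<open>auto intro: le_less_trans\<close>)
  have ode: "AE x in haar p. (\<forall>t. (evolution \<psi>0 x has_vector_derivative
           \<i> * (T (\<lambda>y. evolution \<psi>0 y t) x - evolution \<psi>0 x t)) (at t)) \<and>
         continuous_on UNIV (\<lambda>t. \<i> * (T (\<lambda>y. evolution \<psi>0 y t) x - evolution \<psi>0 x t))"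
    by (rule evolution_solves[OF meas int])
  have cont: "continuous_on {0..} (evolution \<psi>0 x)"
    if "\<forall>t. (evolution \<psi>0 x has_vector_derivative
           \<i> * (T (\<lambda>y. evolution \<psi>0 y t) x - evolution \<psi>0 x t)) (at t)" for x
    using that has_vector_derivative_continuous by (blast intro: continuous_at_imp_continuous_on)
  have ode': "AE x in haar p. continuous_on {0..} (evolution \<psi>0 x) \<and>
      (\<forall>t>0. (evolution \<psi>0 x has_vector_derivative \<i> * (T (\<lambda>y. evolution \<psi>0 y t) x - evolution \<psi>0 x t)) (at t))"
    using ode by eventually_elim (use cont in blast)
  have sq_t: "square_integrable (haar p) (\<lambda>x. evolution \<psi>0 x t)" for t
    unfolding square_integrable_def
  proof
    have "(\<integral>\<^sup>+x. (ennreal (norm (\<psi>0 x)))\<^sup>2 \<partial>haar p) < \<infinity>"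
      using square_integrableD(2)[OF sq] by (simp add: integrable_iff_bounded ennreal_power)
    then have "(\<integral>\<^sup>+x. (ennreal (norm (evolution \<psi>0 x t)))\<^sup>2 \<partial>haar p) < \<infinity>"
      by (intro le_less_trans[OF nn_integral_norm_evolution_le(2)[OF meas int]]) (simp add: ennreal_mult_less_top)
    then show "integrable (haar p) (\<lambda>x. (cmod (evolution \<psi>0 x t))\<^sup>2)"
      by (intro integrableI_bounded) (simp_all add: ennreal_power)
  qed measurable
  have norm_t: "l2norm p (\<lambda>x. evolution \<psi>0 x t) = 1" if t: "t \<ge> 0" for t
  proof -
    \<comment> \<open>This crude growth suffices to determine the moduli of all coefficients; exact
      conservation of the norm then follows from Parseval.\<close>
    have bound: "(\<integral>\<^sup>+x. norm (evolution \<psi>0 x s) \<partial>haar p) \<le> ennreal (exp t)" if "0 \<le> s" "s \<le> t" for s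
    proof -
      have "(\<integral>\<^sup>+x. norm (evolution \<psi>0 x s) \<partial>haar p) \<le> ennreal (exp \<bar>s\<bar>) * (\<integral>\<^sup>+x. norm (\<psi>0 x) \<partial>haar p)"
        by (rule nn_integral_norm_evolution_le(1)[OF meas int])
      also have "\<dots> \<le> ennreal (exp t) * 1"
        using that le1 by (intro mult_mono ennreal_leI) auto
      finally show ?thesis by simp
    qed
    have "(\<integral>x. (cmod (evolution \<psi>0 x t))\<^sup>2 \<partial>haar p) = (\<integral>x. (cmod (\<psi>0 x))\<^sup>2 \<partial>haar p)"
    proof (rule basis.parseval_eq)
      fix i assume "i \<in> basis_index"
      from coeff_IVP[OF evolution_measurable[OF meas] ode' bound t this]
      show "cmod (basis.coeff (\<lambda>x. evolution \<psi>0 x t) i) = cmod (basis.coeff \<psi>0 i)"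
        by (simp only: norm_mult norm_exp_rate evolution_0 mult_1_left)
    qed (auto intro: square_integrable_approximable sq sq_t)
    then show ?thesis using norm by (simp add: l2norm_def)
  qed
  have "AE x in haar p. continuous_on {0..} (evolution \<psi>0 x) \<and>
        (\<exists>D. (\<forall>t>0. (evolution \<psi>0 x has_vector_derivative D t) (at t)) \<and> continuous_on {0<..} D \<and>
             (\<forall>t>0. \<i> * D t = - Jop p J (\<lambda>y. evolution \<psi>0 y t) x))"
    using ode AE_space
  proof eventually_elim
    case (elim x)
    show ?case
    proof (intro conjI exI)
      show "continuous_on {0..} (evolution \<psi>0 x)" using cont elim(1) by blast
      show "\<forall>t>0. (evolution \<psi>0 x has_vector_derivative \<i> * (T (\<lambda>y. evolution \<psi>0 y t) x - evolution \<psi>0 x t)) (at t)"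
        using elim(1) by blast
      show "continuous_on {0<..} (\<lambda>t. \<i> * (T (\<lambda>y. evolution \<psi>0 y t) x - evolution \<psi>0 x t))"
        using elim(1) continuous_on_subset by blast
      show "\<forall>t>0. \<i> * (\<i> * (T (\<lambda>y. evolution \<psi>0 y t) x - evolution \<psi>0 x t)) = - Jop p J (\<lambda>y. evolution \<psi>0 y t) x"
        by (simp add: Jop_eq[OF elim(2)] flip: mult.assoc)
    qed
  qed
  then show ?thesis
    using sq_t norm_t by (simp add: IVP_solution_def L2_iff evolution_0)
qed

end

text \<open>Choosing the coefficients before the solution expresses uniqueness: at each time all
  solutions are L2 limits of the same sums, so any two agree almost everywhere.\<close>

theorem theorem5:
  fixes p :: nat and J :: "real \<Rightarrow> real" and \<psi>0 :: "(nat \<Rightarrow> nat) \<Rightarrow> complex"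
  assumes "prime p"
    and "\<forall>s\<in>{0..1}. J s \<ge> 0"
    and "integrable (haar p) (\<lambda>x. J (padic_abs p x))"
    and "(\<integral>x. J (padic_abs p x) \<partial>haar p) = 1"
    and "L2 p \<psi>0" and "l2norm p \<psi>0 = 1"
  shows "(\<exists>\<Psi>. IVP_solution p J \<psi>0 \<Psi>) \<and>
         (\<exists>(A0::complex) (A::nat \<times> nat \<times> nat \<Rightarrow> complex).
            \<forall>\<Psi>. IVP_solution p J \<psi>0 \<Psi> \<longrightarrow>
              (\<forall>t\<ge>0. ((\<lambda>F. l2norm p (\<lambda>x. \<Psi> x t -
                   (A0 + (\<Sum>(m, \<beta>, k)\<in>F. A (m, \<beta>, k)
                        * exp (\<i> * (Jhat p J (Suc m) - 1) * complex_of_real t)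
                        * wavelet p m \<beta> k x))))
                 \<longlongrightarrow> 0) (finite_subsets_at_top (wav_index p))))"
proof -
  interpret jump_kernel p J
    using assms prime_ge_2_nat by unfold_locales auto
  show ?thesis
    using IVP_solution_evolution[OF assms(5,6)] IVP_expansion[OF assms(5)] by blast
qed

end
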